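(* Let $d\ge 1$ be fixed. Let $S$ be a set of $n\ge 2$ curves in $\mathbb{R}^d$, each with at most $m$ vertices, and let $r>0$. For any parameter $k\in\{1,\dots,m\}$ there is a number $c\in O(m/k)$ and a randomized data structure for the $(c,r)$-near neighbor problem on $S$ under the discrete Fréchet distance, for query curves in $\mathbb{R}^d$ with at most $m$ vertices, that uses space in $O(2^{2k}m^{k-1}n\log n+nm)$, answers queries in $O(2^{2k}m^{k}\log n)$ time, and answers each query correctly with high probability, i.e., with probability at least $1-1/n$.
   Context: A curve in $\mathbb{R}^d$ is given by its finite sequence of vertices $P=p_1,\dots,p_m\in\mathbb{R}^d$, $m\geq 1$. Given curves $P=p_1,\dots,p_{m_1}$ and $Q=q_1,\dots,q_{m_2}$, a traversal is a sequence of index pairs $T=(i_1,j_1),\dots,(i_\ell,j_\ell)$ with $(i_1,j_1)=(1,1)$, $(i_\ell,j_\ell)=(m_1,m_2)$, and, for every $k<\ell$, $i_{k+1}-i_k\in\{0,1\}$, $j_{k+1}-j_k\in\{0,1\}$ and $(i_{k+1}-i_k)+(j_{k+1}-j_k)\ge 1$. The discrete Fréchet distance is $d_F(P,Q)=\min_{T}\max_{(i,j)\in T}\|p_i-q_j\|$, over all traversals $T$, with $\|\cdot\|$ the Euclidean norm. $(c,r)$-near neighbor problem: preprocess a set $S$ of $n$ curves into a data structure that answers queries as follows: given a query curve $Q$, if there exists $P\in S$ with $d_F(P,Q)\le r$, then report some $P'\in S$ with $d_F(P',Q)\le cr$. Space is measured in memory words and time in elementary operations of a (real) RAM, where a word can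 hold a real coordinate or an $O(\log n)$-bit integer; random choices, arithmetic and rounding take unit time. The dimension $d$ is a constant, so $O(\cdot)$ may hide factors depending on $d$. *)

theory Defs
  imports "HOL-Probability.Probability"
begin

section \<open>Curves and the discrete Frechet distance\<close>

text \<open>Indices are 0-based: vertex $p_i$ of the text is \<open>P ! (i - 1)\<close>.\<close>

type_synonym 'd curve = "(real ^ 'd) list"

definition traversal :: "'a list \<Rightarrow> 'b list \<Rightarrow> (nat \<times> nat) list \<Rightarrow> bool" where
  "traversal P Q T \<longleftrightarrow>
     T \<noteq> [] \<and> hd T = (0, 0) \<and> last T = (length P - 1, length Q - 1) \<and>
     (\<forall>l. Suc l < length T \<longrightarrow>
        int (fst (T ! Suc l)) - int (fst (T ! l)) \<in> {0, 1} \<and>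
        int (snd (T ! Suc l)) - int (snd (T ! l)) \<in> {0, 1} \<and>
        (int (fst (T ! Suc l)) - int (fst (T ! l))) + (int (snd (T ! Suc l)) - int (snd (T ! l))) \<ge> 1)"

definition frechet_dist :: "'d::finite curve \<Rightarrow> 'd curve \<Rightarrow> real" where
  "frechet_dist P Q =
     Min {Max ((\<lambda>(i, j). norm (P ! i - Q ! j)) ` set T) | T. traversal P Q T}"

text \<open>The next two facts show that the minimum ranges over a finite nonempty set, where \<open>Min\<close> is
  meaningful.\<close>

lemma traversal_step:
  assumes "traversal P Q T" "Suc l < length T"
  shows "fst (T ! l) \<le> fst (T ! Suc l)" "snd (T ! l) \<le> snd (T ! Suc l)"
  using assms unfolding traversal_def by auto

lemma traversal_bounds:
  assumes T: "traversal P Q T" and x: "x \<in> set T"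
  shows "fst x \<le> length P - 1 \<and> snd x \<le> length Q - 1"
proof -
  have fin: "T ! (length T - 1) = (length P - 1, length Q - 1)"
    using T by (auto simp: traversal_def last_conv_nth)
  obtain l where l: "l < length T" "x = T ! l"
    using x by (auto simp: in_set_conv_nth)
  have "l \<le> length T - 1"
    using l by simp
  then have "fst (T ! l) \<le> fst (T ! (length T - 1)) \<and> snd (T ! l) \<le> snd (T ! (length T - 1))"
  proof (induction rule: inc_induct)
    case (step n)
    then have "Suc n < length T" by simp
    from traversal_step[OF T this] step.IH show ?case by linarith
  qed simp
  then show ?thesis
    using fin l by simp
qed

lemma frechet_dist_finite:
  "finite {Max ((\<lambda>(i, j). norm (P ! i - Q ! j)) ` set T) | T. traversal P Q T}"
proof (rule finite_subset)
  let ?f = "\<lambda>(i, j). norm (P ! i - Q ! j)"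
  let ?B = "{..length P - 1} \<times> {..length Q - 1}"
  show "{Max (?f ` set T) | T. traversal P Q T} \<subseteq> ?f ` ?B"
  proof
    fix v assume "v \<in> {Max (?f ` set T) | T. traversal P Q T}"
    then obtain T where v: "v = Max (?f ` set T)" and T: "traversal P Q T" by blast
    have "set T \<subseteq> ?B"
      using traversal_bounds[OF T] by fastforce
    moreover have "Max (?f ` set T) \<in> ?f ` set T"
      using T by (intro Max_in) (auto simp: traversal_def)
    ultimately show "v \<in> ?f ` ?B" using v by blast
  qed
qed auto

lemma traversal_exists: "\<exists>T. traversal P Q T"
proof -
  let ?a = "length P - 1" and ?b = "length Q - 1"
  let ?f = "\<lambda>l. (min l ?a, l - ?a)"
  let ?T = "map ?f [0..<Suc (?a + ?b)]"
  have "hd ?T = (0, 0)"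
    by (subst hd_conv_nth) (auto simp del: upt_Suc)
  moreover have "last ?T = (?a, ?b)"
    by simp
  ultimately have "traversal P Q ?T"
    unfolding traversal_def by (auto simp del: upt_Suc simp: min_def)
  then show ?thesis ..
qed

section \<open>A randomised real RAM\<close>

text \<open>Programs run on a register machine whose words hold reals; integers (counters, indices,
  addresses) are reals with an integral value. Each arithmetic operation, comparison, memory access,
  rounding \<open>Floor\<close>, assignment, test and random choice costs one time unit. \<open>Rand\<close> draws a fresh
  uniform real from $[0,1)$. A program mentions only a fixed finite set of registers, and its literals
  are integers. An address is rounded down, with negative ones read as 0.\<close>

datatype expr =
    Lit int
  | Reg nat
  | Mem expr
  | Inp expr
  | Add expr expr
  | Sub expr expr
  | Mul expr expr
  | Quo expr expr
  | Floor expr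

datatype test = Less expr expr | NotT test | AndT test test

datatype prog =
    Assign nat expr
  | Store expr expr
  | Rand nat
  | Seq prog prog
  | Cond test prog prog
  | While test prog

record state =
  regs :: "nat \<Rightarrow> real"
  mem :: "nat \<Rightarrow> real"
  tape :: "nat \<Rightarrow> real"

definition addr :: "real \<Rightarrow> nat" where
  "addr v = nat \<lfloor>v\<rfloor>"

text \<open>The first argument is the read-only input; cells past its end read as 0.\<close>

fun eval :: "real list \<Rightarrow> state \<Rightarrow> expr \<Rightarrow> real" where
  "eval I \<sigma> (Lit z) = real_of_int z"
| "eval I \<sigma> (Reg x) = regs \<sigma> x"
| "eval I \<sigma> (Mem e) = mem \<sigma> (addr (eval I \<sigma> e))"
| "eval I \<sigma> (Inp e) = (let a = addr (eval I \<sigma> e) in if a < length I then I ! a else 0)"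
| "eval I \<sigma> (Add e f) = eval I \<sigma> e + eval I \<sigma> f"
| "eval I \<sigma> (Sub e f) = eval I \<sigma> e - eval I \<sigma> f"
| "eval I \<sigma> (Mul e f) = eval I \<sigma> e * eval I \<sigma> f"
| "eval I \<sigma> (Quo e f) = eval I \<sigma> e / eval I \<sigma> f"
| "eval I \<sigma> (Floor e) = real_of_int \<lfloor>eval I \<sigma> e\<rfloor>"

fun holds :: "real list \<Rightarrow> state \<Rightarrow> test \<Rightarrow> bool" where
  "holds I \<sigma> (Less e f) = (eval I \<sigma> e < eval I \<sigma> f)"
| "holds I \<sigma> (NotT b) = (\<not> holds I \<sigma> b)"
| "holds I \<sigma> (AndT b c) = (holds I \<sigma> b \<and> holds I \<sigma> c)"

fun ecost :: "expr \<Rightarrow> nat" where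
  "ecost (Lit z) = 1"
| "ecost (Reg x) = 1"
| "ecost (Mem e) = ecost e + 1"
| "ecost (Inp e) = ecost e + 1"
| "ecost (Add e f) = ecost e + ecost f + 1"
| "ecost (Sub e f) = ecost e + ecost f + 1"
| "ecost (Mul e f) = ecost e + ecost f + 1"
| "ecost (Quo e f) = ecost e + ecost f + 1"
| "ecost (Floor e) = ecost e + 1"

fun tcost :: "test \<Rightarrow> nat" where
  "tcost (Less e f) = ecost e + ecost f + 1"
| "tcost (NotT b) = tcost b + 1"
| "tcost (AndT b c) = tcost b + tcost c + 1"

text \<open>\<open>exec I W p \<sigma> t \<tau>\<close>: with input \<open>I\<close>, started in state \<open>\<sigma>\<close>, program \<open>p\<close> halts in state \<open>\<tau>\<close> after
  \<open>t\<close> time units and writes only to memory cells in \<open>W\<close>. A write outside \<open>W\<close> leaves the machine stuck,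
  so that no \<open>t\<close> and \<open>\<tau>\<close> exist.\<close>

inductive exec :: "real list \<Rightarrow> nat set \<Rightarrow> prog \<Rightarrow> state \<Rightarrow> nat \<Rightarrow> state \<Rightarrow> bool"
  for I W where
  Assign: "exec I W (Assign x e) \<sigma> (ecost e + 1) (\<sigma>\<lparr>regs := (regs \<sigma>)(x := eval I \<sigma> e)\<rparr>)"
| Store: "addr (eval I \<sigma> a) \<in> W \<Longrightarrow>
    exec I W (Store a e) \<sigma> (ecost a + ecost e + 1)
      (\<sigma>\<lparr>mem := (mem \<sigma>)(addr (eval I \<sigma> a) := eval I \<sigma> e)\<rparr>)"
| Rand: "exec I W (Rand x) \<sigma> 1
    (\<sigma>\<lparr>regs := (regs \<sigma>)(x := tape \<sigma> 0), tape := (\<lambda>i. tape \<sigma> (Suc i))\<rparr>)"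
| Seq: "exec I W p \<sigma> t \<sigma>' \<Longrightarrow> exec I W q \<sigma>' u \<tau> \<Longrightarrow> exec I W (Seq p q) \<sigma> (t + u) \<tau>"
| CondT: "holds I \<sigma> b \<Longrightarrow> exec I W p \<sigma> t \<tau> \<Longrightarrow> exec I W (Cond b p q) \<sigma> (tcost b + 1 + t) \<tau>"
| CondF: "\<not> holds I \<sigma> b \<Longrightarrow> exec I W q \<sigma> t \<tau> \<Longrightarrow> exec I W (Cond b p q) \<sigma> (tcost b + 1 + t) \<tau>"
| WhileF: "\<not> holds I \<sigma> b \<Longrightarrow> exec I W (While b p) \<sigma> (tcost b + 1) \<sigma>"
| WhileT: "holds I \<sigma> b \<Longrightarrow> exec I W p \<sigma> t \<sigma>' \<Longrightarrow> exec I W (While b p) \<sigma>' u \<tau> \<Longrightarrow>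
    exec I W (While b p) \<sigma> (tcost b + 1 + t + u) \<tau>"

inductive_cases exec_AssignE: "exec I W (Assign x e) \<sigma> t \<tau>"
inductive_cases exec_StoreE: "exec I W (Store a e) \<sigma> t \<tau>"
inductive_cases exec_RandE: "exec I W (Rand x) \<sigma> t \<tau>"
inductive_cases exec_SeqE: "exec I W (Seq p q) \<sigma> t \<tau>"
inductive_cases exec_CondE: "exec I W (Cond b p q) \<sigma> t \<tau>"
inductive_cases exec_WhileE: "exec I W (While b p) \<sigma> t \<tau>"

lemma exec_deterministic:
  "exec I W p \<sigma> t \<tau> \<Longrightarrow> exec I W p \<sigma> t' \<tau>' \<Longrightarrow> t' = t \<and> \<tau>' = \<tau>"
proof (induction arbitrary: t' \<tau>' rule: exec.induct)
  case (Assign x e \<sigma>)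
  then show ?case by (rule exec_AssignE) simp
next
  case (Store \<sigma> a e)
  from Store.prems show ?case by (rule exec_StoreE) simp
next
  case (Rand x \<sigma>)
  then show ?case by (rule exec_RandE) simp
next
  case (Seq p \<sigma> t \<sigma>' q u \<tau>)
  from Seq.prems obtain t1 \<sigma>1 t2 where
    "exec I W p \<sigma> t1 \<sigma>1" and *: "exec I W q \<sigma>1 t2 \<tau>'" "t' = t1 + t2"
    by (rule exec_SeqE)
  with Seq.IH(1) have "t1 = t" "\<sigma>1 = \<sigma>'" by simp_all
  with * Seq.IH(2)[of t2 \<tau>'] show ?case by simp
next
  case (CondT \<sigma> b p t \<tau> q)
  from CondT.prems show ?case
  proof (rule exec_CondE)
    fix u assume "t' = Suc (tcost b + u)" "exec I W p \<sigma> u \<tau>'"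
    with CondT.IH[of u \<tau>'] show ?thesis by simp
  qed (simp add: CondT.hyps)
next
  case (CondF \<sigma> b q t \<tau> p)
  from CondF.prems show ?case
  proof (rule exec_CondE)
    fix u assume "t' = Suc (tcost b + u)" "exec I W q \<sigma> u \<tau>'"
    with CondF.IH[of u \<tau>'] show ?thesis by simp
  qed (simp add: CondF.hyps)
next
  case (WhileF \<sigma> b p)
  from WhileF.prems show ?case
    by (rule exec_WhileE) (simp_all add: WhileF.hyps)
next
  case (WhileT \<sigma> b p t \<sigma>' u \<tau>)
  from WhileT.prems show ?case
  proof (rule exec_WhileE)
    fix t1 \<sigma>1 t2
    assume *: "t' = Suc (tcost b + t1 + t2)" "exec I W p \<sigma> t1 \<sigma>1" "exec I W (While b p) \<sigma>1 t2 \<tau>'"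
    with WhileT.IH(1) have "t1 = t" "\<sigma>1 = \<sigma>'" by simp_all
    with * WhileT.IH(2)[of t2 \<tau>'] show ?thesis by simp
  qed (simp add: WhileT.hyps)
qed

text \<open>The random source: an infinite sequence of independent uniform reals from $[0,1)$.\<close>

definition tapes :: "(nat \<Rightarrow> real) measure" where
  "tapes = Pi\<^sub>M UNIV (\<lambda>_. restrict_space lborel {0..<1})"

lemma prob_space_tapes: "prob_space tapes"
proof -
  have "prob_space (restrict_space lborel {0..<1::real})"
    by (rule prob_spaceI) (simp add: space_restrict_space emeasure_restrict_space)
  then show ?thesis
    unfolding tapes_def by (rule prob_space_PiM)
qed

section \<open>Randomised data structures for the near neighbor problem\<close>

text \<open>\<open>coords\<close> fixes the order in which the coordinates of a point are listed. A curve is stored as its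
  number of vertices followed by their coordinates.\<close>

definition coords :: "'d::finite list" where
  "coords = (SOME l. distinct l \<and> set l = UNIV)"

definition enc_curve :: "'d::finite curve \<Rightarrow> real list" where
  "enc_curve P = real (length P) # concat (map (\<lambda>p. map (\<lambda>i. p $ i) coords) P)"

definition enc_curves :: "'d::finite curve list \<Rightarrow> real list" where
  "enc_curves Ps = concat (map enc_curve Ps)"

text \<open>The preprocessing program gets the curves as its input and the numbers of curves, \<open>m\<close>, \<open>k\<close> and
  \<open>r\<close> in registers 0 to 3. When it halts, register 0 holds a number \<open>s\<close> and the data structure consists
  of the first \<open>s\<close> memory cells. Time and working memory of the preprocessing are not bounded.\<close>

definition prep_state :: "nat \<Rightarrow> nat \<Rightarrow> nat \<Rightarrow> real \<Rightarrow> (nat \<Rightarrow> real) \<Rightarrow> state" where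
  "prep_state n m k r \<omega> =
     \<lparr>regs = (\<lambda>_. 0)(0 := real n, 1 := real m, 2 := real k, 3 := r), mem = (\<lambda>_. 0), tape = \<omega>\<rparr>"

definition builds ::
  "prog \<Rightarrow> 'd::finite curve list \<Rightarrow> nat \<Rightarrow> nat \<Rightarrow> real \<Rightarrow> (nat \<Rightarrow> real) \<Rightarrow> (nat \<Rightarrow> real) \<Rightarrow> nat \<Rightarrow> bool" where
  "builds pre Ps m k r \<omega> D s \<longleftrightarrow>
     (\<exists>t \<tau>. exec (enc_curves Ps) UNIV pre (prep_state (length Ps) m k r \<omega>) t \<tau> \<and>
        mem \<tau> = D \<and> regs \<tau> 0 = real s)"

text \<open>A query sees the data structure in cells \<open>0..<s\<close>. The other cells have arbitrary contents
  \<open>junk\<close>, e.g. left over from earlier queries. Its random choices are \<open>\<eta>\<close>.\<close>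

definition query_state :: "(nat \<Rightarrow> real) \<Rightarrow> nat \<Rightarrow> (nat \<Rightarrow> real) \<Rightarrow> (nat \<Rightarrow> real) \<Rightarrow> state" where
  "query_state D s junk \<eta> =
     \<lparr>regs = (\<lambda>_. 0), mem = (\<lambda>a. if a < s then D a else junk a), tape = \<eta>\<rparr>"

text \<open>The answer \<open>v\<close> of a query is the position of the reported curve in the input.\<close>

definition correct_answer ::
  "'d::finite curve list \<Rightarrow> real \<Rightarrow> real \<Rightarrow> 'd curve \<Rightarrow> real \<Rightarrow> bool" where
  "correct_answer Ps c r Q v \<longleftrightarrow>
     ((\<exists>P\<in>set Ps. frechet_dist P Q \<le> r) \<longrightarrow>
      (\<exists>i<length Ps. v = real i \<and> frechet_dist (Ps ! i) Q \<le> c * r))"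

text \<open>A randomised data structure for the $(c,r)$-near neighbor problem on the curves \<open>Ps\<close>, for queries
  with at most \<open>m\<close> vertices.

  \<^item> For all random choices, the data structure together with the working memory of a query takes at
    most \<open>space\<close> words, a query halts within \<open>time\<close> steps, and it writes only outside the data
    structure.
  \<^item> For every fixed query, the answer is correct with probability at least \<open>p\<close> over the random choices
    of preprocessing and query. This is expressed by a measurable event of probability at least \<open>p\<close> on
    which the answer is correct.\<close>

definition near_neighbor_structure ::
  "prog \<Rightarrow> prog \<Rightarrow> 'd::finite curve list \<Rightarrow> nat \<Rightarrow> nat \<Rightarrow> real \<Rightarrow> real \<Rightarrow> real \<Rightarrow> real \<Rightarrow> real \<Rightarrow> bool" where
  "near_neighbor_structure pre qry Ps m k r c space_bd time_bd p \<longleftrightarrow>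
     (\<forall>\<omega>\<in>space tapes. \<exists>D s. builds pre Ps m k r \<omega> D s \<and> real s \<le> space_bd \<and>
        (\<forall>Q. 1 \<le> length Q \<and> length Q \<le> m \<longrightarrow>
          (\<forall>\<eta>\<in>space tapes. \<forall>junk. \<exists>t \<tau>.
             exec (enc_curve (Q :: 'd curve)) {a. s \<le> a \<and> real (Suc a) \<le> space_bd} qry
               (query_state D s junk \<eta>) t \<tau> \<and>
             real t \<le> time_bd))) \<and>
     (\<forall>Q. 1 \<le> length Q \<and> length Q \<le> m \<longrightarrow>
        (\<exists>E\<in>sets (tapes \<Otimes>\<^sub>M tapes). p \<le> measure (tapes \<Otimes>\<^sub>M tapes) E \<and>
          (\<forall>(\<omega>, \<eta>)\<in>E. \<forall>D s junk t \<tau>.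
             builds pre Ps m k r \<omega> D s \<longrightarrow>
             exec (enc_curve Q) {a. s \<le> a \<and> real (Suc a) \<le> space_bd} qry
               (query_state D s junk \<eta>) t \<tau> \<longrightarrow>
             correct_answer Ps c r Q (regs \<tau> 0))))"

end

(* All coordinates are rounded to multiples of r, and a stored curve is cut into at most k blocks of
   w = m div k + 1 consecutive vertices. Each block gets one of s = 4dw shifts of a grid of cell width
   s * r; at most half of these shifts put a vertex of the block next to a cell boundary. If a shift
   vector avoids this in every block, then along a matching of cost at most r a query visits exactly the
   cells of the stored curve; conversely, equal cell sequences (without adjacent repetitions) bound the
   distance by d * s * r = O(m / k) * r. The query tries the (2m)^(k-1) ways to split itself into parts
   matched to the blocks.

   A random shift vector suits a given curve with probability at least 2^-k, so by greedy covering
   O(2^k * L) shift vectors suit all curves, with L the logarithm of the number of different patterns of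
   admissible shifts. This number is at most n and at most 2^(sk), so L = O(min (log n) m), and a binary
   search per probe is affordable because min (log n) m * (m + log n) <= 2 * m * log n. As the time
   of preprocessing is unbounded, it finds the shift vectors by exhaustive search, and the structure
   is always correct. Cell sequences become single reals by continued fractions. *)


theory Submission
  imports Defs
begin

section \<open>Matchings of lists\<close>

text \<open>Each curve is stored under one key only, its code for one shift vector that suits it;
  the query bears the cost of trying all shift vectors and all walks. Since the query cannot know
  which shift vector lies behind a key, the argument is asymmetric: soundness of a hit must not
  depend on the shifts at all, and only completeness uses a common shift vector. The shift vectors
  need no table either: they are the digits of one integer in base \<open>s ^ k\<close>, kept in a
  single cell, so the structure has \<open>2 * n + 8\<close> words.

  After rounding, a move by at most \<open>r\<close> changes each coordinate by at most 1. A shift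
  is bad for a coordinate only if it makes it the first or the last position of its cell, so each
  coordinate spoils at most two of the \<open>s\<close> shifts. A block has at most
  \<open>d * w\<close> coordinates, and \<open>s = 4 * d * w\<close> makes the spoilt shifts at most
  half.

  The base \<open>2 * m\<close> of walks combines the last query index of a block with one bit
  telling whether the query advances together with the block. The last block always extends to the
  end of the query, so its digit is forced; this is the origin of the exponent
  \<open>k - 1\<close>.\<close>

fun fr :: "('a \<Rightarrow> 'b \<Rightarrow> bool) \<Rightarrow> 'a list \<Rightarrow> 'b list \<Rightarrow> bool" where
  "fr R (x # xs) (y # ys) \<longleftrightarrow>
     R x y \<and> (xs = [] \<and> ys = [] \<or> fr R xs (y # ys) \<or> fr R (x # xs) ys \<or> fr R xs ys)"
| "fr R [] ys = False"
| "fr R xs [] = False"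

lemma fr_mono: "fr R xs ys \<Longrightarrow> (\<And>x y. x \<in> set xs \<Longrightarrow> y \<in> set ys \<Longrightarrow> R x y \<Longrightarrow> R' x y) \<Longrightarrow> fr R' xs ys"
  by (induction R xs ys rule: fr.induct) auto

section \<open>Traversals as matchings of index intervals\<close>

definition stp :: "nat \<times> nat \<Rightarrow> nat \<times> nat \<Rightarrow> bool" where
  "stp u v \<longleftrightarrow> v \<in> {(Suc (fst u), snd u), (fst u, Suc (snd u)), (Suc (fst u), Suc (snd u))}"

text \<open>Increments in {0, 1} with sum at least 1 leave exactly the three steps of
  \<open>stp\<close>; the form with \<open>successively\<close> suits list induction.\<close>

lemma traversal_iff:
  "traversal P Q T \<longleftrightarrow> T \<noteq> [] \<and> hd T = (0, 0) \<and> last T = (length P - 1, length Q - 1) \<and> successively stp T"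
proof -
  have "stp u v \<longleftrightarrow> int (fst v) - int (fst u) \<in> {0, 1} \<and> int (snd v) - int (snd u) \<in> {0, 1} \<and>
      (int (fst v) - int (fst u)) + (int (snd v) - int (snd u)) \<ge> 1" for u v
    by (cases u; cases v) (auto simp: stp_def)
  then show ?thesis
    unfolding traversal_def successively_conv_nth by simp
qed

text \<open>One unfolding of \<open>fr\<close> that keeps the remaining lists as index intervals, so
  that inductions can speak of the start indices only.\<close>

lemma fr_upt:
  assumes "i < a" "j < b"
  shows "fr R [i..<a] [j..<b] \<longleftrightarrow> R i j \<and> (Suc i \<ge> a \<and> Suc j \<ge> b \<or>
    fr R [Suc i..<a] [j..<b] \<or> fr R [i..<a] [Suc j..<b] \<or> fr R [Suc i..<a] [Suc j..<b])"
proof -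
  have a: "[i..<a] = i # [Suc i..<a]" and b: "[j..<b] = j # [Suc j..<b]"
    using assms by (simp_all add: upt_conv_Cons)
  show ?thesis
    by (subst (1) a, subst (1) b, subst fr.simps) (simp only: a[symmetric] b[symmetric] upt_eq_Nil_conv, auto)
qed

text \<open>Each step of the path selects one case of the recursion of \<open>fr\<close>. The bounds
  on \<open>i\<close> and \<open>j\<close> stand in the conclusion because they come from the end of
  the path: steps never decrease an index.\<close>

lemma stp_path_fr:
  assumes "T \<noteq> []" "hd T = (i, j)" "last T = (a - 1, b - 1)" "successively stp T" "a > 0" "b > 0"
    and "\<forall>(i, j) \<in> set T. R i j"
  shows "i < a \<and> j < b \<and> fr R [i..<a] [j..<b]"
  using assms
proof (induction T arbitrary: i j)
  case (Cons u T)
  have u: "u = (i, j)" using Cons.prems by simp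
  show ?case
  proof (cases T)
    case Nil
    then show ?thesis using Cons.prems u by (simp add: upt_conv_Cons)
  next
    case (Cons v T')
    obtain i' j' where v: "v = (i', j')" by (cases v)
    have IH: "i' < a \<and> j' < b \<and> fr R [i'..<a] [j'..<b]"
      using Cons.IH[of i' j'] Cons.prems Cons v by (auto simp: successively_Cons)
    have "stp (i, j) (i', j')" using Cons.prems Cons u v by (auto simp: successively_Cons)
    then consider "i' = Suc i" "j' = j" | "i' = i" "j' = Suc j" | "i' = Suc i" "j' = Suc j"
      by (auto simp: stp_def)
    moreover have "R i j" using Cons.prems u by simp
    ultimately show ?thesis using IH by cases (simp_all add: fr_upt)
  qed
qed simp

text \<open>The successful branch of the recursion of \<open>fr\<close> is itself the traversal:
  each case prepends the current pair to the path of the recursive call.\<close>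

lemma fr_stp_path:
  assumes "fr R xs ys" "xs = [i..<a]" "ys = [j..<b]"
  shows "\<exists>T. T \<noteq> [] \<and> hd T = (i, j) \<and> last T = (a - 1, b - 1) \<and> successively stp T \<and>
    (\<forall>(i, j) \<in> set T. R i j)"
  using assms
proof (induction R xs ys arbitrary: i j rule: fr.induct)
  case (1 R x xs y ys)
  have "i < a" "j < b" using 1(5,6) by (auto intro: ccontr)
  then have x: "x = i" "xs = [Suc i..<a]" and y: "y = j" "ys = [Suc j..<b]"
    using 1(5,6) by (auto simp: upt_conv_Cons)
  have R: "R i j" using 1(4) x y by simp
  have ext: "?case" if "T \<noteq> []" "hd T = (i', j')" "stp (i, j) (i', j')" "last T = (a - 1, b - 1)"
    "successively stp T" "\<forall>(i, j) \<in> set T. R i j" for i' j' T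
    using that R by (intro exI[of _ "(i, j) # T"]) (auto simp: successively_Cons)
  have cons: "x # xs = [i..<a]" "y # ys = [j..<b]" by (fact 1(5) 1(6))+
  from 1(4) consider "xs = []" "ys = []" | "fr R xs (y # ys)" | "fr R (x # xs) ys" | "fr R xs ys"
    by auto
  then show ?case
  proof cases
    case 1
    then have "a = Suc i" "b = Suc j" using x y \<open>i < a\<close> \<open>j < b\<close> by auto
    then show ?thesis using R by (intro exI[of _ "[(i, j)]"]) auto
  next
    case 2
    from "1.IH"(1)[OF this x(2) cons(2)] obtain T where "T \<noteq> []" "hd T = (Suc i, j)"
      "last T = (a - 1, b - 1)" "successively stp T" "\<forall>(i, j) \<in> set T. R i j"
      by auto
    with ext[of T "Suc i" j] show ?thesis by (simp add: stp_def)
  next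
    case 3
    from "1.IH"(2)[OF this cons(1) y(2)] obtain T where "T \<noteq> []" "hd T = (i, Suc j)"
      "last T = (a - 1, b - 1)" "successively stp T" "\<forall>(i, j) \<in> set T. R i j"
      by auto
    with ext[of T i "Suc j"] show ?thesis by (simp add: stp_def)
  next
    case 4
    from "1.IH"(3)[OF this x(2) y(2)] obtain T where "T \<noteq> []" "hd T = (Suc i, Suc j)"
      "last T = (a - 1, b - 1)" "successively stp T" "\<forall>(i, j) \<in> set T. R i j"
      by auto
    with ext[of T "Suc i" "Suc j"] show ?thesis by (simp add: stp_def)
  qed
next
  case (2 R ys)
  from 2(1) show ?case by simp
next
  case (3 R v va)
  from 3(1) show ?case by simp
qed

text \<open>A minimum of maxima is at most \<open>D\<close> iff some traversal has all its pairs at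
  most \<open>D\<close> apart. The geometric arguments below use the distance only through this
  decision form.\<close>

lemma frechet_dist_le_iff:
  assumes "P \<noteq> []" "Q \<noteq> []"
  shows "frechet_dist P Q \<le> D \<longleftrightarrow>
    fr (\<lambda>i j. norm (P ! i - Q ! j) \<le> D) [0..<length P] [0..<length Q]" (is "_ \<longleftrightarrow> ?fr")
proof -
  let ?f = "\<lambda>(i, j). norm (P ! i - Q ! j)"
  have "frechet_dist P Q \<le> D \<longleftrightarrow> (\<exists>T. traversal P Q T \<and> Max (?f ` set T) \<le> D)"
    unfolding frechet_dist_def
    using frechet_dist_finite[of P Q] traversal_exists[of P Q] by (subst Min_le_iff) auto
  also have "\<dots> \<longleftrightarrow> (\<exists>T. traversal P Q T \<and> (\<forall>(i, j) \<in> set T. norm (P ! i - Q ! j) \<le> D))"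
    by (intro ex_cong1 conj_cong refl, subst Max_le_iff) (auto simp: traversal_def)
  also have "\<dots> \<longleftrightarrow> ?fr"
  proof
    assume "\<exists>T. traversal P Q T \<and> (\<forall>(i, j) \<in> set T. norm (P ! i - Q ! j) \<le> D)"
    then show ?fr
      using stp_path_fr[of _ 0 0 "length P" "length Q" "\<lambda>i j. norm (P ! i - Q ! j) \<le> D"] assms
      by (auto simp: traversal_iff)
  next
    assume ?fr
    from fr_stp_path[OF this refl refl]
    show "\<exists>T. traversal P Q T \<and> (\<forall>(i, j) \<in> set T. norm (P ! i - Q ! j) \<le> D)"
      by (auto simp: traversal_iff)
  qed
  finally show ?thesis .
qed

section \<open>Matchings and adjacent repetitions\<close>

lemma remdups_adj_Cons_conv:
  "remdups_adj (x # xs) =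
    (if xs \<noteq> [] \<and> hd xs = x then remdups_adj xs else x # remdups_adj xs)"
  by (cases xs) auto

text \<open>Whatever is matched to one of two equal neighbours can be matched to the remaining copy;
  a diagonal move into the second copy becomes a move in \<open>xs\<close> alone.\<close>

lemma fr_remdups_adj: "fr R xs ys \<Longrightarrow> fr R xs (remdups_adj ys)"
proof (induction R xs ys rule: fr.induct)
  case (1 R x xs y ys)
  obtain ys' where ys': "remdups_adj (y # ys) = y # ys'"
    by (metis remdups_adj_Cons_alt)
  from "1.prems" consider "xs = []" "ys = []" | "fr R xs (y # ys)" | "fr R (x # xs) ys" | "fr R xs ys"
    by auto
  then show ?case
  proof cases
    case 2
    then show ?thesis using "1.IH"(1) "1.prems" ys' by simp
  next
    case 3
    with "1.IH"(2) "1.prems" show ?thesis by (auto simp: remdups_adj_Cons_conv)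
  next
    case 4
    then have "fr R xs (remdups_adj ys)" by (rule "1.IH"(3))
    moreover have "remdups_adj (y # ys) = remdups_adj ys \<or> remdups_adj (y # ys) = y # remdups_adj ys"
      by (simp add: remdups_adj_Cons_conv)
    ultimately show ?thesis using "1.prems" ys' by auto
  qed (use "1.prems" in auto)
qed auto

text \<open>The runs of equal labels on the two sides correspond in order. A matching can use up the
  current run on either side one element at a time and then enter the next pair of runs
  diagonally.\<close>

lemma remdups_adj_eq_fr:
  "remdups_adj (map f xs) = remdups_adj (map g ys) \<Longrightarrow> xs \<noteq> [] \<Longrightarrow> ys \<noteq> [] \<Longrightarrow>
    fr (\<lambda>x y. f x = g y) xs ys"
proof (induction "length xs + length ys" arbitrary: xs ys rule: less_induct)
  case less
  obtain x xs' y ys' where xs: "xs = x # xs'" and ys: "ys = y # ys'"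
    using less.prems by (meson list.exhaust)
  have hd: "f x = g y"
    using less.prems(1) unfolding xs ys by (metis hd_remdups_adj list.sel(1) list.simps(9))
  consider (a) x' xs'' where "xs' = x' # xs''" "f x' = f x" | (b) y' ys'' where "ys' = y' # ys''" "g y' = g y"
    | (c) "xs' = [] \<or> f (hd xs') \<noteq> f x" "ys' = [] \<or> g (hd ys') \<noteq> g y"
    by (metis hd_Cons_tl)
  then show ?case
  proof cases
    case a
    then have "fr (\<lambda>x y. f x = g y) xs' ys"
      using less xs by (intro less.hyps) auto
    then show ?thesis using hd xs ys by simp
  next
    case b
    then have "fr (\<lambda>x y. f x = g y) xs ys'"
      using less ys by (intro less.hyps) auto
    then show ?thesis using hd xs ys by simp
  next
    case c
    then have "remdups_adj (map f xs') = remdups_adj (map g ys')"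
      using less.prems(1) hd by (cases xs'; cases ys') (auto simp: xs ys)
    moreover from this have "xs' = [] \<longleftrightarrow> ys' = []"
      by (metis map_is_Nil_conv remdups_adj_Nil_iff)
    ultimately have "xs' = [] \<and> ys' = [] \<or> fr (\<lambda>x y. f x = g y) xs' ys'"
      using less.hyps[of xs' ys'] xs ys by auto
    then show ?thesis using hd unfolding xs ys fr.simps(1) by blast
  qed
qed

section \<open>Coding integer sequences by real numbers\<close>

text \<open>A step of a continued fraction: the inverse of \<open>pushc c a\<close> has fractional part \<open>c\<close>, and
  \<open>a * (2 * a + 1)\<close> is the triangular number of index \<open>2 * a\<close> or \<open>- 2 * a - 1\<close>, hence determines \<open>a\<close>.\<close>

definition pushc :: "real \<Rightarrow> int \<Rightarrow> real" where
  "pushc c a = 1 / (2 + c + of_int (a * (2 * a + 1)))"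

lemma int_code_nonneg: "0 \<le> a * (2 * a + 1)" for a :: int
  by (cases "0 \<le> a") (auto simp: mult_nonpos_nonpos)

lemma int_code_inj:
  fixes a b :: int
  assumes "a * (2 * a + 1) = b * (2 * b + 1)"
  shows "a = b"
proof -
  have "(a - b) * (2 * (a + b) + 1) = 0"
    using assms by (simp add: algebra_simps)
  moreover have "2 * (a + b) + 1 \<noteq> 0" by presburger
  ultimately show ?thesis by simp
qed

text \<open>The summand 2 keeps the denominator above 1 even for \<open>c = 0\<close> and
  \<open>a = 0\<close>. Codes therefore stay strictly between 0 and 1, and 0 is left for the empty
  list.\<close>

lemma pushc_range: "0 \<le> c \<Longrightarrow> 0 < pushc c a \<and> pushc c a < 1"
proof -
  assume "0 \<le> c"
  moreover have "0 \<le> real_of_int (a * (2 * a + 1))"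
    using int_code_nonneg[of a] by (simp only: of_int_0_le_iff)
  ultimately have "1 < 2 + c + real_of_int (a * (2 * a + 1))" by linarith
  then show ?thesis unfolding pushc_def by (auto simp only: divide_less_eq_1 zero_less_divide_1_iff)
qed

lemma pushc_inj:
  assumes "pushc c a = pushc c' a'" "0 \<le> c" "c < 1" "0 \<le> c'" "c' < 1"
  shows "c = c' \<and> a = a'"
proof -
  define N where "N = a * (2 * a + 1)"
  define N' where "N' = a' * (2 * a' + 1)"
  have "inverse (2 + c + of_int N) = inverse (2 + c' + of_int N')"
    using assms(1) unfolding pushc_def N_def N'_def inverse_eq_divide .
  then have eq: "c + of_int N = c' + of_int N'" by (simp only: inverse_eq_iff_eq)
  then have "N < N' + 1" "N' < N + 1" using assms(2-) by linarith+
  then have "N = N'" by linarith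
  then show ?thesis using eq int_code_inj[of a a'] by (simp add: N_def N'_def)
qed

lemma foldl_pushc_range: "0 \<le> c \<Longrightarrow> c < 1 \<Longrightarrow> 0 \<le> foldl pushc c xs \<and> foldl pushc c xs < 1"
  by (induction xs arbitrary: c) (auto simp: less_imp_le pushc_range)

lemma foldl_pushc_inj:
  assumes "foldl pushc c xs = foldl pushc c' xs'" "length xs = length xs'"
    "0 \<le> c" "c < 1" "0 \<le> c'" "c' < 1"
  shows "c = c' \<and> xs = xs'"
  using assms(2,1,3-)
proof (induction xs xs' arbitrary: c c' rule: list_induct2)
  case (Cons x xs y ys)
  have "pushc c x = pushc c' y \<and> xs = ys"
    using Cons.prems by (intro Cons.IH) (auto simp: less_imp_le pushc_range)
  then show ?case using pushc_inj Cons.prems by blast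
qed simp

text \<open>Lengths may differ here: a push never yields 0, so decoding from the last element
  backwards stops exactly when the seed 0 is reached.\<close>

lemma foldl_pushc_0_inj:
  "foldl pushc 0 xs = foldl pushc 0 ys \<Longrightarrow> xs = ys"
proof (induction xs arbitrary: ys rule: rev_induct)
  case Nil
  show ?case
  proof (cases ys rule: rev_cases)
    case (snoc ys' y)
    with Nil foldl_pushc_range[of 0 ys'] pushc_range[of "foldl pushc 0 ys'" y] show ?thesis by auto
  qed simp
next
  case (snoc x xs)
  show ?case
  proof (cases ys rule: rev_cases)
    case Nil
    with snoc.prems foldl_pushc_range[of 0 xs] pushc_range[of "foldl pushc 0 xs" x] show ?thesis by auto
  next
    fix ys' y assume ys: "ys = ys' @ [y]"
    with snoc.prems have "pushc (foldl pushc 0 xs) x = pushc (foldl pushc 0 ys') y" by simp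
    from pushc_inj[OF this] snoc.IH[of ys'] ys foldl_pushc_range[of 0] show ?thesis by auto
  qed
qed

text \<open>The first component is the code before the last element was pushed, so that a repetition of this
  element is recognised by comparing two reals.\<close>

definition dstep :: "real \<times> real \<Rightarrow> int list \<Rightarrow> real \<times> real" where
  "dstep u e = (if foldl pushc (fst u) e = snd u then u else (snd u, foldl pushc (snd u) e))"

text \<open>For a fixed element \<open>dstep\<close> is idempotent: after pushing \<open>e\<close>
  the pair has exactly the form that the test for \<open>e\<close> recognises.\<close>

lemma foldl_dstep_remdups_adj: "foldl dstep u (remdups_adj es) = foldl dstep u es"
  by (induction es arbitrary: u rule: remdups_adj.induct) (auto simp: dstep_def)

text \<open>The test of \<open>dstep\<close> gives no false alarm: distinct neighbours of equal
  length, pushed onto the same seed, have different codes.\<close>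

lemma foldl_dstep_distinct_adj:
  assumes "distinct_adj (e # es)" "\<forall>x \<in> set (e # es). length x = d" "0 \<le> c" "c < 1"
  shows "snd (foldl dstep (c, foldl pushc c e) es) = foldl pushc c (e @ concat es)"
  using assms
proof (induction es arbitrary: e c)
  case (Cons x es)
  let ?c = "foldl pushc c e"
  have "foldl pushc c x \<noteq> ?c"
    using foldl_pushc_inj[of c x c e] Cons.prems by auto
  then have "foldl dstep (c, ?c) (x # es) = foldl dstep (?c, foldl pushc ?c x) es"
    by (simp add: dstep_def)
  also have "snd \<dots> = foldl pushc ?c (x @ concat es)"
    using Cons.prems foldl_pushc_range[of c e] by (intro Cons.IH) auto
  finally show ?case by simp
qed simp

definition seq_code :: "int list list \<Rightarrow> real" where
  "seq_code es = snd (foldl dstep (0, 0) es)"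

lemma seq_code_conv:
  assumes "\<forall>x \<in> set es. length x = d" "d > 0"
  shows "seq_code es = foldl pushc 0 (concat (remdups_adj es))"
proof (cases "remdups_adj es")
  case Nil
  then show ?thesis by (simp add: seq_code_def)
next
  case (Cons e fs)
  have len: "\<forall>x \<in> set (e # fs). length x = d"
    using assms(1) remdups_adj_set[of es] Cons by auto
  \<comment> \<open>The initial pair (0, 0) must not look as if \<open>e\<close> had just been
    pushed; since \<open>d > 0\<close>, \<open>e\<close> is nonempty and its code is
    positive.\<close>
  have "foldl pushc 0 e \<noteq> 0"
    using foldl_pushc_0_inj[of e "[]"] len assms(2) by auto
  then have "seq_code es = snd (foldl dstep (0, foldl pushc 0 e) fs)"
    unfolding seq_code_def foldl_dstep_remdups_adj[of _ es, symmetric] Cons by (simp add: dstep_def)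
  also have "\<dots> = foldl pushc 0 (e @ concat fs)"
    using len distinct_adj_remdups_adj[of es] Cons by (intro foldl_dstep_distinct_adj[of _ _ d]) auto
  finally show ?thesis using Cons by simp
qed

text \<open>A code determines the flattened sequence, and the common block length \<open>d\<close>
  recovers the blocks from it.\<close>

lemma seq_code_eq_iff:
  assumes "\<forall>x \<in> set es. length x = d" "\<forall>x \<in> set fs. length x = d" "d > 0"
  shows "seq_code es = seq_code fs \<longleftrightarrow> remdups_adj es = remdups_adj fs"
proof
  assume "seq_code es = seq_code fs"
  then have c: "concat (remdups_adj es) = concat (remdups_adj fs)"
    using seq_code_conv assms foldl_pushc_0_inj by metis
  have len: "\<forall>x \<in> set (remdups_adj es). length x = d" "\<forall>x \<in> set (remdups_adj fs). length x = d"
    using assms by auto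
  have "length (concat xs) = d * length xs" if "\<forall>x \<in> set xs. length x = d" for xs :: "int list list"
    using that by (induction xs) auto
  with len c assms(3) have "length (remdups_adj es) = length (remdups_adj fs)"
    by (metis mult_left_cancel not_gr_zero)
  then show "remdups_adj es = remdups_adj fs"
    using c len by (intro concat_injective) (fastforce dest: set_zip_leftD set_zip_rightD)+
next
  assume "remdups_adj es = remdups_adj fs"
  then show "seq_code es = seq_code fs"
    by (metis seq_code_def foldl_dstep_remdups_adj)
qed

section \<open>Shifted grids\<close>

text \<open>The lower end of the cell, not its number: equal corners then bound the distance even if they come
  from different shifts, so a match of codes is never misleading.\<close>

definition corner :: "nat \<Rightarrow> nat \<Rightarrow> int \<Rightarrow> int" where
  "corner s j a = int s * ((a + int j) div int s) - int j"

definition vcorner :: "nat \<Rightarrow> real \<Rightarrow> nat \<Rightarrow> real ^ 'd::finite \<Rightarrow> int list" where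
  "vcorner s r j p = map (\<lambda>i. corner s j \<lfloor>p $ i / r\<rfloor>) coords"

text \<open>The residue is the offset of \<open>a\<close> within its cell. Excluded are the first
  and the last position, the only ones with a neighbouring integer in another cell.\<close>

definition inside :: "nat \<Rightarrow> nat \<Rightarrow> int \<Rightarrow> bool" where
  "inside s j a \<longleftrightarrow> 0 < (a + int j) mod int s \<and> (a + int j) mod int s < int s - 1"

definition vinside :: "nat \<Rightarrow> real \<Rightarrow> nat \<Rightarrow> real ^ 'd::finite \<Rightarrow> bool" where
  "vinside s r j p \<longleftrightarrow> (\<forall>i. inside s j \<lfloor>p $ i / r\<rfloor>)"

lemma coords_props: "distinct (coords :: 'd::finite list)" "set (coords :: 'd list) = UNIV"
  "length (coords :: 'd list) = CARD('d)"
proof -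
  have "\<exists>l :: 'd list. distinct l \<and> set l = UNIV"
    using finite_distinct_list[of "UNIV :: 'd set"] by auto
  then have "distinct (coords :: 'd list) \<and> set (coords :: 'd list) = UNIV"
    unfolding coords_def by (rule someI_ex)
  then show "distinct (coords :: 'd::finite list)" "set (coords :: 'd list) = UNIV"
    "length (coords :: 'd list) = CARD('d)"
    using distinct_card[of "coords :: 'd list"] by auto
qed

lemma length_vcorner [simp]: "length (vcorner s r j (p :: real ^ 'd::finite)) = CARD('d)"
  by (simp add: vcorner_def coords_props)

lemma corner_bounds:
  assumes "s > 0"
  shows "corner s j a \<le> a \<and> a < corner s j a + int s"
proof -
  have "a + int j = int s * ((a + int j) div int s) + (a + int j) mod int s" by simp
  moreover have "0 \<le> (a + int j) mod int s" "(a + int j) mod int s < int s" using assms by auto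
  ultimately show ?thesis unfolding corner_def by linarith
qed

text \<open>A corner fixes an interval of length \<open>s\<close> (in units of \<open>r\<close>)
  whatever the shift, so both points share it in every coordinate and differ there by at most
  \<open>s * r\<close>. The factor \<open>CARD('d)\<close> comes from the bound of the norm by the
  sum of coordinates.\<close>

lemma vcorner_eq_norm_le:
  fixes p q :: "real ^ 'd::finite"
  assumes "vcorner s r j p = vcorner s r j' q" "r > 0" "s > 0"
  shows "norm (p - q) \<le> real CARD('d) * (real s * r)"
proof -
  have "\<bar>(p - q) $ i\<bar> \<le> real s * r" for i
  proof -
    have "corner s j \<lfloor>p $ i / r\<rfloor> = corner s j' \<lfloor>q $ i / r\<rfloor>"
      using assms(1) by (simp add: vcorner_def coords_props)
    then have "\<bar>p $ i / r - q $ i / r\<bar> \<le> real s"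
      using corner_bounds[OF assms(3), of j "\<lfloor>p $ i / r\<rfloor>"]
        corner_bounds[OF assms(3), of j' "\<lfloor>q $ i / r\<rfloor>"] by linarith
    also have "p $ i / r - q $ i / r = (p - q) $ i / r" by (simp add: diff_divide_distrib)
    finally show ?thesis using assms(2) by (simp add: pos_divide_le_eq)
  qed
  then have "(\<Sum>i\<in>UNIV. \<bar>(p - q) $ i\<bar>) \<le> (\<Sum>i\<in>(UNIV :: 'd set). real s * r)"
    by (intro sum_mono)
  with norm_le_l1_cart[of "p - q"] show ?thesis by simp
qed

lemma inside_corner_eq:
  assumes "inside s j a" "\<bar>a - a'\<bar> \<le> 1"
  shows "corner s j a = corner s j a'"
proof -
  let ?q = "(a + int j) div int s" and ?m = "(a + int j) mod int s"
  have "a' + int j = int s * ?q + (?m + (a' - a))"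
    using mult_div_mod_eq[of "int s" "a + int j"] by linarith
  then have "(a' + int j) div int s = ?q"
    by (rule int_div_pos_eq) (use assms in \<open>auto simp: inside_def\<close>)
  then show ?thesis by (simp add: corner_def)
qed

text \<open>Coordinates at distance at most \<open>r\<close> have floors differing by at most 1,
  which is the slack in \<open>inside\<close>. As this condition concerns \<open>p\<close> alone,
  shifts can be judged in preprocessing, before the query vertex \<open>q\<close> is known.\<close>

lemma vinside_vcorner_eq:
  fixes p q :: "real ^ 'd::finite"
  assumes "vinside s r j p" "norm (p - q) \<le> r" "r > 0"
  shows "vcorner s r j p = vcorner s r j q"
  unfolding vcorner_def
proof (rule map_cong[OF refl])
  fix i :: 'd
  have "\<bar>p $ i - q $ i\<bar> \<le> r"
    using component_le_norm_cart[of "p - q" i] assms(2) by simp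
  then have "\<bar>(p $ i - q $ i) / r\<bar> \<le> 1" using assms(3) by simp
  then have "\<bar>p $ i / r - q $ i / r\<bar> \<le> 1" by (simp add: diff_divide_distrib)
  then have "\<bar>\<lfloor>p $ i / r\<rfloor> - \<lfloor>q $ i / r\<rfloor>\<bar> \<le> 1" by linarith
  with assms(1) show "corner s j \<lfloor>p $ i / r\<rfloor> = corner s j \<lfloor>q $ i / r\<rfloor>"
    by (intro inside_corner_eq) (auto simp: vinside_def)
qed

text \<open>Over \<open>s\<close> consecutive shifts \<open>a + j\<close> takes every residue at
  most once, and only the residues 0 and \<open>s - 1\<close> are bad.\<close>

lemma card_not_inside:
  assumes "s > 0"
  shows "card {j \<in> {..<s}. \<not> inside s j a} \<le> 2"
proof -
  have one: "card {j \<in> {..<s}. (a + int j) mod int s = v} \<le> 1" for v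
  proof -
    have "x = y" if "x < s" "y < s" "(a + int x) mod int s = v" "(a + int y) mod int s = v" for x y
    proof -
      have "int s dvd (a + int x) - (a + int y)" using that by (metis mod_eq_dvd_iff)
      then have "int s dvd int x - int y" by simp
      moreover have "\<bar>int x - int y\<bar> < int s" using that by linarith
      ultimately show ?thesis using zdvd_not_zless[of "\<bar>int x - int y\<bar>" "int s"] by (cases "x = y") auto
    qed
    then show ?thesis by (auto simp: card_le_Suc0_iff_eq)
  qed
  have "{j \<in> {..<s}. \<not> inside s j a} \<subseteq>
    {j \<in> {..<s}. (a + int j) mod int s = 0} \<union> {j \<in> {..<s}. (a + int j) mod int s = int s - 1}"
  proof
    fix j assume j: "j \<in> {j \<in> {..<s}. \<not> inside s j a}"
    have "0 \<le> (a + int j) mod int s" "(a + int j) mod int s < int s" using assms by auto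
    with j have "(a + int j) mod int s = 0 \<or> (a + int j) mod int s = int s - 1"
      unfolding inside_def mem_Collect_eq by linarith
    with j show "j \<in> {j \<in> {..<s}. (a + int j) mod int s = 0} \<union> {j \<in> {..<s}. (a + int j) mod int s = int s - 1}"
      by blast
  qed
  then have "card {j \<in> {..<s}. \<not> inside s j a} \<le>
    card ({j \<in> {..<s}. (a + int j) mod int s = 0} \<union> {j \<in> {..<s}. (a + int j) mod int s = int s - 1})"
    by (intro card_mono) auto
  also have "\<dots> \<le> 1 + 1"
    using one by (intro order.trans[OF card_Un_le add_mono]) auto
  finally show ?thesis by simp
qed

text \<open>Union bound: each of the \<open>card I * CARD('d)\<close> coordinates spoils at most two
  shifts, which by the factor 4 in the hypothesis is at most half of them.\<close>

lemma card_vinside_ge: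
  fixes p :: "nat \<Rightarrow> real ^ 'd::finite"
  assumes "finite I" "4 * CARD('d) * card I \<le> s" "s > 0"
  shows "s \<le> 2 * card {j \<in> {..<s}. \<forall>i\<in>I. vinside s r j (p i)}"
proof -
  let ?B = "\<lambda>i c. {j \<in> {..<s}. \<not> inside s j \<lfloor>p i $ c / r\<rfloor>}"
  let ?G = "{j \<in> {..<s}. \<forall>i\<in>I. vinside s r j (p i)}"
  have eq: "{..<s} - ?G = (\<Union>i\<in>I. \<Union>c\<in>UNIV. ?B i c)"
    by (auto simp: vinside_def)
  have "card (\<Union>i\<in>I. \<Union>c\<in>UNIV. ?B i c) \<le> (\<Sum>i\<in>I. card (\<Union>c\<in>UNIV. ?B i c))"
    by (intro card_UN_le assms)
  also have "\<dots> \<le> (\<Sum>i\<in>I. \<Sum>c\<in>UNIV. card (?B i c))"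
    by (intro sum_mono card_UN_le) auto
  also have "\<dots> \<le> (\<Sum>i\<in>I. \<Sum>c\<in>(UNIV :: 'd set). 2)"
    by (intro sum_mono card_not_inside assms)
  finally have "card ({..<s} - ?G) \<le> card I * (CARD('d) * 2)" unfolding eq by simp
  moreover have "card ({..<s} - ?G) = s - card ?G"
    by (subst card_Diff_subset) auto
  moreover have "2 * (card I * (CARD('d) * 2)) \<le> s" using assms(2) by (simp add: algebra_simps)
  ultimately show ?thesis by linarith
qed

section \<open>Walks along the query\<close>

text \<open>The digit \<open>e\<close> of block \<open>b\<close> says that the part of the query matched to this block ends at
  index \<open>e div 2\<close>; if \<open>e\<close> is odd, the next block starts at the next index.\<close>

function walk :: "nat \<Rightarrow> nat \<Rightarrow> nat \<Rightarrow> nat list \<Rightarrow> (nat \<times> nat) list" where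
  "walk L q b [] = []"
| "walk L q b (e # es) = (if L \<le> q then [] else (q, b) #
     (if q < e div 2 then walk L (Suc q) b (e # es) else walk L (q + e mod 2) (Suc b) es))"
  by pat_completeness auto
termination by (relation "Wellfounded.measure (\<lambda>(L, q, b, es). length es + (L - q))") auto

declare walk.simps(2) [simp del]

lemma walk_ge: "L \<le> q \<Longrightarrow> walk L q b es = []"
  by (cases es) (simp_all add: walk.simps(2)[of L q])

lemma walk_hd: "q < L \<Longrightarrow> es \<noteq> [] \<Longrightarrow> walk L q b es \<noteq> [] \<and> hd (walk L q b es) = (q, b)"
  by (cases es) (simp_all add: walk.simps(2)[of L q])

text \<open>Every step of a walk raises the query index by 0 or 1, so arbitrary digits skip no
  vertex. The last digit \<open>2 * m - 1\<close> means end index \<open>m - 1\<close> together with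
  an advance, so the blocks cannot run out before the query does.\<close>

lemma remdups_adj_walk:
  assumes "q < L" "es \<noteq> []" "last es = 2 * m - 1" "L \<le> m"
  shows "remdups_adj (map fst (walk L q b es)) = [q..<L]"
  using assms
proof (induction L q b es rule: walk.induct)
  case (2 L q b e es)
  have prems: "q < L" "last (e # es) = 2 * m - 1" "L \<le> m" using 2 by auto
  have split: "[q..<L] = q # [Suc q..<L]" using 2(3) by (simp add: upt_conv_Cons)
  have Cons: "remdups_adj (q # xs) = q # [Suc q..<L]"
    if "remdups_adj xs = [Suc q..<L] \<or> remdups_adj xs = q # [Suc q..<L]" for xs
    using that by (cases "Suc q < L") (auto simp: remdups_adj_Cons upt_conv_Cons)
  show ?case
  proof (cases "q < e div 2")
    case True
    have "remdups_adj (map fst (walk L (Suc q) b (e # es))) = [Suc q..<L]"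
    proof (cases "Suc q < L")
      case True then show ?thesis using prems \<open>q < e div 2\<close> by (intro 2(1)) auto
    qed (simp add: walk_ge)
    then show ?thesis using True 2(3) by (subst walk.simps) (simp add: split Cons)
  next
    case False
    have "remdups_adj (map fst (walk L (q + e mod 2) (Suc b) es)) = [q + e mod 2..<L]"
    proof (cases "es = []")
      case True
      then have "e = 2 * m - 1" using prems by simp
      moreover have "(2 * m - 1) mod 2 = 1" "(2 * m - 1) div 2 = m - 1" using prems(1,3) by presburger+
      ultimately have "q + e mod 2 = L" using False prems(1,3) by simp
      then show ?thesis using True by simp
    next
      case es: False
      show ?thesis
      proof (cases "q + e mod 2 < L")
        case True
        then show ?thesis using prems \<open>\<not> q < e div 2\<close> es by (intro 2(2)) auto
      next
        case False
        then show ?thesis by (simp add: walk_ge)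
      qed
    qed
    moreover have "e mod 2 = 0 \<or> e mod 2 = 1" by auto
    ultimately show ?thesis using False 2(3)
      by (subst walk.simps) (auto simp: split Cons)
  qed
qed simp

lemma fr_Nil_right [simp]: "\<not> fr R xs []"
  by (cases xs) auto

lemma fr_map: "fr (\<lambda>x y. R x (h y)) xs ys \<Longrightarrow> fr R xs (map h ys)"
  by (induction "\<lambda>x y. R x (h y)" xs ys rule: fr.induct) auto

text \<open>Equal corner sequences match the vertices of \<open>P\<close> with the entries of the
  walk; projecting these to query indices and removing repetitions gives a matching with
  \<open>Q\<close>. The shift functions \<open>J\<close> and \<open>J'\<close> are independent, so
  every hit is sound.\<close>

lemma frechet_dist_le_of_corners:
  fixes P Q :: "'d::finite curve"
  assumes "P \<noteq> []" "Q \<noteq> []" "r > 0" "s > 0" "es \<noteq> []" "last es = 2 * m - 1" "length Q \<le> m"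
    and eq: "remdups_adj (map (\<lambda>i. vcorner s r (J i) (P ! i)) [0..<length P]) =
      remdups_adj (map (\<lambda>(q, b). vcorner s r (J' b) (Q ! q)) (walk (length Q) 0 0 es))"
  shows "frechet_dist P Q \<le> real CARD('d) * (real s * r)"
proof -
  let ?W = "walk (length Q) 0 0 es"
  have W: "remdups_adj (map fst ?W) = [0..<length Q]"
    using assms by (intro remdups_adj_walk) auto
  have "?W \<noteq> []"
  proof
    assume "?W = []"
    then have "[0..<length Q] = []" using W by simp
    then show False using assms(2) by simp
  qed
  then have "fr (\<lambda>i u. vcorner s r (J i) (P ! i) = (\<lambda>(q, b). vcorner s r (J' b) (Q ! q)) u)
    [0..<length P] ?W"
    using assms by (intro remdups_adj_eq_fr) auto
  then have "fr (\<lambda>i u. norm (P ! i - Q ! fst u) \<le> real CARD('d) * (real s * r)) [0..<length P] ?W"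
    by (rule fr_mono) (auto intro: vcorner_eq_norm_le assms)
  from fr_remdups_adj[OF fr_map[where h = fst and R = "\<lambda>i q. norm (P ! i - Q ! q) \<le> real CARD('d) * (real s * r)", OF this]]
  show ?thesis
    unfolding W using assms by (simp add: frechet_dist_le_iff)
qed

text \<open>The digits are read off the matching from its end. A move within a block only repeats a
  corner or extends the walk; a move into the next block prepends \<open>2 * q\<close> if the query
  stays and \<open>2 * q + 1\<close> if it advances too. The invariant
  \<open>q \<le> hd es div 2\<close> says that the part of the current block ends at
  \<open>q\<close> or later, so the walk can be extended backwards.\<close>

lemma fr_walk:
  fixes P Q :: "'d::finite curve"
  assumes "fr (\<lambda>i q. norm (P ! i - Q ! q) \<le> r) [i..<length P] [q..<length Q]" "r > 0"
    and "\<forall>i<length P. vinside s r (J (i div w)) (P ! i)" "\<forall>i<length P. i div w < k"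
    and "length Q \<le> m" "i < length P" "q < length Q"
  shows "\<exists>es. length es = k - i div w \<and> (\<forall>e\<in>set es. e < 2 * m) \<and> last es = 2 * m - 1 \<and>
    q \<le> hd es div 2 \<and>
    remdups_adj (map (\<lambda>i. vcorner s r (J (i div w)) (P ! i)) [i..<length P]) =
    remdups_adj (map (\<lambda>(q, b). vcorner s r (J b) (Q ! q)) (walk (length Q) q (i div w) es))"
  using assms(1,6,7)
proof (induction "(length P - i) + (length Q - q)" arbitrary: i q rule: less_induct)
  case less
  define F where "F = (\<lambda>i. vcorner s r (J (i div w)) (P ! i))"
  define G where "G = (\<lambda>(q, b). vcorner s r (J b) (Q ! q))"
  let ?R = "\<lambda>i q. norm (P ! i - Q ! q) \<le> r"
  let ?C = "\<lambda>i q es. length es = k - i div w \<and> (\<forall>e\<in>set es. e < 2 * m) \<and> last es = 2 * m - 1 \<and>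
    q \<le> hd es div 2 \<and> remdups_adj (map F [i..<length P]) = remdups_adj (map G (walk (length Q) q (i div w) es))"
  have FG: "F i = G (q, i div w)" if "?R i q" "i < length P" for i q
    unfolding F_def G_def using that assms by (simp add: vinside_vcorner_eq)
  have block: "i div w < k" if "i < length P" for i using that assms by blast
  have IH: "\<exists>es. ?C i' q' es" if "fr ?R [i'..<length P] [q'..<length Q]"
    "(length P - i') + (length Q - q') < (length P - i) + (length Q - q)" for i' q'
  proof -
    have "i' < length P \<and> q' < length Q" using that(1) by (cases "i' < length P"; cases "q' < length Q") auto
    then show ?thesis using less.hyps[of i' q'] that unfolding F_def G_def by blast
  qed
  have m: "1 \<le> m" "q \<le> m - 1" using less.prems assms(5) by auto
  have splitP: "[i..<length P] = i # [Suc i..<length P]" using less.prems by (simp add: upt_conv_Cons)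
  have R: "?R i q" and cases: "Suc i \<ge> length P \<and> Suc q \<ge> length Q \<or>
    fr ?R [Suc i..<length P] [q..<length Q] \<or> fr ?R [i..<length P] [Suc q..<length Q] \<or>
    fr ?R [Suc i..<length P] [Suc q..<length Q]"
    using less.prems fr_upt[of i "length P" q "length Q" ?R] by auto
  note FGi = FG[OF R less.prems(2)]
  have div_Suc: "Suc i div w = i div w \<or> Suc i div w = Suc (i div w)" by (auto simp: div_Suc)
  have frP: "i' < length P" and frQ: "q' < length Q"
    if "fr ?R [i'..<length P] [q'..<length Q]" for i' q'
    using that by (cases "i' < length P"; cases "q' < length Q"; auto)+
  have ne: "es \<noteq> []" if "?C i' q' es" "i' < length P" for i' q' es
    using that block[of i'] by auto
  have "\<exists>es. ?C i q es"
    using cases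
  proof (elim disjE conjE)
    assume a: "Suc i \<ge> length P" "Suc q \<ge> length Q"
    \<comment> \<open>At the end of both curves all remaining blocks receive the forced digit; the
      walk stops before reaching the later ones, as the query is exhausted.\<close>
    define es where "es = replicate (k - i div w) (2 * m - 1)"
    obtain es' where es': "es = (2 * m - 1) # es'" "es' = replicate (k - i div w - 1) (2 * m - 1)"
      using block[OF less.prems(2)] unfolding es_def by (cases "k - i div w") auto
    have odd: "(2 * m - 1) mod 2 = 1" "(2 * m - 1) div 2 = m - 1" using m by presburger+
    have "walk (length Q) q (i div w) es = [(q, i div w)]"
    proof (cases "q < m - 1")
      case True
      then show ?thesis unfolding es' using a less.prems odd
        by (subst walk.simps, subst walk.simps) auto
    next
      case False
      have "walk (length Q) (Suc q) (Suc (i div w)) es' = []"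
        using a by (simp add: walk_ge)
      then show ?thesis unfolding es' using False less.prems odd by (subst walk.simps) auto
    qed
    then have "?C i q es" using a FGi block[OF less.prems(2)] m splitP odd
      unfolding es_def by (auto simp: last_replicate hd_replicate)
    then show ?thesis ..
  next
    assume a: "fr ?R [Suc i..<length P] [q..<length Q]"
    have "(length P - Suc i) + (length Q - q) < (length P - i) + (length Q - q)" using less.prems by linarith
    from IH[OF a this] obtain es where es: "?C (Suc i) q es" by blast
    have ne: "es \<noteq> []" using ne[OF es] frP[OF a] by blast
    show ?thesis
    proof (cases "Suc i div w = i div w")
      case True
      have "remdups_adj (map F [i..<length P]) = remdups_adj (F i # map G (walk (length Q) q (i div w) es))"
        using es True by (simp add: splitP remdups_adj_Cons)
      also have "\<dots> = remdups_adj (map G (walk (length Q) q (i div w) es))"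
        using walk_hd[OF less.prems(3) ne, of "i div w"] FGi
        by (subst remdups_adj_Cons_conv) (auto simp: hd_map)
      finally show ?thesis using es True by (intro exI[of _ es]) auto
    next
      case False
      then have b: "Suc i div w = Suc (i div w)" using div_Suc by simp
      have "walk (length Q) q (i div w) ((2 * q) # es) = (q, i div w) # walk (length Q) q (Suc (i div w)) es"
        using less.prems by (subst walk.simps) simp
      then have "?C i q ((2 * q) # es)"
        using es b FGi m ne block[OF frP[OF a]] by (auto simp: splitP remdups_adj_Cons)
      then show ?thesis ..
    qed
  next
    assume a: "fr ?R [i..<length P] [Suc q..<length Q]"
    have "(length P - i) + (length Q - Suc q) < (length P - i) + (length Q - q)" using less.prems by linarith
    from IH[OF a this] obtain es where es: "?C i (Suc q) es" by blast
    have ne: "es \<noteq> []" using ne[OF es] frP[OF a] by blast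
    have "walk (length Q) q (i div w) es = (q, i div w) # walk (length Q) (Suc q) (i div w) es"
      using ne es less.prems by (cases es) (auto simp: walk.simps(2)[of _ q])
    then have "remdups_adj (map G (walk (length Q) q (i div w) es)) = remdups_adj (F i # map F [i..<length P])"
      using es FGi by (simp add: remdups_adj_Cons)
    also have "\<dots> = remdups_adj (map F [i..<length P])" by (simp add: splitP)
    finally show ?thesis using es by (intro exI[of _ es]) auto
  next
    assume a: "fr ?R [Suc i..<length P] [Suc q..<length Q]"
    have "(length P - Suc i) + (length Q - Suc q) < (length P - i) + (length Q - q)" using less.prems by linarith
    from IH[OF a this] obtain es where es: "?C (Suc i) (Suc q) es" by blast
    have ne: "es \<noteq> []" using ne[OF es] frP[OF a] by blast
    show ?thesis
    proof (cases "Suc i div w = i div w")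
      case True
      have "walk (length Q) q (i div w) es = (q, i div w) # walk (length Q) (Suc q) (i div w) es"
        using ne es less.prems by (cases es) (auto simp: walk.simps(2)[of _ q])
      then have "?C i q es" using es True FGi by (auto simp: splitP remdups_adj_Cons)
      then show ?thesis ..
    next
      case False
      then have b: "Suc i div w = Suc (i div w)" using div_Suc by simp
      have odd: "(2 * q + 1) mod 2 = 1" "(2 * q + 1) div 2 = q" by presburger+
      have "walk (length Q) q (i div w) ((2 * q + 1) # es) = (q, i div w) # walk (length Q) (Suc q) (Suc (i div w)) es"
        using less.prems odd by (subst walk.simps) simp
      then have "?C i q ((2 * q + 1) # es)"
        using es b FGi m ne block[OF frP[OF a]] frQ[OF a] odd assms(5)
        by (auto simp: splitP remdups_adj_Cons)
      then show ?thesis ..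
    qed
  qed
  then show ?case unfolding F_def G_def .
qed

section \<open>Numerals\<close>

fun undigits :: "nat \<Rightarrow> nat list \<Rightarrow> nat" where
  "undigits M [] = 0"
| "undigits M (e # es) = e + M * undigits M es"

lemma undigits_append: "undigits M (xs @ ys) = undigits M xs + M ^ length xs * undigits M ys"
  by (induction xs) (auto simp: algebra_simps)

lemma undigits_less:
  assumes "\<forall>e\<in>set es. e < M"
  shows "undigits M es < M ^ length es"
  using assms
proof (induction es)
  case (Cons e es)
  then have "Suc (undigits M es) \<le> M ^ length es" "e < M" by auto
  then have "e + M * undigits M es < M * Suc (undigits M es)" by simp
  also have "\<dots> \<le> M * M ^ length es" using \<open>Suc (undigits M es) \<le> _\<close> by (rule mult_le_mono2)
  finally show ?case by simp
qed simp

lemma undigits_digit: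
  assumes "\<forall>e\<in>set es. e < M" "i < length es"
  shows "undigits M es div M ^ i mod M = es ! i"
  using assms
proof (induction es arbitrary: i)
  case (Cons e es)
  then show ?case by (cases i) (auto simp: div_mult2_eq)
qed simp

lemma undigits_last_ge:
  assumes "es \<noteq> []"
  shows "last es * M ^ (length es - 1) \<le> undigits M es"
proof -
  have "undigits M es = undigits M (butlast es @ [last es])" using assms by simp
  also have "\<dots> = undigits M (butlast es) + M ^ (length es - 1) * last es"
    unfolding undigits_append by simp
  finally show ?thesis by simp
qed

text \<open>The numbers with top digit \<open>M - 1\<close> are consecutive, so all admissible walks
  can be enumerated by a counter. Division by \<open>M\<close> strips the lowest digit and keeps the
  bounds.\<close>

lemma ex_undigits:
  assumes "k \<ge> 1" "(M - 1) * M ^ (k - 1) \<le> y" "y < M ^ k" "M \<ge> 1"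
  shows "\<exists>es. length es = k \<and> (\<forall>e\<in>set es. e < M) \<and> last es = M - 1 \<and> undigits M es = y"
  using assms
proof (induction k arbitrary: y rule: nat_induct_at_least)
  case base
  then show ?case by (intro exI[of _ "[y]"]) auto
next
  case (Suc k)
  have k: "M ^ k = M * M ^ (k - 1)" using Suc.hyps by (cases k) auto
  have "(M - 1) * M ^ (k - 1) \<le> y div M"
    using Suc.prems k by (simp add: less_eq_div_iff_mult_less_eq algebra_simps)
  moreover have "y div M < M ^ k" using Suc.prems by (simp add: div_less_iff_less_mult mult.commute)
  ultimately obtain es where es: "length es = k" "\<forall>e\<in>set es. e < M" "last es = M - 1" "undigits M es = y div M"
    using Suc.IH[of "y div M"] Suc.prems by blast
  then show ?case using Suc.prems Suc.hyps by (intro exI[of _ "(y mod M) # es"]) auto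
qed

section \<open>Covering all curves by few shift vectors\<close>

text \<open>Double counting of the pairs with \<open>ok x g\<close>: if every \<open>x\<close>
  served less than the fraction 1/\<open>N\<close> of \<open>G\<close>, the total over
  \<open>X\<close> would be too small.\<close>

lemma averaging:
  assumes "finite G" "finite X" "X \<noteq> {}"
    and "\<And>g. g \<in> G \<Longrightarrow> card X \<le> N * card {x \<in> X. ok x g}"
  shows "\<exists>x\<in>X. card G \<le> N * card {g \<in> G. ok x g}"
proof (rule ccontr)
  assume "\<not> ?thesis"
  then have less: "N * card {g \<in> G. ok x g} < card G" if "x \<in> X" for x
    using that by (auto simp: not_le)
  have "(\<Sum>x\<in>X. N * card {g \<in> G. ok x g}) < (\<Sum>x\<in>X. card G)"
    using assms less by (intro sum_strict_mono) auto
  also have "\<dots> = (\<Sum>g\<in>G. card X)" by simp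
  also have "\<dots> \<le> (\<Sum>g\<in>G. N * card {x \<in> X. ok x g})"
    using assms by (intro sum_mono) auto
  also have "\<dots> = N * (\<Sum>g\<in>G. card {x \<in> X. ok x g})" by (simp add: sum_distrib_left)
  also have "(\<Sum>g\<in>G. card {x \<in> X. ok x g}) = (\<Sum>g\<in>G. \<Sum>x\<in>X. if ok x g then 1 else 0)"
    using assms by (simp add: sum.If_cases Int_def)
  also have "\<dots> = (\<Sum>x\<in>X. \<Sum>g\<in>G. if ok x g then 1 else 0)" by (rule sum.swap)
  also have "\<dots> = (\<Sum>x\<in>X. card {g \<in> G. ok x g})"
    using assms by (simp add: sum.If_cases Int_def)
  finally show False by (simp add: sum_distrib_left)
qed

text \<open>Averaging is applied to the elements still uncovered, so each new \<open>x\<close>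
  removes at least the fraction 1/\<open>N\<close> of them.\<close>

lemma greedy_cover:
  assumes "finite G" "finite X" "X \<noteq> {}" "N > 0"
    and "\<And>g. g \<in> G \<Longrightarrow> card X \<le> N * card {x \<in> X. ok x g}"
  shows "\<exists>xs. set xs \<subseteq> X \<and> length xs = T \<and>
    real (card {g \<in> G. \<forall>x\<in>set xs. \<not> ok x g}) \<le> real (card G) * (1 - 1 / real N) ^ T"
proof (induction T)
  case (Suc T)
  then obtain xs where xs: "set xs \<subseteq> X" "length xs = T"
    "real (card {g \<in> G. \<forall>x\<in>set xs. \<not> ok x g}) \<le> real (card G) * (1 - 1 / real N) ^ T" by blast
  define G1 where "G1 = {g \<in> G. \<forall>x\<in>set xs. \<not> ok x g}"
  have fin: "finite G1" using assms(1) by (simp add: G1_def)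
  obtain x where x: "x \<in> X" "card G1 \<le> N * card {g \<in> G1. ok x g}"
    using averaging[of G1 X N ok] assms fin by (auto simp: G1_def)
  have H: "{g \<in> G. \<forall>y\<in>set (x # xs). \<not> ok y g} = G1 - {g \<in> G1. ok x g}"
    by (auto simp: G1_def)
  have le: "card {g \<in> G1. ok x g} \<le> card G1" using fin by (intro card_mono) auto
  have "card (G1 - {g \<in> G1. ok x g}) = card G1 - card {g \<in> G1. ok x g}"
    using fin by (intro card_Diff_subset) auto
  then have "real (card (G1 - {g \<in> G1. ok x g})) = real (card G1) - real (card {g \<in> G1. ok x g})"
    using le by (simp only: of_nat_diff)
  also have "\<dots> \<le> real (card G1) - real (card G1) / real N"
  proof -
    have "real (card G1) \<le> real N * real (card {g \<in> G1. ok x g})"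
      using x(2) by (metis of_nat_le_iff of_nat_mult)
    then show ?thesis using assms(4) by (simp add: divide_le_eq mult.commute)
  qed
  also have "\<dots> = real (card G1) * (1 - 1 / real N)" by (simp add: algebra_simps)
  also have "\<dots> \<le> real (card G) * (1 - 1 / real N) ^ T * (1 - 1 / real N)"
    using xs(3) assms(4) by (intro mult_right_mono) (auto simp: G1_def)
  finally have "real (card {g \<in> G. \<forall>y\<in>set (x # xs). \<not> ok y g}) \<le> real (card G) * (1 - 1 / real N) ^ Suc T"
    unfolding H by (simp add: algebra_simps)
  then show ?case using xs(1,2) x(1) by (intro exI[of _ "x # xs"]) simp
qed auto

lemma power_one_minus_inverse_le_half:
  assumes "N > 0"
  shows "(1 - 1 / real N) ^ N \<le> 1 / 2"
proof -
  have "1 - 1 / real N \<le> exp (- (1 / real N))"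
    using exp_ge_add_one_self[of "- (1 / real N)"] by simp
  then have "(1 - 1 / real N) ^ N \<le> exp (- (1 / real N)) ^ N"
    using assms by (intro power_mono) auto
  also have "\<dots> = exp (- 1)"
    using assms by (simp add: exp_of_nat_mult[symmetric])
  also have "\<dots> \<le> 1 / 2"
    using exp_ge_add_one_self[of 1] by (simp add: exp_minus field_simps)
  finally show ?thesis .
qed

text \<open>Every \<open>N\<close> steps at least halve the uncovered part, so after
  \<open>N * L\<close> steps fewer than one element is left.\<close>

lemma exists_cover:
  assumes "finite G" "finite X" "X \<noteq> {}" "N > 0" "card G < 2 ^ L"
    and "\<And>g. g \<in> G \<Longrightarrow> card X \<le> N * card {x \<in> X. ok x g}"
  shows "\<exists>xs. set xs \<subseteq> X \<and> length xs = N * L \<and> (\<forall>g\<in>G. \<exists>x\<in>set xs. ok x g)"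
proof -
  obtain xs where xs: "set xs \<subseteq> X" "length xs = N * L"
    "real (card {g \<in> G. \<forall>x\<in>set xs. \<not> ok x g}) \<le> real (card G) * (1 - 1 / real N) ^ (N * L)"
    using greedy_cover[of G X N ok "N * L"] assms by auto
  note xs(3)
  also have "real (card G) * (1 - 1 / real N) ^ (N * L) \<le> real (card G) * (1 / 2) ^ L"
    unfolding power_mult using assms(4)
    by (intro mult_left_mono power_mono power_one_minus_inverse_le_half) auto
  also have "\<dots> < 1" using assms(5) by (simp add: power_one_over field_simps)
  finally have "card {g \<in> G. \<forall>x\<in>set xs. \<not> ok x g} = 0" by simp
  then have "{g \<in> G. \<forall>x\<in>set xs. \<not> ok x g} = {}" using assms(1) by simp
  then show ?thesis using xs by blast
qed

text \<open>The number of curves may exceed the number of patterns of admissible shifts; this is what keeps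
  the number of shift vectors in \<open>O(2 ^ k * m)\<close> when \<open>log n\<close> is large compared to \<open>m\<close>.\<close>

lemma exists_shift_numeral:
  fixes A :: "'a \<Rightarrow> nat \<Rightarrow> nat set"
  assumes "finite S" "s \<ge> 2" "k \<ge> 1" "card S < 2 ^ L \<or> L = s * k + 1"
    and sub: "\<And>P b. P \<in> S \<Longrightarrow> A P b \<subseteq> {..<s}"
    and half: "\<And>P b. P \<in> S \<Longrightarrow> s \<le> 2 * card (A P b)"
  shows "\<exists>z. 0 < z \<and> z < (s ^ k) ^ (2 ^ k * L + 1) \<and>
    (\<forall>P\<in>S. \<exists>t. 0 < z div (s ^ k) ^ t \<and>
      (\<forall>b<k. (z div (s ^ k) ^ t mod s ^ k) div s ^ b mod s \<in> A P b))"
proof -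
  \<comment> \<open>Curves with the same admissible shifts in the first \<open>k\<close> blocks are
    served by the same vectors. The restriction identifies them, so that \<open>G\<close> counts
    patterns instead of curves.\<close>
  define pat where "pat P = restrict (A P) {..<k}" for P
  define G where "G = pat ` S"
  define X where "X = (\<Pi>\<^sub>E b\<in>{..<k}. {..<s})"
  define ok where "ok x g \<longleftrightarrow> (\<forall>b<k. x b \<in> g b)" for x :: "nat \<Rightarrow> nat" and g :: "nat \<Rightarrow> nat set"
  have finX: "finite X" unfolding X_def by (intro finite_PiE) auto
  have cardX: "card X = s ^ k" unfolding X_def by (subst card_PiE) auto
  have "X \<noteq> {}" using cardX assms(2) by auto
  have finG: "finite G" unfolding G_def using assms(1) by simp
  have "card G < 2 ^ L"
    using assms(4)
  proof
    assume "card S < 2 ^ L"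
    then show ?thesis unfolding G_def using card_image_le[OF assms(1), of pat] by simp
  next
    assume L: "L = s * k + 1"
    have "G \<subseteq> (\<Pi>\<^sub>E b\<in>{..<k}. Pow {..<s})"
      unfolding G_def pat_def using sub by (force simp: PiE_def Pi_def)
    then have "card G \<le> card (\<Pi>\<^sub>E b\<in>{..<k}. Pow {..<s})"
      by (intro card_mono finite_PiE) auto
    also have "\<dots> = 2 ^ (s * k)" by (subst card_PiE) (auto simp: card_Pow power_mult)
    also have "(2 :: nat) ^ (s * k) < 2 ^ L" unfolding L by simp
    finally show ?thesis .
  qed
  moreover have "card X \<le> 2 ^ k * card {x \<in> X. ok x g}" if g: "g \<in> G" for g
  proof -
    obtain P where P: "P \<in> S" "g = pat P" using g unfolding G_def by auto
    \<comment> \<open>The vectors suiting a pattern form a product of \<open>k\<close> sets, each at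
      least half of the shifts; hence their share is at least 1/\<open>2 ^ k\<close>.\<close>
    have "{x \<in> X. ok x g} = (\<Pi>\<^sub>E b\<in>{..<k}. A P b)"
      using sub[OF P(1)] by (force simp: X_def ok_def P(2) pat_def PiE_def Pi_def)
    then have "2 ^ k * card {x \<in> X. ok x g} = (\<Prod>b<k. 2 * card (A P b))"
      by (simp add: card_PiE prod.distrib)
    moreover have "(\<Prod>b<k. s) \<le> (\<Prod>b<k. 2 * card (A P b))"
      using half[OF P(1)] by (intro prod_mono) auto
    ultimately show ?thesis using cardX by simp
  qed
  ultimately obtain xs where xs: "set xs \<subseteq> X" "length xs = 2 ^ k * L" "\<forall>g\<in>G. \<exists>x\<in>set xs. ok x g"
    using exists_cover[of G X "2 ^ k" L ok] finG finX \<open>X \<noteq> {}\<close> by auto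
  define num where "num x = undigits s (map x [0..<k])" for x :: "nat \<Rightarrow> nat"
  have X: "x b < s" if "x \<in> X" "b < k" for x b using that by (auto simp: X_def)
  have num: "num x < s ^ k" "\<forall>b<k. num x div s ^ b mod s = x b" if "x \<in> X" for x
    using undigits_less[of "map x [0..<k]" s] undigits_digit[of "map x [0..<k]" s] X[OF that] by (auto simp: num_def)
  let ?B = "s ^ k"
  have B: "1 < ?B" using assms(2,3) by (metis Suc_1 Suc_le_lessD not_one_le_zero one_less_power not_gr_zero)
  \<comment> \<open>The top digit 1 is a marker. It keeps \<open>z div ?B ^ t\<close> positive at
    every position of a shift vector, even if the highest vectors have the number 0, so a loop
    dividing down to 0 visits them all.\<close>
  define zs where "zs = map num xs @ [1]"
  define z where "z = undigits ?B zs"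
  have zs: "\<forall>e\<in>set zs. e < ?B" using num(1) xs(1) B unfolding zs_def by auto
  have "z < ?B ^ (2 ^ k * L + 1)" using undigits_less[OF zs] xs(2) by (simp add: z_def zs_def)
  moreover have z_ge: "?B ^ (2 ^ k * L) \<le> z"
    using undigits_last_ge[of zs ?B] xs(2) by (simp add: z_def zs_def)
  moreover have "0 < z" using z_ge B by (metis gr_zeroI le_zero_eq power_eq_0_iff not_one_less_zero)
  moreover have "\<exists>t. 0 < z div ?B ^ t \<and> (\<forall>b<k. (z div ?B ^ t mod ?B) div s ^ b mod s \<in> A P b)"
    if P: "P \<in> S" for P
  proof -
    obtain x where "x \<in> set xs" "ok x (pat P)" using xs(3) P unfolding G_def by auto
    then obtain t where t: "t < length xs" "x = xs ! t" by (auto simp: in_set_conv_nth)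
    have "x \<in> X" using xs(1) \<open>x \<in> set xs\<close> by auto
    have "z div ?B ^ t mod ?B = num x"
      using undigits_digit[OF zs, of t] t unfolding z_def by (simp add: zs_def nth_append)
    moreover have "?B ^ t \<le> z"
      using t xs(2) B by (intro order.trans[OF _ z_ge] power_increasing) auto
    then have "0 < z div ?B ^ t" using B assms(2) by (simp add: div_greater_zero_iff)
    moreover have "\<forall>b<k. num x div s ^ b mod s \<in> A P b"
      using num(2)[OF \<open>x \<in> X\<close>] \<open>ok x (pat P)\<close> by (auto simp: ok_def pat_def)
    ultimately show ?thesis by (intro exI[of _ t]) simp
  qed
  ultimately show ?thesis by blast
qed

section \<open>Reasoning about programs\<close>

text \<open>Total correctness with the running time passed to the postcondition. Since
  \<open>exec\<close> is deterministic, existence of one run describes the only run.\<close>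

definition wp :: "real list \<Rightarrow> nat set \<Rightarrow> prog \<Rightarrow> (nat \<Rightarrow> state \<Rightarrow> bool) \<Rightarrow> state \<Rightarrow> bool" where
  "wp I W p Q \<sigma> \<longleftrightarrow> (\<exists>t \<tau>. exec I W p \<sigma> t \<tau> \<and> Q t \<tau>)"

lemma wp_Assign:
  "Q (ecost e + 1) (\<sigma>\<lparr>regs := (regs \<sigma>)(x := eval I \<sigma> e)\<rparr>) \<Longrightarrow> wp I W (Assign x e) Q \<sigma>"
  unfolding wp_def using exec.Assign by blast

lemma wp_Store:
  "addr (eval I \<sigma> a) \<in> W \<Longrightarrow>
    Q (ecost a + ecost e + 1) (\<sigma>\<lparr>mem := (mem \<sigma>)(addr (eval I \<sigma> a) := eval I \<sigma> e)\<rparr>) \<Longrightarrow>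
    wp I W (Store a e) Q \<sigma>"
  unfolding wp_def using exec.Store by blast

lemma wp_Seq: "wp I W p (\<lambda>t \<sigma>'. wp I W q (\<lambda>u. Q (t + u)) \<sigma>') \<sigma> \<Longrightarrow> wp I W (Seq p q) Q \<sigma>"
  unfolding wp_def using exec.Seq by blast

lemma wp_Cond:
  "(holds I \<sigma> b \<Longrightarrow> wp I W p (\<lambda>t. Q (tcost b + 1 + t)) \<sigma>) \<Longrightarrow>
   (\<not> holds I \<sigma> b \<Longrightarrow> wp I W q (\<lambda>t. Q (tcost b + 1 + t)) \<sigma>) \<Longrightarrow> wp I W (Cond b p q) Q \<sigma>"
  unfolding wp_def using exec.CondT exec.CondF by blast

lemma wp_mono: "wp I W p Q \<sigma> \<Longrightarrow> (\<And>t \<tau>. Q t \<tau> \<Longrightarrow> Q' t \<tau>) \<Longrightarrow> wp I W p Q' \<sigma>"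
  unfolding wp_def by blast

text \<open>The index of \<open>Inv\<close> bounds the number of iterations left and
  \<open>c\<close> the cost of one body, which gives the time bound available in
  \<open>post\<close>.\<close>

lemma wp_While:
  assumes "Inv i \<sigma>"
    and step: "\<And>i \<sigma>. Inv i \<sigma> \<Longrightarrow> holds I \<sigma> b \<Longrightarrow> wp I W p (\<lambda>t \<tau>. t \<le> c \<and> (\<exists>j<i. Inv j \<tau>)) \<sigma>"
    and post: "\<And>j t \<tau>. Inv j \<tau> \<Longrightarrow> \<not> holds I \<tau> b \<Longrightarrow> t \<le> i * (c + tcost b + 1) + tcost b + 1 \<Longrightarrow> Q t \<tau>"
  shows "wp I W (While b p) Q \<sigma>"
proof -
  have "\<exists>t \<tau>. exec I W (While b p) \<sigma> t \<tau> \<and> t \<le> i * (c + tcost b + 1) + tcost b + 1 \<and>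
    (\<exists>j. Inv j \<tau>) \<and> \<not> holds I \<tau> b"
    using assms(1)
  proof (induction i arbitrary: \<sigma> rule: less_induct)
    case (less i)
    show ?case
    proof (cases "holds I \<sigma> b")
      case False
      then show ?thesis using less.prems exec.WhileF by fastforce
    next
      case True
      then obtain t \<sigma>' j where t: "exec I W p \<sigma> t \<sigma>'" "t \<le> c" "j < i" "Inv j \<sigma>'"
        using step[OF less.prems] unfolding wp_def by blast
      from less.IH[OF t(3,4)] obtain u \<tau> where u: "exec I W (While b p) \<sigma>' u \<tau>"
        "u \<le> j * (c + tcost b + 1) + tcost b + 1" "\<exists>j. Inv j \<tau>" "\<not> holds I \<tau> b" by blast
      have "Suc j * (c + tcost b + 1) \<le> i * (c + tcost b + 1)"
        using t(3) by (intro mult_le_mono1) simp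
      then have "tcost b + 1 + t + u \<le> i * (c + tcost b + 1) + tcost b + 1"
        using t(2) u(2) by simp
      with exec.WhileT[OF True t(1) u(1)] u show ?thesis by blast
    qed
  qed
  then show ?thesis unfolding wp_def using post by blast
qed

text \<open>The variant for preprocessing, where only termination matters and no cost is
  tracked.\<close>

lemma wp_While_measure:
  assumes "Inv (i :: nat) \<sigma>"
    and step: "\<And>i \<sigma>. Inv i \<sigma> \<Longrightarrow> holds I \<sigma> b \<Longrightarrow> wp I W p (\<lambda>t \<tau>. \<exists>j<i. Inv j \<tau>) \<sigma>"
    and post: "\<And>j t \<tau>. Inv j \<tau> \<Longrightarrow> \<not> holds I \<tau> b \<Longrightarrow> Q t \<tau>"
  shows "wp I W (While b p) Q \<sigma>"
proof -
  have "\<exists>t \<tau>. exec I W (While b p) \<sigma> t \<tau> \<and> (\<exists>j. Inv j \<tau>) \<and> \<not> holds I \<tau> b"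
    using assms(1)
  proof (induction i arbitrary: \<sigma> rule: less_induct)
    case (less i)
    show ?case
    proof (cases "holds I \<sigma> b")
      case False
      then show ?thesis using less.prems exec.WhileF by blast
    next
      case True
      then obtain t \<sigma>' j where t: "exec I W p \<sigma> t \<sigma>'" "j < i" "Inv j \<sigma>'"
        using step[OF less.prems] unfolding wp_def by blast
      from less.IH[OF t(2,3)] exec.WhileT[OF True t(1)] show ?thesis by blast
    qed
  qed
  then show ?thesis unfolding wp_def using post by blast
qed

lemma addr_of_nat [simp]: "addr (real n) = n"
  by (simp add: addr_def)

section \<open>Frame conditions and integer arithmetic on the machine\<close>

definition unchanged :: "nat set \<Rightarrow> state \<Rightarrow> state \<Rightarrow> bool" where
  "unchanged X \<sigma> \<tau> \<longleftrightarrow> mem \<tau> = mem \<sigma> \<and> (\<forall>x. x \<notin> X \<longrightarrow> regs \<tau> x = regs \<sigma> x)"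

lemma unchanged_refl: "unchanged X \<sigma> \<sigma>"
  by (simp add: unchanged_def)

lemma unchanged_trans: "unchanged X \<sigma> \<tau> \<Longrightarrow> unchanged Y \<tau> \<upsilon> \<Longrightarrow> X \<subseteq> Z \<Longrightarrow> Y \<subseteq> Z \<Longrightarrow> unchanged Z \<sigma> \<upsilon>"
  unfolding unchanged_def by (metis subsetD)

definition divE :: "expr \<Rightarrow> expr \<Rightarrow> expr" where
  "divE a b = Floor (Quo a b)"

definition modE :: "expr \<Rightarrow> expr \<Rightarrow> expr" where
  "modE a b = Sub a (Mul b (divE a b))"

definition eqT :: "expr \<Rightarrow> expr \<Rightarrow> test" where
  "eqT a b = AndT (NotT (Less a b)) (NotT (Less b a))"

lemma holds_eqT [simp]: "holds I \<sigma> (eqT a b) \<longleftrightarrow> eval I \<sigma> a = eval I \<sigma> b"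
  by (auto simp: eqT_def)

lemma eval_divE:
  "eval I \<sigma> a = real x \<Longrightarrow> eval I \<sigma> b = real y \<Longrightarrow> eval I \<sigma> (divE a b) = real (x div y)"
  by (simp add: divE_def floor_divide_of_nat_eq)

lemma eval_modE:
  assumes "eval I \<sigma> a = real x" "eval I \<sigma> b = real y"
  shows "eval I \<sigma> (modE a b) = real (x mod y)"
proof -
  have "real x = real y * real (x div y) + real (x mod y)"
    by (metis mult_div_mod_eq of_nat_add of_nat_mult)
  then show ?thesis using assms eval_divE[OF assms] by (simp add: modE_def)
qed

section \<open>Extending a code by a vertex\<close>

definition push1E :: "expr \<Rightarrow> expr \<Rightarrow> expr" where
  "push1E c a = Quo (Lit 1) (Add (Add (Lit 2) c) (Mul a (Add (Mul (Lit 2) a) (Lit 1))))"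

lemma eval_push1E: "eval I \<sigma> a = of_int z \<Longrightarrow> eval I \<sigma> (push1E c a) = pushc (eval I \<sigma> c) z"
  by (simp add: push1E_def pushc_def)

text \<open>Register 6 holds the address of the current curve, 7 the index of the current vertex, 3 the
  radius \<open>r\<close>, 4 the cell width \<open>s\<close> and 5 the current shift, both in units of \<open>r\<close>.\<close>

definition coordE :: "nat \<Rightarrow> nat \<Rightarrow> expr" where
  "coordE d c = Floor (Quo (Inp (Add (Add (Reg 6) (Lit 1)) (Add (Mul (Reg 7) (Lit (int d))) (Lit (int c))))) (Reg 3))"

definition cornerE :: "nat \<Rightarrow> nat \<Rightarrow> expr" where
  "cornerE d c = Sub (Mul (Reg 4) (Floor (Quo (Add (coordE d c) (Reg 5)) (Reg 4)))) (Reg 5)"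

text \<open>The loop over the coordinates is unrolled when the program is built. As \<open>d\<close>
  is fixed, a vertex is then processed in a constant number of steps.\<close>

fun pushE :: "nat \<Rightarrow> expr \<Rightarrow> nat list \<Rightarrow> expr" where
  "pushE d e [] = e"
| "pushE d e (c # cs) = pushE d (push1E e (cornerE d c)) cs"

text \<open>Relative to an address, so that the same code reads the query, which starts at 0, and
  each curve within the concatenated input.\<close>

definition has_curve :: "real list \<Rightarrow> nat \<Rightarrow> 'd::finite curve \<Rightarrow> bool" where
  "has_curve I a P \<longleftrightarrow> a < length I \<and> I ! a = real (length P) \<and>
    (\<forall>i<length P. \<forall>c<CARD('d). a + 1 + (i * CARD('d) + c) < length I \<and>
      I ! (a + 1 + (i * CARD('d) + c)) = P ! i $ (coords ! c))"

lemma eval_coordE: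
  fixes P :: "'d::finite curve"
  assumes "has_curve I a P" "i < length P" "c < CARD('d)"
    "regs \<sigma> 6 = real a" "regs \<sigma> 7 = real i" "regs \<sigma> 3 = r"
  shows "eval I \<sigma> (coordE CARD('d) c) = of_int \<lfloor>P ! i $ (coords ! c) / r\<rfloor>"
proof -
  have "eval I \<sigma> (Add (Add (Reg 6) (Lit 1)) (Add (Mul (Reg 7) (Lit (int CARD('d)))) (Lit (int c)))) =
    real (a + 1 + (i * CARD('d) + c))"
    using assms by simp
  then show ?thesis
    using assms unfolding coordE_def has_curve_def
    by (simp del: of_nat_add of_nat_mult of_nat_Suc add: Let_def)
qed

lemma eval_cornerE:
  fixes P :: "'d::finite curve"
  assumes "has_curve I a P" "i < length P" "c < CARD('d)"
    "regs \<sigma> 6 = real a" "regs \<sigma> 7 = real i" "regs \<sigma> 3 = r" "regs \<sigma> 4 = real s" "regs \<sigma> 5 = real j"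
  shows "eval I \<sigma> (cornerE CARD('d) c) = of_int (corner s j \<lfloor>P ! i $ (coords ! c) / r\<rfloor>)"
proof -
  have "\<lfloor>(of_int \<lfloor>P ! i $ (coords ! c) / r\<rfloor> + real j) / real s\<rfloor> =
    (\<lfloor>P ! i $ (coords ! c) / r\<rfloor> + int j) div int s"
    using floor_divide_of_int_eq[of "\<lfloor>P ! i $ (coords ! c) / r\<rfloor> + int j" "int s"] by simp
  then show ?thesis
    using eval_coordE[OF assms(1-6)] assms(7,8) by (simp add: cornerE_def corner_def)
qed

lemma eval_pushE:
  fixes P :: "'d::finite curve"
  assumes "has_curve I a P" "i < length P"
    "regs \<sigma> 6 = real a" "regs \<sigma> 7 = real i" "regs \<sigma> 3 = r" "regs \<sigma> 4 = real s" "regs \<sigma> 5 = real j"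
  shows "eval I \<sigma> (pushE CARD('d) e [0..<CARD('d)]) = foldl pushc (eval I \<sigma> e) (vcorner s r j (P ! i))"
proof -
  have *: "eval I \<sigma> (pushE CARD('d) e cs) =
    foldl pushc (eval I \<sigma> e) (map (\<lambda>c. corner s j \<lfloor>P ! i $ (coords ! c) / r\<rfloor>) cs)"
    if "set cs \<subseteq> {0..<CARD('d)}" for cs
    using that
  proof (induction cs arbitrary: e)
    case (Cons c cs)
    then have "eval I \<sigma> (push1E e (cornerE CARD('d) c)) =
      pushc (eval I \<sigma> e) (corner s j \<lfloor>P ! i $ (coords ! c) / r\<rfloor>)"
      using assms by (intro eval_push1E eval_cornerE) auto
    then show ?case using Cons by simp
  qed simp
  have "vcorner s r j (P ! i) = map (\<lambda>c. corner s j \<lfloor>P ! i $ (coords ! c) / r\<rfloor>) [0..<CARD('d)]"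
    unfolding vcorner_def
    by (rule nth_equalityI) (auto simp: coords_props)
  then show ?thesis using *[of "[0..<CARD('d)]"] by simp
qed

text \<open>Registers 9 and 10 are the pair on which \<open>dstep\<close> acts. The language has no
  skip; assigning to the scratch register 27 takes its place, here and below.\<close>

definition vpush :: "nat \<Rightarrow> prog" where
  "vpush d = Seq (Assign 27 (pushE d (Reg 9) [0..<d]))
     (Cond (eqT (Reg 27) (Reg 10)) (Assign 27 (Lit 0))
       (Seq (Assign 9 (Reg 10)) (Assign 10 (pushE d (Reg 9) [0..<d]))))"

definition vcost :: "nat \<Rightarrow> nat" where
  "vcost d = 2 * ecost (pushE d (Reg 9) [0..<d]) + 20"

lemma wp_vpush:
  fixes P :: "'d::finite curve"
  assumes "has_curve I a P" "i < length P"
    "regs \<sigma> 6 = real a" "regs \<sigma> 7 = real i" "regs \<sigma> 3 = r" "regs \<sigma> 4 = real s" "regs \<sigma> 5 = real j"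
  shows "wp I W (vpush CARD('d)) (\<lambda>t \<tau>. t \<le> vcost CARD('d) \<and> unchanged {9, 10, 27} \<sigma> \<tau> \<and>
    (regs \<tau> 9, regs \<tau> 10) = dstep (regs \<sigma> 9, regs \<sigma> 10) (vcorner s r j (P ! i))) \<sigma>"
proof -
  note ev1 = eval_pushE[OF assms]
  have ev2: "eval I (\<sigma>\<lparr>regs := (regs \<sigma>)(27 := v, 9 := u)\<rparr>) (pushE CARD('d) (Reg 9) [0..<CARD('d)]) =
      foldl pushc u (vcorner s r j (P ! i))" for u v
    by (subst eval_pushE[OF assms(1,2)]) (use assms in auto)
  show ?thesis
    unfolding vpush_def
    by (intro wp_Seq wp_Assign wp_Cond)
      (auto simp: ev1 ev2 vcost_def unchanged_def dstep_def eqT_def)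
qed

definition halfE :: expr where
  "halfE = divE (Reg 24) (Lit 2)"

text \<open>Register 8 holds the remaining base-\<open>s\<close> digits of the shift vector and 23 the remaining base-\<open>2m\<close>
  digits describing the walk.\<close>

definition walk_body :: "nat \<Rightarrow> prog" where
  "walk_body d = Seq (Assign 5 (modE (Reg 8) (Reg 4))) (Seq (Assign 24 (modE (Reg 23) (Reg 20))) (Seq (vpush d)
     (Cond (Less (Reg 7) halfE) (Assign 7 (Add (Reg 7) (Lit 1)))
       (Seq (Assign 7 (Add (Reg 7) (modE (Reg 24) (Lit 2))))
         (Seq (Assign 8 (divE (Reg 8) (Reg 4))) (Assign 23 (divE (Reg 23) (Reg 20))))))))"

lemma wp_walk_body:
  fixes Q :: "'d::finite curve"
  assumes "has_curve I a Q" "q < length Q"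
    "regs \<sigma> 6 = real a" "regs \<sigma> 7 = real q" "regs \<sigma> 3 = r" "regs \<sigma> 4 = real s"
    "regs \<sigma> 8 = real x" "regs \<sigma> 23 = real y" "regs \<sigma> 20 = real M"
  shows "wp I W (walk_body CARD('d)) (\<lambda>t \<tau>. t \<le> vcost CARD('d) + 60 \<and>
    unchanged {5, 7, 8, 9, 10, 23, 24, 27} \<sigma> \<tau> \<and>
    (regs \<tau> 9, regs \<tau> 10) = dstep (regs \<sigma> 9, regs \<sigma> 10) (vcorner s r (x mod s) (Q ! q)) \<and>
    (if q < (y mod M) div 2 then regs \<tau> 7 = real (Suc q) \<and> regs \<tau> 8 = real x \<and> regs \<tau> 23 = real y
     else regs \<tau> 7 = real (q + (y mod M) mod 2) \<and> regs \<tau> 8 = real (x div s) \<and> regs \<tau> 23 = real (y div M))) \<sigma>"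
proof -
  let ?next = "\<lambda>\<tau>. if q < (y mod M) div 2 then regs \<tau> 7 = real (Suc q) \<and> regs \<tau> 8 = real x \<and> regs \<tau> 23 = real y
     else regs \<tau> 7 = real (q + (y mod M) mod 2) \<and> regs \<tau> 8 = real (x div s) \<and> regs \<tau> 23 = real (y div M)"
  let ?move = "Cond (Less (Reg 7) halfE) (Assign 7 (Add (Reg 7) (Lit 1)))
       (Seq (Assign 7 (Add (Reg 7) (modE (Reg 24) (Lit 2))))
         (Seq (Assign 8 (divE (Reg 8) (Reg 4))) (Assign 23 (divE (Reg 23) (Reg 20)))))"
  define \<sigma>1 where "\<sigma>1 = \<sigma>\<lparr>regs := (regs \<sigma>)(5 := real (x mod s), 24 := real (y mod M))\<rparr>"
  have e1: "eval I \<sigma> (modE (Reg 8) (Reg 4)) = real (x mod s)"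
    using assms by (intro eval_modE) auto
  have e2: "eval I (\<sigma>\<lparr>regs := (regs \<sigma>)(5 := v)\<rparr>) (modE (Reg 23) (Reg 20)) = real (y mod M)" for v
    using assms by (intro eval_modE) auto
  have c: "ecost (modE (Reg 8) (Reg 4)) = 8" "ecost (modE (Reg 23) (Reg 20)) = 8" "ecost halfE = 4"
    "ecost (modE (Reg 24) (Lit 2)) = 8" "ecost (divE (Reg 8) (Reg 4)) = 4" "ecost (divE (Reg 23) (Reg 20)) = 4"
    by (simp_all add: modE_def divE_def halfE_def)
  have rest: "wp I W ?move
     (\<lambda>t \<tau>. t \<le> 40 \<and> unchanged {7, 8, 23} \<sigma>' \<tau> \<and>
     ?next \<tau>) \<sigma>'"
    if \<sigma>': "unchanged {9, 10, 27} \<sigma>1 \<sigma>'" for \<sigma>'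
  proof -
    have r: "regs \<sigma>' 7 = real q" "regs \<sigma>' 24 = real (y mod M)" "regs \<sigma>' 8 = real x" "regs \<sigma>' 4 = real s"
      "regs \<sigma>' 23 = real y" "regs \<sigma>' 20 = real M"
      using \<sigma>' assms by (auto simp: unchanged_def \<sigma>1_def)
    have e3: "eval I \<sigma>' halfE = real (y mod M div 2)" unfolding halfE_def
      by (rule eval_divE) (use r in auto)
    have e4: "eval I \<sigma>' (modE (Reg 24) (Lit 2)) = real (y mod M mod 2)"
      by (rule eval_modE) (use r in auto)
    have e5: "eval I (\<sigma>'\<lparr>regs := (regs \<sigma>')(7 := v)\<rparr>) (divE (Reg 8) (Reg 4)) = real (x div s)" for v
      by (rule eval_divE) (use r in auto)
    have e6: "eval I (\<sigma>'\<lparr>regs := (regs \<sigma>')(7 := v, 8 := w)\<rparr>) (divE (Reg 23) (Reg 20)) = real (y div M)" for v w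
      by (rule eval_divE) (use r in auto)
    show ?thesis
      by (intro wp_Seq wp_Assign wp_Cond) (auto simp: r e3 e4 e5 e6 c unchanged_def)
  qed
  have "wp I W (vpush CARD('d)) (\<lambda>t \<tau>. t \<le> vcost CARD('d) \<and> unchanged {9, 10, 27} \<sigma>1 \<tau> \<and>
    (regs \<tau> 9, regs \<tau> 10) = dstep (regs \<sigma>1 9, regs \<sigma>1 10) (vcorner s r (x mod s) (Q ! q))) \<sigma>1"
    by (rule wp_vpush[OF assms(1,2)]) (use assms in \<open>auto simp: \<sigma>1_def\<close>)
  then have "wp I W (Seq (vpush CARD('d)) ?move) (\<lambda>t \<tau>. t \<le> vcost CARD('d) + 40 \<and>
    unchanged {5, 7, 8, 9, 10, 23, 24, 27} \<sigma> \<tau> \<and>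
    (regs \<tau> 9, regs \<tau> 10) = dstep (regs \<sigma> 9, regs \<sigma> 10) (vcorner s r (x mod s) (Q ! q)) \<and>
    ?next \<tau>) \<sigma>1"
    apply (intro wp_Seq)
    apply (erule wp_mono)
    apply (elim conjE)
    apply (rule wp_mono[OF rest], assumption)
    apply (auto simp: \<sigma>1_def unchanged_def)
    done
  then show ?thesis
    unfolding walk_body_def
    apply (intro wp_Seq[of _ _ "Assign _ _"] wp_Assign)
    apply (simp add: e1 e2 c \<sigma>1_def)
    apply (erule wp_mono)
    apply auto
    done
qed

definition walkP :: "nat \<Rightarrow> prog" where
  "walkP d = Seq (Assign 7 (Lit 0)) (Seq (Assign 9 (Lit 0)) (Seq (Assign 10 (Lit 0))
     (While (Less (Reg 7) (Inp (Reg 6))) (walk_body d))))"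

definition walk_elem :: "nat \<Rightarrow> real \<Rightarrow> nat \<Rightarrow> 'd::finite curve \<Rightarrow> nat \<times> nat \<Rightarrow> int list" where
  "walk_elem s r x Q = (\<lambda>(q, b). vcorner s r (x div s ^ b mod s) (Q ! q))"

text \<open>The invariant looks forward: folding the rest of the walk onto the current pair still
  yields the final code. The measure is the one by which \<open>walk\<close> terminates, as each
  step advances the query or consumes a digit.\<close>

lemma wp_walkP:
  fixes Q :: "'d::finite curve"
  assumes Q: "has_curve I a Q" "length Q \<le> m"
    and regs: "regs \<sigma> 6 = real a" "regs \<sigma> 3 = r" "regs \<sigma> 4 = real s" "regs \<sigma> 8 = real x"
      "regs \<sigma> 23 = real (undigits (2 * m) es)" "regs \<sigma> 20 = real (2 * m)"
    and es: "es \<noteq> []" "\<forall>e\<in>set es. e < 2 * m" "last es = 2 * m - 1"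
  shows "wp I W (walkP CARD('d)) (\<lambda>t \<tau>. t \<le> (length es + length Q) * (vcost CARD('d) + 65) + 11 \<and>
    unchanged {5, 7, 8, 9, 10, 23, 24, 27} \<sigma> \<tau> \<and>
    regs \<tau> 10 = seq_code (map (walk_elem s r x Q) (walk (length Q) 0 0 es))) \<sigma>"
proof -
  define G where "G = walk_elem s r x Q"
  define target where "target = seq_code (map G (walk (length Q) 0 0 es))"
  let ?X = "{5, 7, 8, 9, 10, 23, 24, 27} :: nat set"
  define Inv where "Inv i \<tau> \<longleftrightarrow> unchanged ?X \<sigma> \<tau> \<and> (\<exists>q b es. i = length es + (length Q - q) \<and>
    regs \<tau> 7 = real q \<and> regs \<tau> 8 = real (x div s ^ b) \<and> regs \<tau> 23 = real (undigits (2 * m) es) \<and>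
    (es = [] \<longrightarrow> length Q \<le> q) \<and> (\<forall>e\<in>set es. e < 2 * m) \<and> (es \<noteq> [] \<longrightarrow> last es = 2 * m - 1) \<and>
    snd (foldl dstep (regs \<tau> 9, regs \<tau> 10) (map G (walk (length Q) q b es))) = target)" for i \<tau>
  have cond: "holds I \<tau> (Less (Reg 7) (Inp (Reg 6))) \<longleftrightarrow> q < length Q"
    if "unchanged ?X \<sigma> \<tau>" "regs \<tau> 7 = real q" for \<tau> q
    using that Q regs(1) by (auto simp: unchanged_def has_curve_def)
  have step: "wp I W (walk_body CARD('d)) (\<lambda>t \<tau>'. t \<le> vcost CARD('d) + 60 \<and> (\<exists>j<i. Inv j \<tau>')) \<tau>"
    if inv: "Inv i \<tau>" and h: "holds I \<tau> (Less (Reg 7) (Inp (Reg 6)))" for i \<tau>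
  proof -
    obtain q b es where u: "unchanged ?X \<sigma> \<tau>" and i: "i = length es + (length Q - q)" and
      r: "regs \<tau> 7 = real q" "regs \<tau> 8 = real (x div s ^ b)" "regs \<tau> 23 = real (undigits (2 * m) es)"
      and ne: "es = [] \<longrightarrow> length Q \<le> q" and dig: "\<forall>e\<in>set es. e < 2 * m" and
      last: "es \<noteq> [] \<longrightarrow> last es = 2 * m - 1" and
      tgt: "snd (foldl dstep (regs \<tau> 9, regs \<tau> 10) (map G (walk (length Q) q b es))) = target"
      using inv unfolding Inv_def by blast
    have q: "q < length Q" using h cond[OF u r(1)] by simp
    obtain e es' where es': "es = e # es'" using ne q by (cases es) auto
    have e: "e < 2 * m" "undigits (2 * m) es mod (2 * m) = e" "undigits (2 * m) es div (2 * m) = undigits (2 * m) es'"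
      using dig es' by auto
    have walk: "walk (length Q) q b es = (q, b) # (if q < e div 2 then walk (length Q) (Suc q) b es
      else walk (length Q) (q + e mod 2) (Suc b) es')"
      using q unfolding es' by (simp add: walk.simps(2)[of _ q b])
    \<comment> \<open>The forced last digit is consumed only when the query is exhausted; otherwise
      the machine would go on reading zeros beyond the numeral.\<close>
    have ende: "q + e mod 2 = length Q" if "es' = []" "\<not> q < e div 2"
    proof -
      have "e = 2 * m - 1" using last es' that by simp
      moreover have "(2 * m - 1) mod 2 = 1" "(2 * m - 1) div 2 = m - 1" using e(1) by presburger+
      ultimately show ?thesis using that q Q(2) by simp
    qed
    have r': "regs \<tau> 6 = real a" "regs \<tau> 3 = r" "regs \<tau> 4 = real s" "regs \<tau> 20 = real (2 * m)"
      using u regs by (auto simp: unchanged_def)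
    show ?thesis
    proof (rule wp_mono[OF wp_walk_body[OF Q(1) q r'(1) r(1) r'(2,3) r(2,3) r'(4)]], elim conjE, intro conjI)
      fix t \<tau>'
      assume u': "unchanged ?X \<tau> \<tau>'" and
        d: "(regs \<tau>' 9, regs \<tau>' 10) = dstep (regs \<tau> 9, regs \<tau> 10) (vcorner s r (x div s ^ b mod s) (Q ! q))"
        and c: "if q < (undigits (2 * m) es mod (2 * m)) div 2 then regs \<tau>' 7 = real (Suc q) \<and> regs \<tau>' 8 = real (x div s ^ b) \<and>
          regs \<tau>' 23 = real (undigits (2 * m) es)
       else regs \<tau>' 7 = real (q + (undigits (2 * m) es mod (2 * m)) mod 2) \<and>
         regs \<tau>' 8 = real (x div s ^ b div s) \<and> regs \<tau>' 23 = real (undigits (2 * m) es div (2 * m))"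
      have uu: "unchanged ?X \<sigma> \<tau>'" by (rule unchanged_trans[OF u u']) auto
      have dd: "snd (foldl dstep (regs \<tau>' 9, regs \<tau>' 10) (map G (if q < e div 2 then walk (length Q) (Suc q) b es
        else walk (length Q) (q + e mod 2) (Suc b) es'))) = target"
        using tgt unfolding walk d by (simp add: G_def walk_elem_def)
      show "\<exists>j<i. Inv j \<tau>'"
      proof (cases "q < e div 2")
        case True
        have "Inv (length es + (length Q - Suc q)) \<tau>'"
          unfolding Inv_def using True uu dd c dig last es' unfolding e(2)
          by (intro conjI exI[of _ "Suc q"] exI[of _ b] exI[of _ es]) auto
        moreover have "length es + (length Q - Suc q) < i" using i q by simp
        ultimately show ?thesis by blast
      next
        case False
        have "Inv (length es' + (length Q - (q + e mod 2))) \<tau>'"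
          unfolding Inv_def
          using False uu dd c dig last es' ende unfolding e(2,3)
          by (intro conjI exI[of _ "q + e mod 2"] exI[of _ "Suc b"] exI[of _ es'])
            (auto simp: div_mult2_eq[symmetric] mult.commute)
        moreover have "length es' + (length Q - (q + e mod 2)) < i" using i es' by simp
        ultimately show ?thesis by blast
      qed
    qed
  qed
  define \<sigma>1 where "\<sigma>1 = \<sigma>\<lparr>regs := (regs \<sigma>)(7 := 0, 9 := 0, 10 := 0)\<rparr>"
  have init: "Inv (length es + length Q) \<sigma>1"
    unfolding Inv_def using regs es
    by (intro conjI exI[of _ 0] exI[of _ es]) (auto simp: \<sigma>1_def unchanged_def target_def seq_code_def)
  have "wp I W (While (Less (Reg 7) (Inp (Reg 6))) (walk_body CARD('d)))
    (\<lambda>t \<tau>. t \<le> (length es + length Q) * (vcost CARD('d) + 65) + 5 \<and>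
      unchanged ?X \<sigma> \<tau> \<and> regs \<tau> 10 = target) \<sigma>1"
  proof (rule wp_While[of Inv, OF init step])
    fix j t \<tau>
    assume inv: "Inv j \<tau>" and h: "\<not> holds I \<tau> (Less (Reg 7) (Inp (Reg 6)))"
      and t: "t \<le> (length es + length Q) * (vcost CARD('d) + 60 + tcost (Less (Reg 7) (Inp (Reg 6))) + 1) +
        tcost (Less (Reg 7) (Inp (Reg 6))) + 1"
    obtain q b es' where u: "unchanged ?X \<sigma> \<tau>" and r: "regs \<tau> 7 = real q" and
      tgt: "snd (foldl dstep (regs \<tau> 9, regs \<tau> 10) (map G (walk (length Q) q b es'))) = target"
      using inv unfolding Inv_def by blast
    have "length Q \<le> q" using h cond[OF u r] by simp
    then have "regs \<tau> 10 = target" using tgt by (simp add: walk_ge)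
    moreover have "vcost CARD('d) + 60 + tcost (Less (Reg 7) (Inp (Reg 6))) + 1 = vcost CARD('d) + 65"
      "tcost (Less (Reg 7) (Inp (Reg 6))) + 1 = 5" by simp_all
    then have "t \<le> (length es + length Q) * (vcost CARD('d) + 65) + 5"
      using t by (simp only: add.assoc)
    ultimately show "t \<le> (length es + length Q) * (vcost CARD('d) + 65) + 5 \<and>
      unchanged ?X \<sigma> \<tau> \<and> regs \<tau> 10 = target" using u by blast
  qed
  then show ?thesis
    unfolding walkP_def
    apply (intro wp_Seq[of _ _ "Assign _ _"] wp_Assign)
    apply (simp add: \<sigma>1_def[symmetric])
    apply (erule wp_mono)
    apply (auto simp: target_def G_def)
    done
qed

section \<open>Binary search\<close>

definition bsearch :: prog where
  "bsearch = Seq (Assign 25 (Lit 0)) (Seq (Assign 26 (Reg 19))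
     (While (Less (Add (Reg 25) (Lit 1)) (Reg 26))
       (Seq (Assign 28 (divE (Add (Reg 25) (Reg 26)) (Lit 2)))
         (Cond (Less (Reg 10) (Mem (Add (Lit 8) (Reg 28)))) (Assign 26 (Reg 28)) (Assign 25 (Reg 28))))))"

text \<open>The result is the last index whose key does not exceed the one sought, or 0 by default.
  If the key occurs it is found there; if not, the result says nothing, and \<open>probe\<close>
  compares once more.\<close>

lemma wp_bsearch:
  assumes A: "\<forall>i<n. mem \<sigma> (8 + i) = A i" "\<forall>i j. i \<le> j \<longrightarrow> j < n \<longrightarrow> A i \<le> A j"
    and n: "regs \<sigma> 19 = real n" "1 \<le> n" "n \<le> 2 ^ l"
  shows "wp I W bsearch (\<lambda>t \<tau>. t \<le> l * 30 + 20 \<and> unchanged {25, 26, 28} \<sigma> \<tau> \<and>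
    (\<exists>lo<n. regs \<tau> 25 = real lo \<and> ((\<exists>i<n. A i = regs \<sigma> 10) \<longrightarrow> A lo = regs \<sigma> 10))) \<sigma>"
proof -
  let ?b = "Less (Add (Reg 25) (Lit 1)) (Reg 26)"
  let ?X = "{25, 26, 28} :: nat set"
  define Inv where "Inv i \<tau> \<longleftrightarrow> unchanged ?X \<sigma> \<tau> \<and> (\<exists>lo hi. regs \<tau> 25 = real lo \<and> regs \<tau> 26 = real hi \<and>
    lo < hi \<and> hi \<le> n \<and> hi - lo \<le> 2 ^ i \<and> (hi = n \<or> regs \<sigma> 10 < A hi) \<and> (lo = 0 \<or> A lo \<le> regs \<sigma> 10))"
    for i \<tau>
  define \<sigma>1 where "\<sigma>1 = \<sigma>\<lparr>regs := (regs \<sigma>)(25 := 0, 26 := real n)\<rparr>"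
  have init: "Inv l \<sigma>1"
    unfolding Inv_def using n by (auto simp: \<sigma>1_def unchanged_def intro!: exI[of _ 0] exI[of _ n])
  have step: "wp I W (Seq (Assign 28 (divE (Add (Reg 25) (Reg 26)) (Lit 2)))
         (Cond (Less (Reg 10) (Mem (Add (Lit 8) (Reg 28)))) (Assign 26 (Reg 28)) (Assign 25 (Reg 28))))
      (\<lambda>t \<tau>'. t \<le> 22 \<and> (\<exists>j<i. Inv j \<tau>')) \<tau>"
    if inv: "Inv i \<tau>" and h: "holds I \<tau> ?b" for i \<tau>
  proof -
    obtain lo hi where u: "unchanged ?X \<sigma> \<tau>" and r: "regs \<tau> 25 = real lo" "regs \<tau> 26 = real hi"
      and lh: "lo < hi" "hi \<le> n" "hi - lo \<le> 2 ^ i" "hi = n \<or> regs \<sigma> 10 < A hi" "lo = 0 \<or> A lo \<le> regs \<sigma> 10"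
      using inv unfolding Inv_def by blast
    have lt: "lo + 1 < hi" using h r by simp
    then have "i \<noteq> 0" using lh(3) by (cases i) auto
    then obtain i' where i': "i = Suc i'" using not0_implies_Suc by blast
    define mid where "mid = (lo + hi) div 2"
    have mid: "lo < mid" "mid < hi" "hi - mid \<le> 2 ^ i'" "mid - lo \<le> 2 ^ i'"
      using lt lh(3) unfolding mid_def i' by auto
    have e: "eval I \<tau> (divE (Add (Reg 25) (Reg 26)) (Lit 2)) = real mid"
      unfolding mid_def by (rule eval_divE) (use r in auto)
    have "addr (8 + real mid) = 8 + mid"
      using addr_of_nat[of "8 + mid"] by (simp only: of_nat_add of_nat_numeral)
    then have c: "mem \<tau> (addr (8 + real mid)) = A mid"
      using A(1) mid lh(2) u by (simp add: unchanged_def)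
    have cost: "ecost (divE (Add (Reg 25) (Reg 26)) (Lit 2)) = 6" by (simp add: divE_def)
    have u10: "regs \<tau> 10 = regs \<sigma> 10" using u by (simp add: unchanged_def)
    have I1: "Inv i' (\<tau>\<lparr>regs := (regs \<tau>)(28 := real mid, 26 := real mid)\<rparr>)" if "regs \<sigma> 10 < A mid"
      unfolding Inv_def using u r lh mid that
      by (intro conjI exI[of _ lo] exI[of _ mid]) (auto simp: unchanged_def)
    have I2: "Inv i' (\<tau>\<lparr>regs := (regs \<tau>)(28 := real mid, 25 := real mid)\<rparr>)" if "\<not> regs \<sigma> 10 < A mid"
      unfolding Inv_def using u r lh mid that
      by (intro conjI exI[of _ mid] exI[of _ hi]) (auto simp: unchanged_def)
    show ?thesis
      using I1 I2 unfolding i'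
      by (intro wp_Seq wp_Assign wp_Cond) (auto simp: e c u10 cost)
  qed
  have "wp I W (While ?b (Seq (Assign 28 (divE (Add (Reg 25) (Reg 26)) (Lit 2)))
         (Cond (Less (Reg 10) (Mem (Add (Lit 8) (Reg 28)))) (Assign 26 (Reg 28)) (Assign 25 (Reg 28)))))
    (\<lambda>t \<tau>. t \<le> l * 30 + 10 \<and> unchanged ?X \<sigma> \<tau> \<and>
    (\<exists>lo<n. regs \<tau> 25 = real lo \<and> ((\<exists>i<n. A i = regs \<sigma> 10) \<longrightarrow> A lo = regs \<sigma> 10))) \<sigma>1"
  proof (rule wp_While[of Inv, OF init step])
    fix j t \<tau>
    assume inv: "Inv j \<tau>" and h: "\<not> holds I \<tau> ?b"
      and t: "t \<le> l * (22 + tcost ?b + 1) + tcost ?b + 1"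
    obtain lo hi where u: "unchanged ?X \<sigma> \<tau>" and r: "regs \<tau> 25 = real lo" "regs \<tau> 26 = real hi"
      and lh: "lo < hi" "hi \<le> n" "hi = n \<or> regs \<sigma> 10 < A hi" "lo = 0 \<or> A lo \<le> regs \<sigma> 10"
      using inv unfolding Inv_def by blast
    have hi: "hi = Suc lo" using h r lh by simp
    have "A lo = regs \<sigma> 10" if i: "i < n" "A i = regs \<sigma> 10" for i
    proof -
      have "i \<le> lo"
        using A(2)[rule_format, of hi i] lh(3) i hi by (cases "i \<le> lo") auto
      then have "A i \<le> A lo" using A(2) lh by simp
      then show ?thesis using lh(4) i \<open>i \<le> lo\<close> by auto
    qed
    then show "t \<le> l * 30 + 10 \<and> unchanged ?X \<sigma> \<tau> \<and>
      (\<exists>lo<n. regs \<tau> 25 = real lo \<and> ((\<exists>i<n. A i = regs \<sigma> 10) \<longrightarrow> A lo = regs \<sigma> 10))"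
      using u r lh t by auto
  qed
  then show ?thesis
    unfolding bsearch_def
    apply (intro wp_Seq[of _ _ "Assign _ _"] wp_Assign)
    apply (simp add: \<sigma>1_def[symmetric] n)
    apply (erule wp_mono)
    apply auto
    done
qed

section \<open>The query program\<close>

definition probe :: "nat \<Rightarrow> prog" where
  "probe d = Seq (Assign 8 (modE (Reg 17) (Reg 12))) (Seq (Assign 23 (Reg 21)) (Seq (walkP d) (Seq bsearch
     (Cond (eqT (Reg 10) (Mem (Add (Lit 8) (Reg 25)))) (Assign 0 (Mem (Add (Add (Lit 8) (Reg 19)) (Reg 25))))
       (Assign 27 (Lit 0))))))"

definition probes :: "nat \<Rightarrow> prog" where
  "probes d = While (Less (Reg 21) (Reg 13)) (Seq (probe d) (Assign 21 (Add (Reg 21) (Lit 1))))"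

definition rounds :: "nat \<Rightarrow> prog" where
  "rounds d = While (Less (Lit 0) (Reg 17))
     (Seq (Assign 21 (Reg 22)) (Seq (probes d) (Assign 17 (divE (Reg 17) (Reg 12)))))"

text \<open>Cells 0 to 7 hold the parameters loaded here, cells \<open>8..<8 + n\<close> the sorted keys and the next \<open>n\<close>
  cells the positions of their curves. The digits of cell 7 in base \<open>s ^ k\<close> are the shift vectors; cells 5
  and 6 delimit the numbers whose base-\<open>2m\<close> digits are the admissible walks.\<close>

definition query_prog :: "nat \<Rightarrow> prog" where
  "query_prog d = Seq (Assign 19 (Mem (Lit 0))) (Seq (Assign 3 (Mem (Lit 1))) (Seq (Assign 4 (Mem (Lit 2)))
     (Seq (Assign 12 (Mem (Lit 3))) (Seq (Assign 20 (Mem (Lit 4))) (Seq (Assign 22 (Mem (Lit 5)))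
     (Seq (Assign 13 (Mem (Lit 6))) (Seq (Assign 17 (Mem (Lit 7))) (rounds d))))))))"

section \<open>Correctness and running time of the query\<close>

lemma undigits_inj:
  assumes "undigits M xs = undigits M ys" "length xs = length ys" "\<forall>e\<in>set xs. e < M" "\<forall>e\<in>set ys. e < M"
  shows "xs = ys"
  using assms by (metis nth_equalityI undigits_digit)

definition valid_walk :: "nat \<Rightarrow> nat \<Rightarrow> nat list \<Rightarrow> bool" where
  "valid_walk k m es \<longleftrightarrow> length es = k \<and> (\<forall>e\<in>set es. e < 2 * m) \<and> last es = 2 * m - 1"

lemma valid_walk_bounds:
  assumes "valid_walk k m es" "k \<ge> 1"
  shows "(2 * m - 1) * (2 * m) ^ (k - 1) \<le> undigits (2 * m) es \<and> undigits (2 * m) es < (2 * m) ^ k"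
  using assms undigits_last_ge[of es "2 * m"] undigits_less[of es "2 * m"]
  by (cases "es = []") (auto simp: valid_walk_def simp del: power_mult_distrib)

definition walk_code :: "nat \<Rightarrow> real \<Rightarrow> 'd::finite curve \<Rightarrow> nat \<Rightarrow> nat list \<Rightarrow> real" where
  "walk_code s r Q x es = seq_code (map (walk_elem s r x Q) (walk (length Q) 0 0 es))"

definition stores_params :: "(nat \<Rightarrow> real) \<Rightarrow> nat \<Rightarrow> nat \<Rightarrow> nat \<Rightarrow> nat \<Rightarrow> nat \<Rightarrow> real \<Rightarrow> bool" where
  "stores_params D n m k s z r \<longleftrightarrow> D 0 = real n \<and> D 1 = r \<and> D 2 = real s \<and> D 3 = real (s ^ k) \<and> D 4 = real (2 * m) \<and>
    D 5 = real ((2 * m - 1) * (2 * m) ^ (k - 1)) \<and> D 6 = real ((2 * m) ^ k) \<and> D 7 = real z"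

text \<open>The search is separated from the geometry: any sorted table will do in which a key equal
  to a walk code has a \<open>Good\<close> value. In \<open>sound\<close> the shift vector
  \<open>x\<close> is arbitrary, as a hit may come from a foreign one.\<close>

locale query_run =
  fixes Q :: "'d::finite curve" and I :: "real list" and W :: "nat set" and D :: "nat \<Rightarrow> real"
    and A V :: "nat \<Rightarrow> real" and n m k s z l :: nat and r :: real and Good :: "real \<Rightarrow> bool"
  assumes Q: "has_curve I 0 Q" "1 \<le> length Q" "length Q \<le> m"
    and k: "1 \<le> k" "k \<le> m" and n: "1 \<le> n" "n \<le> 2 ^ l" and s: "2 \<le> s"
    and D: "stores_params D n m k s z r"
    and A: "\<forall>i<n. D (8 + i) = A i" "\<forall>i j. i \<le> j \<longrightarrow> j < n \<longrightarrow> A i \<le> A j"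
    and V: "\<forall>i<n. D (8 + n + i) = V i"
    and sound: "\<And>x es i. valid_walk k m es \<Longrightarrow> i < n \<Longrightarrow> A i = walk_code s r Q x es \<Longrightarrow> Good (V i)"
begin

definition env :: "state \<Rightarrow> bool" where
  "env \<sigma> \<longleftrightarrow> mem \<sigma> = D \<and> regs \<sigma> 3 = r \<and> regs \<sigma> 4 = real s \<and> regs \<sigma> 6 = 0 \<and> regs \<sigma> 12 = real (s ^ k) \<and>
    regs \<sigma> 13 = real ((2 * m) ^ k) \<and> regs \<sigma> 19 = real n \<and> regs \<sigma> 20 = real (2 * m) \<and>
    regs \<sigma> 22 = real ((2 * m - 1) * (2 * m) ^ (k - 1))"

definition hit :: "nat \<Rightarrow> nat list \<Rightarrow> bool" where
  "hit x es \<longleftrightarrow> (\<exists>i<n. A i = walk_code s r Q x es)"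

definition probe_cost :: nat where
  "probe_cost = (k + m) * (vcost CARD('d) + 65) + l * 30 + 70"

lemma env_unchanged: "env \<sigma> \<Longrightarrow> unchanged X \<sigma> \<tau> \<Longrightarrow> X \<inter> {3, 4, 6, 12, 13, 19, 20, 22} = {} \<Longrightarrow> env \<tau>"
  unfolding env_def unchanged_def by auto

text \<open>A miss leaves register 0 alone, and a hit replaces its content by a good answer; so once
  an answer is good, it stays good.\<close>

lemma wp_probe:
  assumes env: "env \<sigma>" and regs: "regs \<sigma> 17 = real zz" "regs \<sigma> 21 = real (undigits (2 * m) es)"
    and es: "valid_walk k m es"
  shows "wp I W (probe CARD('d)) (\<lambda>t \<tau>. t \<le> probe_cost \<and>
    unchanged {0, 5, 7, 8, 9, 10, 23, 24, 25, 26, 27, 28} \<sigma> \<tau> \<and>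
    (if hit (zz mod s ^ k) es then Good (regs \<tau> 0) else regs \<tau> 0 = regs \<sigma> 0)) \<sigma>"
proof -
  let ?X = "{5, 7, 8, 9, 10, 23, 24, 27} :: nat set"
  let ?Y = "{25, 26, 28} :: nat set"
  define x where "x = zz mod s ^ k"
  define K where "K = walk_code s r Q x es"
  let ?f = "Cond (eqT (Reg 10) (Mem (Add (Lit 8) (Reg 25)))) (Assign 0 (Mem (Add (Add (Lit 8) (Reg 19)) (Reg 25))))
       (Assign 27 (Lit 0))"
  let ?P = "\<lambda>\<tau>. unchanged {0, 5, 7, 8, 9, 10, 23, 24, 25, 26, 27, 28} \<sigma> \<tau> \<and>
    (if hit x es then Good (regs \<tau> 0) else regs \<tau> 0 = regs \<sigma> 0)"
  have e1: "eval I \<sigma> (modE (Reg 17) (Reg 12)) = real x"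
    unfolding x_def using env regs by (intro eval_modE) (auto simp: env_def)
  have c1: "ecost (modE (Reg 17) (Reg 12)) = 8" by (simp add: modE_def divE_def)
  define \<sigma>1 where "\<sigma>1 = \<sigma>\<lparr>regs := (regs \<sigma>)(8 := real x, 23 := real (undigits (2 * m) es))\<rparr>"
  have fin: "wp I W ?f (\<lambda>t \<tau>. t \<le> 25 \<and> unchanged {0, 27} \<tau>2 \<tau> \<and>
      (if hit x es then Good (regs \<tau> 0) else regs \<tau> 0 = regs \<tau>2 0)) \<tau>2"
    if mem: "mem \<tau>2 = D" and r: "regs \<tau>2 19 = real n" "regs \<tau>2 10 = K" "regs \<tau>2 25 = real lo" and lo: "lo < n"
      and lo2: "(\<exists>i<n. A i = K) \<longrightarrow> A lo = K" for \<tau>2 lo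
  proof -
    have a1: "addr (8 + real lo) = 8 + lo"
      using addr_of_nat[of "8 + lo"] by (simp only: of_nat_add of_nat_numeral)
    have a2: "addr (8 + real n + real lo) = 8 + n + lo"
      using addr_of_nat[of "8 + n + lo"] by (simp only: of_nat_add of_nat_numeral)
    have m1: "D (8 + lo) = A lo" "D (8 + n + lo) = V lo" using A(1) V lo by auto
    have G: "Good (V lo)" if "K = A lo"
      using sound[OF es lo, of x] that by (simp add: K_def)
    have nohit: "\<not> hit x es" if "K \<noteq> A lo"
      using lo2 that by (auto simp: hit_def K_def)
    have hit: "hit x es" if "K = A lo"
      using lo that by (auto simp: hit_def K_def)
    show ?thesis
      by (intro wp_Cond wp_Assign)
        (use mem r a1 a2 m1 G hit nohit in \<open>auto simp: unchanged_def eqT_def simp del: of_nat_add\<close>)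
  qed
  have ne: "es \<noteq> []" "\<forall>e\<in>set es. e < 2 * m" "last es = 2 * m - 1" "length es = k"
    using es k by (auto simp: valid_walk_def)
  have "wp I W (walkP CARD('d)) (\<lambda>t \<tau>. t \<le> (length es + length Q) * (vcost CARD('d) + 65) + 11 \<and>
    unchanged ?X \<sigma>1 \<tau> \<and> regs \<tau> 10 = seq_code (map (walk_elem s r x Q) (walk (length Q) 0 0 es))) \<sigma>1"
    by (rule wp_walkP[OF Q(1,3)]) (use env ne in \<open>auto simp: \<sigma>1_def env_def\<close>)
  then have "wp I W (Seq (walkP CARD('d)) (Seq bsearch ?f)) (\<lambda>t \<tau>. t \<le> probe_cost - 14 \<and>
    ?P \<tau>) \<sigma>1"
  proof (intro wp_Seq, elim wp_mono conjE)
    fix t \<tau>1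
    assume t: "t \<le> (length es + length Q) * (vcost CARD('d) + 65) + 11" and u1: "unchanged ?X \<sigma>1 \<tau>1"
      and K1: "regs \<tau>1 10 = seq_code (map (walk_elem s r x Q) (walk (length Q) 0 0 es))"
    have u1': "unchanged ?X \<sigma> \<tau>1" using u1 by (auto simp: unchanged_def \<sigma>1_def)
    have mem1: "mem \<tau>1 = D" "regs \<tau>1 19 = real n" "regs \<tau>1 10 = K"
      using u1' env K1 by (auto simp: unchanged_def env_def K_def walk_code_def)
    have bs: "wp I W bsearch (\<lambda>t \<tau>. t \<le> l * 30 + 20 \<and> unchanged ?Y \<tau>1 \<tau> \<and>
      (\<exists>lo<n. regs \<tau> 25 = real lo \<and> ((\<exists>i<n. A i = regs \<tau>1 10) \<longrightarrow> A lo = regs \<tau>1 10))) \<tau>1"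
      by (rule wp_bsearch) (use A n mem1 in auto)
    show "wp I W (Seq bsearch ?f) (\<lambda>u \<tau>. t + u \<le> probe_cost - 14 \<and>
      ?P \<tau>) \<tau>1"
    proof (rule wp_Seq, rule wp_mono[OF bs], elim conjE exE)
      fix u \<tau>2 lo
      assume u: "u \<le> l * 30 + 20" and u2: "unchanged ?Y \<tau>1 \<tau>2" and lo: "lo < n" "regs \<tau>2 25 = real lo"
        "(\<exists>i<n. A i = regs \<tau>1 10) \<longrightarrow> A lo = regs \<tau>1 10"
      have mem2: "mem \<tau>2 = D" "regs \<tau>2 19 = real n" "regs \<tau>2 10 = K" "regs \<tau>2 0 = regs \<sigma> 0"
        using u2 u1' mem1 by (auto simp: unchanged_def)
      have u12: "unchanged (?X \<union> ?Y) \<sigma> \<tau>2" by (rule unchanged_trans[OF u1' u2]) auto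
      have le: "(length es + length Q) * (vcost CARD('d) + 65) \<le> (k + m) * (vcost CARD('d) + 65)"
        using ne Q by (intro mult_le_mono1) auto
      show "wp I W ?f (\<lambda>v \<tau>. t + (u + v) \<le> probe_cost - 14 \<and>
        ?P \<tau>) \<tau>2"
      proof (rule wp_mono[OF fin[OF mem2(1-3) lo(2,1)]], use lo(3) mem1(3) in simp, elim conjE)
        fix v :: nat and \<tau>
        assume "v \<le> 25" and u3: "unchanged {0, 27} \<tau>2 \<tau>"
          and g: "if hit x es then Good (regs \<tau> 0) else regs \<tau> 0 = regs \<tau>2 0"
        then have "t + (u + v) \<le> probe_cost - 14"
          using t u le unfolding probe_cost_def by linarith
        moreover have "unchanged {0, 5, 7, 8, 9, 10, 23, 24, 25, 26, 27, 28} \<sigma> \<tau>"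
          by (rule unchanged_trans[OF u12 u3]) auto
        ultimately show "t + (u + v) \<le> probe_cost - 14 \<and>
          ?P \<tau>"
          using g mem2(4) by simp
      qed
    qed
  qed
  then show ?thesis
    unfolding probe_def x_def[symmetric]
    apply (intro wp_Seq[of _ _ "Assign _ _"] wp_Assign)
    apply (simp add: e1 c1 regs \<sigma>1_def[symmetric])
    apply (erule wp_mono)
    apply (auto simp: probe_cost_def)
    done
qed

definition hits_below :: "nat \<Rightarrow> nat \<Rightarrow> bool" where
  "hits_below x y \<longleftrightarrow> (\<exists>es. valid_walk k m es \<and> undigits (2 * m) es < y \<and> hit x es)"

lemma wp_probes:
  assumes env: "env \<sigma>" and regs: "regs \<sigma> 17 = real zz" "regs \<sigma> 21 = regs \<sigma> 22"
  shows "wp I W (probes CARD('d)) (\<lambda>t \<tau>. t \<le> (2 * m) ^ (k - 1) * (probe_cost + 10) + 10 \<and>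
    unchanged {0, 5, 7, 8, 9, 10, 21, 23, 24, 25, 26, 27, 28} \<sigma> \<tau> \<and>
    (if hits_below (zz mod s ^ k) ((2 * m) ^ k) then Good (regs \<tau> 0) else regs \<tau> 0 = regs \<sigma> 0)) \<sigma>"
proof -
  let ?X = "{0, 5, 7, 8, 9, 10, 21, 23, 24, 25, 26, 27, 28} :: nat set"
  let ?Y0 = "(2 * m - 1) * (2 * m) ^ (k - 1)" and ?Y1 = "(2 * m) ^ k"
  let ?b = "Less (Reg 21) (Reg 13)"
  define x where "x = zz mod s ^ k"
  have m: "1 \<le> m" using k by simp
  \<comment> \<open>Fixing the top digit leaves \<open>(2 * m) ^ (k - 1)\<close> walks, and this is
    the number of probes per shift vector.\<close>
  have Y1: "?Y1 = ?Y0 + (2 * m) ^ (k - 1)"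
  proof -
    have "?Y1 = (2 * m) * (2 * m) ^ (k - 1)" using k by (cases k) auto
    also have "\<dots> = (Suc (2 * m - 1)) * (2 * m) ^ (k - 1)" using m by simp
    finally show ?thesis by simp
  qed
  define Inv where "Inv i \<tau> \<longleftrightarrow> unchanged ?X \<sigma> \<tau> \<and> (\<exists>y. regs \<tau> 21 = real y \<and> ?Y0 \<le> y \<and> y \<le> ?Y1 \<and> i = ?Y1 - y \<and>
    (if hits_below x y then Good (regs \<tau> 0) else regs \<tau> 0 = regs \<sigma> 0))" for i \<tau>
  have env': "env \<tau>" if "unchanged ?X \<sigma> \<tau>" for \<tau>
    using env_unchanged[OF env that] by auto
  have "\<not> hits_below x ?Y0"
    using valid_walk_bounds k by (auto simp: hits_below_def not_less)
  then have init: "Inv (?Y1 - ?Y0) \<sigma>"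
    unfolding Inv_def using regs env Y1 by (auto simp: unchanged_refl env_def intro!: exI[of _ ?Y0] simp del: of_nat_mult of_nat_power)
  have step: "wp I W (Seq (probe CARD('d)) (Assign 21 (Add (Reg 21) (Lit 1))))
      (\<lambda>t \<tau>'. t \<le> probe_cost + 4 \<and> (\<exists>j<i. Inv j \<tau>')) \<tau>"
    if inv: "Inv i \<tau>" and h: "holds I \<tau> ?b" for i \<tau>
  proof -
    obtain y where u: "unchanged ?X \<sigma> \<tau>" and y: "regs \<tau> 21 = real y" "?Y0 \<le> y" "y \<le> ?Y1" "i = ?Y1 - y"
      and g: "if hits_below x y then Good (regs \<tau> 0) else regs \<tau> 0 = regs \<sigma> 0"
      using inv unfolding Inv_def by blast
    have "real y < real ?Y1" using h y(1) env'[OF u] by (simp add: env_def)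
    then have lt: "y < ?Y1" by (simp only: of_nat_less_iff)
    obtain es where es: "valid_walk k m es" "undigits (2 * m) es = y"
      using ex_undigits[OF k(1) y(2) lt] m unfolding valid_walk_def by auto
    \<comment> \<open>By injectivity of the numerals, advancing the counter past \<open>y\<close>
      adds exactly one walk.\<close>
    have hb: "hits_below x (Suc y) \<longleftrightarrow> hits_below x y \<or> hit x es"
    proof
      assume "hits_below x (Suc y)"
      then obtain es' where es': "valid_walk k m es'" "undigits (2 * m) es' < Suc y" "hit x es'"
        unfolding hits_below_def by blast
      show "hits_below x y \<or> hit x es"
      proof (cases "undigits (2 * m) es' = y")
        case True
        then have "es' = es" using es es' by (intro undigits_inj[of "2 * m"]) (auto simp: valid_walk_def)
        then show ?thesis using es' by simp
      next
        case False
        then show ?thesis using es' unfolding hits_below_def by auto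
      qed
    next
      assume "hits_below x y \<or> hit x es"
      then show "hits_below x (Suc y)" unfolding hits_below_def using es less_Suc_eq by blast
    qed
    have r17: "regs \<tau> 17 = real zz" using u regs by (simp add: unchanged_def)
    show ?thesis
    proof (intro wp_Seq, rule wp_mono[OF wp_probe[OF env'[OF u] r17 _ es(1)]], simp add: es y, elim conjE, intro wp_Assign conjI)
      fix t \<tau>'
      assume t: "t \<le> probe_cost" and u': "unchanged {0, 5, 7, 8, 9, 10, 23, 24, 25, 26, 27, 28} \<tau> \<tau>'"
        and g': "if hit (zz mod s ^ k) es then Good (regs \<tau>' 0) else regs \<tau>' 0 = regs \<tau> 0"
      show "t + (ecost (Add (Reg 21) (Lit 1)) + 1) \<le> probe_cost + 4" using t by simp
      have r21: "regs \<tau>' 21 = real y" using u' y by (simp add: unchanged_def)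
      have "unchanged ?X \<sigma> \<tau>'" by (rule unchanged_trans[OF u u']) auto
      then have "Inv (?Y1 - Suc y) (\<tau>'\<lparr>regs := (regs \<tau>')(21 := eval I \<tau>' (Add (Reg 21) (Lit 1)))\<rparr>)"
        unfolding Inv_def using y lt r21 g g' hb
        by (intro conjI exI[of _ "Suc y"]) (auto simp: unchanged_def x_def split: if_splits)
      then show "\<exists>j<i. Inv j (\<tau>'\<lparr>regs := (regs \<tau>')(21 := eval I \<tau>' (Add (Reg 21) (Lit 1)))\<rparr>)"
        using y(4) lt by (intro exI[of _ "?Y1 - Suc y"]) auto
    qed
  qed
  show ?thesis
    unfolding probes_def
  proof (rule wp_While[of Inv, OF init step])
    fix j t \<tau>
    assume inv: "Inv j \<tau>" and h: "\<not> holds I \<tau> ?b" and t: "t \<le> (?Y1 - ?Y0) * (probe_cost + 4 + tcost ?b + 1) + tcost ?b + 1"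
    obtain y where u: "unchanged ?X \<sigma> \<tau>" and y: "regs \<tau> 21 = real y" "?Y0 \<le> y" "y \<le> ?Y1"
      and g: "if hits_below x y then Good (regs \<tau> 0) else regs \<tau> 0 = regs \<sigma> 0"
      using inv unfolding Inv_def by blast
    have "\<not> real y < real ?Y1" using h y(1) env'[OF u] by (simp add: env_def)
    then have "y = ?Y1" using y(3) by (simp only: of_nat_less_iff not_less)
    have "?Y1 - ?Y0 = (2 * m) ^ (k - 1)" using Y1 by linarith
    from t[unfolded this] have "t \<le> (2 * m) ^ (k - 1) * (probe_cost + 4 + tcost ?b + 1) + tcost ?b + 1" .
    moreover have "(2 * m) ^ (k - 1) * (probe_cost + 4 + tcost ?b + 1) \<le> (2 * m) ^ (k - 1) * (probe_cost + 10)"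
      by (intro mult_le_mono2) simp
    moreover have "tcost ?b = 3" by simp
    ultimately have "t \<le> (2 * m) ^ (k - 1) * (probe_cost + 10) + 10" by linarith
    then show "t \<le> (2 * m) ^ (k - 1) * (probe_cost + 10) + 10 \<and> unchanged ?X \<sigma> \<tau> \<and>
      (if hits_below (zz mod s ^ k) ?Y1 then Good (regs \<tau> 0) else regs \<tau> 0 = regs \<sigma> 0)"
      using u g \<open>y = ?Y1\<close> by (simp add: x_def)
  qed
qed

definition round_cost :: nat where
  "round_cost = (2 * m) ^ (k - 1) * (probe_cost + 10) + 30"

text \<open>Each round strips one digit of \<open>z\<close> in base \<open>s ^ k\<close>, so
  \<open>T\<close> digits allow at most \<open>T\<close> rounds. A position with positive quotient
  comes before the one at which the loop stops, hence has been visited.\<close>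

lemma wp_rounds:
  assumes env: "env \<sigma>" and regs: "regs \<sigma> 17 = real z" and T: "z < (s ^ k) ^ T"
  shows "wp I W (rounds CARD('d)) (\<lambda>t \<tau>. t \<le> T * round_cost + 10 \<and>
    (\<forall>t es. 0 < z div (s ^ k) ^ t \<longrightarrow> valid_walk k m es \<longrightarrow> hit (z div (s ^ k) ^ t mod s ^ k) es \<longrightarrow> Good (regs \<tau> 0))) \<sigma>"
proof -
  let ?X = "{0, 5, 7, 8, 9, 10, 17, 21, 23, 24, 25, 26, 27, 28} :: nat set"
  let ?b = "Less (Lit 0) (Reg 17)"
  let ?B = "s ^ k"
  let ?C = "(2 * m) ^ (k - 1) * (probe_cost + 10) + 10"
  define Inv where "Inv i \<tau> \<longleftrightarrow> unchanged ?X \<sigma> \<tau> \<and> (\<exists>t. regs \<tau> 17 = real (z div ?B ^ t) \<and> z div ?B ^ t < ?B ^ i \<and>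
    ((\<exists>t'<t. hits_below (z div ?B ^ t' mod ?B) ((2 * m) ^ k)) \<longrightarrow> Good (regs \<tau> 0)))" for i \<tau>
  have env': "env \<tau>" if "unchanged ?X \<sigma> \<tau>" for \<tau>
    using env_unchanged[OF env that] by auto
  have init: "Inv T \<sigma>"
    unfolding Inv_def using regs T by (auto simp: unchanged_refl intro!: exI[of _ 0])
  have step: "wp I W (Seq (Assign 21 (Reg 22)) (Seq (probes CARD('d)) (Assign 17 (divE (Reg 17) (Reg 12)))))
      (\<lambda>t \<tau>'. t \<le> ?C + 7 \<and> (\<exists>j<i. Inv j \<tau>')) \<tau>"
    if inv: "Inv i \<tau>" and h: "holds I \<tau> ?b" for i \<tau>
  proof -
    obtain t where u: "unchanged ?X \<sigma> \<tau>" and zt: "regs \<tau> 17 = real (z div ?B ^ t)" "z div ?B ^ t < ?B ^ i"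
      and g: "(\<exists>t'<t. hits_below (z div ?B ^ t' mod ?B) ((2 * m) ^ k)) \<longrightarrow> Good (regs \<tau> 0)"
      using inv unfolding Inv_def by blast
    have "0 < z div ?B ^ t" using h zt by simp
    then have "i \<noteq> 0" using zt(2) by (cases i) auto
    then obtain i' where i': "i = Suc i'" using not0_implies_Suc by blast
    have zS: "z div ?B ^ Suc t = z div ?B ^ t div ?B" by (simp add: div_mult2_eq[symmetric] mult.commute)
    have "z div ?B ^ t < ?B ^ i' * ?B" using zt(2) unfolding i' by (simp add: mult.commute)
    then have lt': "z div ?B ^ Suc t < ?B ^ i'" unfolding zS by (rule less_mult_imp_div_less)
    define \<tau>1 where "\<tau>1 = \<tau>\<lparr>regs := (regs \<tau>)(21 := regs \<tau> 22)\<rparr>"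
    have u1: "unchanged ?X \<sigma> \<tau>1" using u by (simp add: unchanged_def \<tau>1_def)
    have r1: "regs \<tau>1 17 = real (z div ?B ^ t)" "regs \<tau>1 21 = regs \<tau>1 22" "regs \<tau>1 0 = regs \<tau> 0"
      using zt by (auto simp: \<tau>1_def)
    have c: "ecost (divE (Reg 17) (Reg 12)) = 4" by (simp add: divE_def)
    have "wp I W (Seq (probes CARD('d)) (Assign 17 (divE (Reg 17) (Reg 12))))
      (\<lambda>t \<tau>'. t \<le> ?C + 5 \<and> (\<exists>j<i. Inv j \<tau>')) \<tau>1"
    proof (intro wp_Seq, rule wp_mono[OF wp_probes[OF env'[OF u1] r1(1,2)]], elim conjE, intro wp_Assign conjI)
      fix v \<tau>'
      assume v: "v \<le> ?C" and u': "unchanged {0, 5, 7, 8, 9, 10, 21, 23, 24, 25, 26, 27, 28} \<tau>1 \<tau>'"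
        and g': "if hits_below (z div ?B ^ t mod ?B) ((2 * m) ^ k) then Good (regs \<tau>' 0) else regs \<tau>' 0 = regs \<tau>1 0"
      show "v + (ecost (divE (Reg 17) (Reg 12)) + 1) \<le> ?C + 5" using v by (simp add: c)
      have u'': "unchanged ?X \<sigma> \<tau>'" by (rule unchanged_trans[OF u1 u']) auto
      have "eval I \<tau>' (divE (Reg 17) (Reg 12)) = real (z div ?B ^ t div ?B)"
        by (rule eval_divE) (use r1 u' env'[OF u''] in \<open>auto simp: unchanged_def env_def\<close>)
      then have e: "eval I \<tau>' (divE (Reg 17) (Reg 12)) = real (z div ?B ^ Suc t)"
        by (simp only: zS)
      have "Inv i' (\<tau>'\<lparr>regs := (regs \<tau>')(17 := eval I \<tau>' (divE (Reg 17) (Reg 12)))\<rparr>)"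
        unfolding Inv_def e
      proof (intro conjI exI[of _ "Suc t"])
        show "(\<exists>t'<Suc t. hits_below (z div ?B ^ t' mod ?B) ((2 * m) ^ k)) \<longrightarrow>
          Good (regs (\<tau>'\<lparr>regs := (regs \<tau>')(17 := real (z div ?B ^ Suc t))\<rparr>) 0)"
          using g g' r1(3) by (auto simp: less_Suc_eq split: if_splits)
      qed (use u'' lt' in \<open>auto simp: unchanged_def\<close>)
      then show "\<exists>j<i. Inv j (\<tau>'\<lparr>regs := (regs \<tau>')(17 := eval I \<tau>' (divE (Reg 17) (Reg 12)))\<rparr>)"
        using i' by blast
    qed
    then show ?thesis
      apply (intro wp_Seq[of _ _ "Assign _ _"] wp_Assign)
      apply (simp add: \<tau>1_def)
      done
  qed
  show ?thesis
    unfolding rounds_def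
  proof (rule wp_While[of Inv, OF init step])
    fix j t \<tau>
    assume inv: "Inv j \<tau>" and h: "\<not> holds I \<tau> ?b" and t: "t \<le> T * (?C + 7 + tcost ?b + 1) + tcost ?b + 1"
    obtain t0 where zt: "regs \<tau> 17 = real (z div ?B ^ t0)"
      and g: "(\<exists>t'<t0. hits_below (z div ?B ^ t' mod ?B) ((2 * m) ^ k)) \<longrightarrow> Good (regs \<tau> 0)"
      using inv unfolding Inv_def by blast
    have z0: "z div ?B ^ t0 = 0" using h zt by simp
    have "T * (?C + 7 + tcost ?b + 1) \<le> T * round_cost"
      by (intro mult_le_mono2) (simp add: round_cost_def)
    moreover have "tcost ?b = 3" by simp
    ultimately have tt: "t \<le> T * round_cost + 10" using t by linarith
    have "Good (regs \<tau> 0)" if t': "0 < z div ?B ^ t'" and es: "valid_walk k m es" and "hit (z div ?B ^ t' mod ?B) es" for t' es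
    proof -
      have "t' < t0"
      proof (rule ccontr)
        assume "\<not> t' < t0"
        then have "?B ^ t0 \<le> ?B ^ t'" using s by (intro power_increasing) auto
        then have "z div ?B ^ t' \<le> z div ?B ^ t0" using s by (intro div_le_mono2) auto
        then show False using t' z0 by simp
      qed
      moreover have "hits_below (z div ?B ^ t' mod ?B) ((2 * m) ^ k)"
        unfolding hits_below_def using es that(3) valid_walk_bounds[OF es k(1)] by blast
      ultimately show ?thesis using g by blast
    qed
    then show "t \<le> T * round_cost + 10 \<and> (\<forall>t es. 0 < z div ?B ^ t \<longrightarrow> valid_walk k m es \<longrightarrow>
      hit (z div ?B ^ t mod ?B) es \<longrightarrow> Good (regs \<tau> 0))" using tt by blast
  qed
qed

lemma wp_query_prog:
  assumes T: "z < (s ^ k) ^ T"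
  shows "wp I W (query_prog CARD('d)) (\<lambda>t \<tau>. t \<le> T * round_cost + 40 \<and>
    (\<forall>t es. 0 < z div (s ^ k) ^ t \<longrightarrow> valid_walk k m es \<longrightarrow> hit (z div (s ^ k) ^ t mod s ^ k) es \<longrightarrow> Good (regs \<tau> 0)))
    \<lparr>regs = \<lambda>_. 0, mem = D, tape = \<eta>\<rparr>"
proof -
  let ?\<sigma> = "\<lparr>regs = (\<lambda>_. 0)(19 := real n, 3 := r, 4 := real s, 12 := real (s ^ k), 20 := real (2 * m),
    22 := real ((2 * m - 1) * (2 * m) ^ (k - 1)), 13 := real ((2 * m) ^ k), 17 := real z), mem = D, tape = \<eta>\<rparr>"
  have addr: "addr 0 = 0" "addr 1 = 1" "addr (numeral w) = numeral w" for w
    by (simp_all add: addr_def)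
  have "wp I W (rounds CARD('d)) (\<lambda>t \<tau>. t \<le> T * round_cost + 10 \<and>
    (\<forall>t es. 0 < z div (s ^ k) ^ t \<longrightarrow> valid_walk k m es \<longrightarrow> hit (z div (s ^ k) ^ t mod s ^ k) es \<longrightarrow> Good (regs \<tau> 0))) ?\<sigma>"
    by (rule wp_rounds[OF _ _ T]) (auto simp: env_def)
  then show ?thesis
    unfolding query_prog_def
    apply (intro wp_Seq[of _ _ "Assign _ _"] wp_Assign)
    apply (simp add: addr D[unfolded stores_params_def] D[unfolded stores_params_def One_nat_def] del: of_nat_mult of_nat_power)
    apply (erule wp_mono)
    apply auto
    done
qed

end

section \<open>The preprocessing program\<close>

text \<open>\<open>Floor\<close> and \<open>div\<close> on integers both round down, so the
  remainder is also right for negative coordinates.\<close>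

lemma eval_modE_int:
  assumes "eval I \<sigma> a = of_int x" "eval I \<sigma> b = real y"
  shows "eval I \<sigma> (modE a b) = of_int (x mod int y)"
proof -
  have "eval I \<sigma> (divE a b) = of_int (x div int y)"
    using assms floor_divide_of_int_eq[of x "int y"] by (simp add: divE_def)
  moreover have "real_of_int x = real y * of_int (x div int y) + of_int (x mod int y)"
    by (metis mult_div_mod_eq of_int_add of_int_mult of_int_of_nat_eq)
  ultimately show ?thesis using assms by (simp add: modE_def)
qed

text \<open>Unrolled over the coordinates like \<open>pushE\<close>; the test of 0 < 1 stands for
  truth.\<close>

fun insideT :: "nat \<Rightarrow> nat list \<Rightarrow> test" where
  "insideT d [] = Less (Lit 0) (Lit 1)"
| "insideT d (c # cs) = AndT (Less (Lit 0) (modE (Add (coordE d c) (Reg 5)) (Reg 4)))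
     (AndT (Less (modE (Add (coordE d c) (Reg 5)) (Reg 4)) (Sub (Reg 4) (Lit 1))) (insideT d cs))"

lemma holds_insideT:
  fixes P :: "'d::finite curve"
  assumes "has_curve I a P" "i < length P"
    "regs \<sigma> 6 = real a" "regs \<sigma> 7 = real i" "regs \<sigma> 3 = r" "regs \<sigma> 4 = real s" "regs \<sigma> 5 = real j"
  shows "holds I \<sigma> (insideT CARD('d) [0..<CARD('d)]) \<longleftrightarrow> vinside s r j (P ! i)"
proof -
  have *: "holds I \<sigma> (insideT CARD('d) cs) \<longleftrightarrow> (\<forall>c\<in>set cs. inside s j \<lfloor>P ! i $ (coords ! c) / r\<rfloor>)"
    if "set cs \<subseteq> {0..<CARD('d)}" for cs
    using that
  proof (induction cs)
    case (Cons c cs)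
    have e: "eval I \<sigma> (modE (Add (coordE CARD('d) c) (Reg 5)) (Reg 4)) =
      of_int ((\<lfloor>P ! i $ (coords ! c) / r\<rfloor> + int j) mod int s)"
    proof (rule eval_modE_int)
      show "eval I \<sigma> (Add (coordE CARD('d) c) (Reg 5)) = of_int (\<lfloor>P ! i $ (coords ! c) / r\<rfloor> + int j)"
        using eval_coordE[OF assms(1,2) _ assms(3-5), of c] Cons.prems assms(7) by simp
    qed (use assms in simp)
    have "real_of_int v < real s - 1 \<longleftrightarrow> v < int s - 1" for v by linarith
    then show ?case using Cons e assms(6) by (simp add: inside_def)
  qed simp
  have "(\<forall>c<CARD('d). inside s j \<lfloor>P ! i $ (coords ! c) / r\<rfloor>) \<longleftrightarrow> vinside s r j (P ! i)"
    unfolding vinside_def using coords_props(2,3)[where 'd='d] by (metis UNIV_I in_set_conv_nth)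
  then show ?thesis using *[of "[0..<CARD('d)]"] by auto
qed

section \<open>Codes of the stored curves under a given shift vector\<close>

definition curve_elem :: "nat \<Rightarrow> real \<Rightarrow> nat \<Rightarrow> 'd::finite curve \<Rightarrow> nat \<Rightarrow> nat \<Rightarrow> int list" where
  "curve_elem s r w P x i = vcorner s r (x div s ^ (i div w) mod s) (P ! i)"

definition curve_code :: "nat \<Rightarrow> real \<Rightarrow> nat \<Rightarrow> 'd::finite curve \<Rightarrow> nat \<Rightarrow> real" where
  "curve_code s r w P x = seq_code (map (curve_elem s r w P x) [0..<length P])"

definition curve_ok :: "nat \<Rightarrow> real \<Rightarrow> nat \<Rightarrow> 'd::finite curve \<Rightarrow> nat \<Rightarrow> bool" where
  "curve_ok s r w P x \<longleftrightarrow> (\<forall>i<length P. vinside s r (x div s ^ (i div w) mod s) (P ! i))"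

text \<open>Register 29 is a flag, cleared at the first vertex not inside its cell. Register 11
  holds the block length; register 8 loses a digit whenever the next vertex opens a new
  block.\<close>

definition vertex_prog :: "nat \<Rightarrow> prog" where
  "vertex_prog d = Seq (Assign 5 (modE (Reg 8) (Reg 4))) (Seq (vpush d)
     (Seq (Cond (insideT d [0..<d]) (Assign 27 (Lit 0)) (Assign 29 (Lit 0)))
     (Seq (Assign 7 (Add (Reg 7) (Lit 1)))
       (Cond (eqT (modE (Reg 7) (Reg 11)) (Lit 0)) (Assign 8 (divE (Reg 8) (Reg 4))) (Assign 27 (Lit 0))))))"

lemma wp_vertex_prog:
  fixes P :: "'d::finite curve"
  assumes "has_curve I a P" "i < length P"
    "regs \<sigma> 6 = real a" "regs \<sigma> 7 = real i" "regs \<sigma> 3 = r" "regs \<sigma> 4 = real s" "regs \<sigma> 8 = real y" "regs \<sigma> 11 = real w"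
  shows "wp I W (vertex_prog CARD('d)) (\<lambda>t \<tau>. unchanged {5, 7, 8, 9, 10, 27, 29} \<sigma> \<tau> \<and>
    (regs \<tau> 9, regs \<tau> 10) = dstep (regs \<sigma> 9, regs \<sigma> 10) (vcorner s r (y mod s) (P ! i)) \<and>
    regs \<tau> 7 = real (Suc i) \<and> regs \<tau> 8 = real (if Suc i mod w = 0 then y div s else y) \<and>
    regs \<tau> 29 = (if vinside s r (y mod s) (P ! i) then regs \<sigma> 29 else 0)) \<sigma>"
proof -
  let ?next = "\<lambda>\<tau>. regs \<tau> 7 = real (Suc i) \<and> regs \<tau> 8 = real (if Suc i mod w = 0 then y div s else y)"
  define \<sigma>1 where "\<sigma>1 = \<sigma>\<lparr>regs := (regs \<sigma>)(5 := real (y mod s))\<rparr>"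
  have e1: "eval I \<sigma> (modE (Reg 8) (Reg 4)) = real (y mod s)"
    using assms by (intro eval_modE) auto
  let ?p = "Seq (Cond (insideT CARD('d) [0..<CARD('d)]) (Assign 27 (Lit 0)) (Assign 29 (Lit 0)))
     (Seq (Assign 7 (Add (Reg 7) (Lit 1)))
       (Cond (eqT (modE (Reg 7) (Reg 11)) (Lit 0)) (Assign 8 (divE (Reg 8) (Reg 4))) (Assign 27 (Lit 0))))"
  have rest: "wp I W ?p (\<lambda>t \<tau>. unchanged {7, 8, 27, 29} \<tau>1 \<tau> \<and> ?next \<tau> \<and>
      regs \<tau> 29 = (if vinside s r (y mod s) (P ! i) then regs \<tau>1 29 else 0)) \<tau>1"
    if u: "unchanged {9, 10, 27} \<sigma>1 \<tau>1" for \<tau>1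
  proof -
    have r: "regs \<tau>1 6 = real a" "regs \<tau>1 7 = real i" "regs \<tau>1 3 = r" "regs \<tau>1 4 = real s"
      "regs \<tau>1 5 = real (y mod s)" "regs \<tau>1 8 = real y" "regs \<tau>1 11 = real w"
      using u assms by (auto simp: unchanged_def \<sigma>1_def)
    note h = holds_insideT[OF assms(1,2) r(1-5)]
    have e2: "eval I \<upsilon> (modE (Reg 7) (Reg 11)) = real (Suc i mod w)"
      if "regs \<upsilon> 7 = real (Suc i)" "regs \<upsilon> 11 = real w" for \<upsilon>
      using that by (intro eval_modE) auto
    have e3: "eval I \<upsilon> (divE (Reg 8) (Reg 4)) = real (y div s)"
      if "regs \<upsilon> 8 = real y" "regs \<upsilon> 4 = real s" for \<upsilon>
      using that by (intro eval_divE) auto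
    show ?thesis
      by (intro wp_Seq wp_Assign wp_Cond) (auto simp: h r e2 e3 unchanged_def)
  qed
  have "wp I W (vpush CARD('d)) (\<lambda>t \<tau>. t \<le> vcost CARD('d) \<and> unchanged {9, 10, 27} \<sigma>1 \<tau> \<and>
    (regs \<tau> 9, regs \<tau> 10) = dstep (regs \<sigma>1 9, regs \<sigma>1 10) (vcorner s r (y mod s) (P ! i))) \<sigma>1"
    by (rule wp_vpush[OF assms(1,2)]) (use assms in \<open>auto simp: \<sigma>1_def\<close>)
  then have "wp I W (Seq (vpush CARD('d)) ?p) (\<lambda>t \<tau>. unchanged {5, 7, 8, 9, 10, 27, 29} \<sigma> \<tau> \<and>
    (regs \<tau> 9, regs \<tau> 10) = dstep (regs \<sigma> 9, regs \<sigma> 10) (vcorner s r (y mod s) (P ! i)) \<and>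
    ?next \<tau> \<and>
    regs \<tau> 29 = (if vinside s r (y mod s) (P ! i) then regs \<sigma> 29 else 0)) \<sigma>1"
    apply (intro wp_Seq[of _ _ "vpush _"])
    apply (erule wp_mono)
    apply (elim conjE)
    apply (rule wp_mono[OF rest], assumption)
    apply (auto simp: \<sigma>1_def unchanged_def)
    done
  then show ?thesis
    unfolding vertex_prog_def
    by (intro wp_Seq[of _ _ "Assign _ _"] wp_Assign) (simp add: e1 \<sigma>1_def)
qed

definition curve_prog :: "nat \<Rightarrow> prog" where
  "curve_prog d = Seq (Assign 7 (Lit 0)) (Seq (Assign 9 (Lit 0)) (Seq (Assign 10 (Lit 0)) (Seq (Assign 29 (Lit 1))
     (While (Less (Reg 7) (Inp (Reg 6))) (vertex_prog d)))))"

lemma wp_curve_prog: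
  fixes P :: "'d::finite curve"
  assumes P: "has_curve I a P" and regs: "regs \<sigma> 6 = real a" "regs \<sigma> 3 = r" "regs \<sigma> 4 = real s"
    "regs \<sigma> 8 = real x" "regs \<sigma> 11 = real w" and w: "w > 0"
  shows "wp I W (curve_prog CARD('d)) (\<lambda>t \<tau>. unchanged {5, 7, 8, 9, 10, 27, 29} \<sigma> \<tau> \<and>
    regs \<tau> 10 = curve_code s r w P x \<and> (0 < regs \<tau> 29 \<longleftrightarrow> curve_ok s r w P x)) \<sigma>"
    (is "wp _ _ _ (\<lambda>t. ?Post) _")
proof -
  let ?X = "{5, 7, 8, 9, 10, 27, 29} :: nat set"
  let ?b = "Less (Reg 7) (Inp (Reg 6))"
  let ?ok = "\<lambda>i. vinside s r (x div s ^ (i div w) mod s) (P ! i)"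
  define F where "F = curve_elem s r w P x"
  define Inv where "Inv j \<tau> \<longleftrightarrow> unchanged ?X \<sigma> \<tau> \<and> (\<exists>i. j = length P - i \<and> i \<le> length P \<and> regs \<tau> 7 = real i \<and>
    regs \<tau> 8 = real (x div s ^ (i div w)) \<and>
    snd (foldl dstep (regs \<tau> 9, regs \<tau> 10) (map F [i..<length P])) = curve_code s r w P x \<and>
    (0 < regs \<tau> 29 \<longleftrightarrow> (\<forall>i'<i. ?ok i')))" for j \<tau>
  have cond: "holds I \<tau> ?b \<longleftrightarrow> i < length P" if "unchanged ?X \<sigma> \<tau>" "regs \<tau> 7 = real i" for \<tau> i
    using that P regs(1) by (auto simp: unchanged_def has_curve_def)
  have step: "wp I W (vertex_prog CARD('d)) (\<lambda>t \<tau>'. \<exists>j'<j. Inv j' \<tau>') \<tau>"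
    if inv: "Inv j \<tau>" and h: "holds I \<tau> ?b" for j \<tau>
  proof -
    obtain i where u: "unchanged ?X \<sigma> \<tau>" and i: "j = length P - i" "regs \<tau> 7 = real i"
      and r8: "regs \<tau> 8 = real (x div s ^ (i div w))"
      and tgt: "snd (foldl dstep (regs \<tau> 9, regs \<tau> 10) (map F [i..<length P])) = curve_code s r w P x"
      and ok: "0 < regs \<tau> 29 \<longleftrightarrow> (\<forall>i'<i. ?ok i')"
      using inv unfolding Inv_def by blast
    have lt: "i < length P" using h cond[OF u i(2)] by simp
    have r: "regs \<tau> 6 = real a" "regs \<tau> 3 = r" "regs \<tau> 4 = real s" "regs \<tau> 11 = real w"
      using u regs by (auto simp: unchanged_def)
    show ?thesis
    proof (rule wp_mono[OF wp_vertex_prog[OF P lt r(1) i(2) r(2,3) r8 r(4)]], elim conjE)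
      fix \<tau>'
      assume u': "unchanged ?X \<tau> \<tau>'"
        and d: "(regs \<tau>' 9, regs \<tau>' 10) = dstep (regs \<tau> 9, regs \<tau> 10) (vcorner s r (x div s ^ (i div w) mod s) (P ! i))"
        and r7: "regs \<tau>' 7 = real (Suc i)"
        and r8': "regs \<tau>' 8 = real (if Suc i mod w = 0 then x div s ^ (i div w) div s else x div s ^ (i div w))"
        and r29: "regs \<tau>' 29 = (if ?ok i then regs \<tau> 29 else 0)"
      have "unchanged ?X \<sigma> \<tau>'" by (rule unchanged_trans[OF u u']) auto
      moreover have "regs \<tau>' 8 = real (x div s ^ (Suc i div w))"
        using r8' by (simp add: div_Suc div_mult2_eq[symmetric] mult.commute)
      moreover have "snd (foldl dstep (regs \<tau>' 9, regs \<tau>' 10) (map F [Suc i..<length P])) = curve_code s r w P x"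
        using tgt lt unfolding d by (simp add: upt_conv_Cons F_def curve_elem_def)
      moreover have "0 < regs \<tau>' 29 \<longleftrightarrow> (\<forall>i'<Suc i. ?ok i')"
        using ok r29 by (auto simp: less_Suc_eq)
      ultimately have "Inv (length P - Suc i) \<tau>'"
        unfolding Inv_def using lt r7 by (intro conjI exI[of _ "Suc i"]) auto
      then show "\<exists>j'<j. Inv j' \<tau>'" using i lt by (intro exI[of _ "length P - Suc i"]) auto
    qed
  qed
  define \<sigma>1 where "\<sigma>1 = \<sigma>\<lparr>regs := (regs \<sigma>)(7 := 0, 9 := 0, 10 := 0, 29 := 1)\<rparr>"
  have init: "Inv (length P) \<sigma>1"
    unfolding Inv_def using regs
    by (intro conjI exI[of _ 0]) (auto simp: \<sigma>1_def unchanged_def curve_code_def seq_code_def F_def)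
  have "wp I W (While ?b (vertex_prog CARD('d))) (\<lambda>t. ?Post) \<sigma>1"
  proof (rule wp_While_measure[of Inv, OF init step])
    fix j \<tau>
    assume inv: "Inv j \<tau>" and h: "\<not> holds I \<tau> ?b"
    obtain i where u: "unchanged ?X \<sigma> \<tau>" and i: "i \<le> length P" "regs \<tau> 7 = real i"
      and tgt: "snd (foldl dstep (regs \<tau> 9, regs \<tau> 10) (map F [i..<length P])) = curve_code s r w P x"
      and ok: "0 < regs \<tau> 29 \<longleftrightarrow> (\<forall>i'<i. ?ok i')"
      using inv unfolding Inv_def by blast
    have "i = length P" using h cond[OF u i(2)] i(1) by simp
    then show "?Post \<tau>"
      using u tgt ok by (simp add: curve_ok_def)
  qed
  then show ?thesis
    unfolding curve_prog_def
    by (intro wp_Seq[of _ _ "Assign _ _"] wp_Assign) (simp add: \<sigma>1_def)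
qed

text \<open>Positivity of the quotient says that position \<open>t\<close> is visited by a loop
  dividing by \<open>B\<close> until 0 remains.\<close>

definition covered :: "nat \<Rightarrow> real \<Rightarrow> nat \<Rightarrow> nat \<Rightarrow> nat \<Rightarrow> 'd::finite curve \<Rightarrow> nat \<Rightarrow> bool" where
  "covered s r w B z P t \<longleftrightarrow> 0 < z div B ^ t \<and> curve_ok s r w P (z div B ^ t mod B)"

text \<open>The position is left open: the loop overwrites earlier finds, and the code for any
  suitable shift vector serves as key.\<close>

definition key_of :: "nat \<Rightarrow> real \<Rightarrow> nat \<Rightarrow> nat \<Rightarrow> nat \<Rightarrow> 'd::finite curve \<Rightarrow> real \<Rightarrow> bool" where
  "key_of s r w B z P v \<longleftrightarrow> (\<exists>t. covered s r w B z P t \<and> v = curve_code s r w P (z div B ^ t mod B))"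

text \<open>Unsorted keys are collected behind the \<open>2 * n\<close> table cells. This area lies
  beyond the size finally reported, so it is not part of the structure.\<close>

definition keyA :: expr where
  "keyA = Add (Add (Lit 8) (Mul (Lit 2) (Reg 0))) (Reg 16)"

lemma addr_key: "addr (8 + 2 * real n + real p) = 8 + 2 * n + p"
  using addr_of_nat[of "8 + 2 * n + p"] by (simp only: of_nat_add of_nat_mult of_nat_numeral)

definition key_prog :: "nat \<Rightarrow> prog" where
  "key_prog d = Seq (Assign 17 (Reg 14)) (Seq (Assign 18 (Lit 0)) (While (Less (Lit 0) (Reg 17))
     (Seq (Assign 8 (modE (Reg 17) (Reg 12))) (Seq (curve_prog d)
       (Seq (Cond (Less (Lit 0) (Reg 29)) (Seq (Assign 18 (Lit 1)) (Store keyA (Reg 10))) (Assign 27 (Lit 0)))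
         (Assign 17 (divE (Reg 17) (Reg 12))))))))"

definition same_regs :: "nat set \<Rightarrow> state \<Rightarrow> state \<Rightarrow> bool" where
  "same_regs X \<sigma> \<tau> \<longleftrightarrow> (\<forall>x. x \<notin> X \<longrightarrow> regs \<tau> x = regs \<sigma> x)"

lemma wp_key_prog:
  fixes P :: "'d::finite curve"
  assumes P: "has_curve I a P" and regs: "regs \<sigma> 6 = real a" "regs \<sigma> 3 = r" "regs \<sigma> 4 = real s"
    "regs \<sigma> 11 = real w" "regs \<sigma> 12 = real B" "regs \<sigma> 14 = real z" "regs \<sigma> 16 = real p" "regs \<sigma> 0 = real n"
    and w: "w > 0" and B: "B > 1"
  shows "wp I UNIV (key_prog CARD('d)) (\<lambda>t \<tau>. same_regs {5, 7, 8, 9, 10, 17, 18, 27, 29} \<sigma> \<tau> \<and>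
    (\<forall>c. c \<noteq> 8 + 2 * n + p \<longrightarrow> mem \<tau> c = mem \<sigma> c) \<and> (0 < regs \<tau> 18 \<longrightarrow> key_of s r w B z P (mem \<tau> (8 + 2 * n + p))) \<and>
    ((\<exists>t. covered s r w B z P t) \<longrightarrow> 0 < regs \<tau> 18)) \<sigma>"
    (is "wp _ _ _ (\<lambda>t. ?Post) _")
proof -
  let ?X = "{5, 7, 8, 9, 10, 17, 18, 27, 29} :: nat set"
  let ?b = "Less (Lit 0) (Reg 17)"
  let ?cov = "covered s r w B z P"
  let ?c = "8 + 2 * n + p"
  define Inv where "Inv j \<tau> \<longleftrightarrow> same_regs ?X \<sigma> \<tau> \<and> (\<forall>c. c \<noteq> ?c \<longrightarrow> mem \<tau> c = mem \<sigma> c) \<and>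
    (0 < regs \<tau> 18 \<longrightarrow> key_of s r w B z P (mem \<tau> ?c)) \<and>
    (\<exists>t. regs \<tau> 17 = real (z div B ^ t) \<and> j = z div B ^ t \<and> ((\<exists>t'<t. ?cov t') \<longrightarrow> 0 < regs \<tau> 18))" for j \<tau>
  let ?body = "Seq (Assign 8 (modE (Reg 17) (Reg 12))) (Seq (curve_prog CARD('d))
       (Seq (Cond (Less (Lit 0) (Reg 29)) (Seq (Assign 18 (Lit 1)) (Store keyA (Reg 10))) (Assign 27 (Lit 0)))
         (Assign 17 (divE (Reg 17) (Reg 12)))))"
  have step: "wp I UNIV ?body (\<lambda>t \<tau>'. \<exists>j'<j. Inv j' \<tau>') \<tau>"
    if inv: "Inv j \<tau>" and h: "holds I \<tau> ?b" for j \<tau>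
  proof -
    obtain t where u: "same_regs ?X \<sigma> \<tau>" and mem: "\<forall>c. c \<noteq> ?c \<longrightarrow> mem \<tau> c = mem \<sigma> c"
      and key: "0 < regs \<tau> 18 \<longrightarrow> key_of s r w B z P (mem \<tau> ?c)"
      and t: "regs \<tau> 17 = real (z div B ^ t)" "j = z div B ^ t" and cov: "(\<exists>t'<t. ?cov t') \<longrightarrow> 0 < regs \<tau> 18"
      using inv unfolding Inv_def by blast
    define x where "x = z div B ^ t mod B"
    have r: "regs \<tau> 6 = real a" "regs \<tau> 3 = r" "regs \<tau> 4 = real s" "regs \<tau> 11 = real w" "regs \<tau> 12 = real B"
      "regs \<tau> 16 = real p" "regs \<tau> 0 = real n"
      using u regs by (auto simp: same_regs_def)
    have pos: "0 < z div B ^ t" using h t by simp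
    have e1: "eval I \<tau> (modE (Reg 17) (Reg 12)) = real x"
      unfolding x_def using r t by (intro eval_modE) auto
    define \<tau>1 where "\<tau>1 = \<tau>\<lparr>regs := (regs \<tau>)(8 := real x)\<rparr>"
    have zS: "z div B ^ Suc t = z div B ^ t div B" by (simp add: div_mult2_eq[symmetric] mult.commute)
    let ?q = "Seq (Cond (Less (Lit 0) (Reg 29)) (Seq (Assign 18 (Lit 1)) (Store keyA (Reg 10))) (Assign 27 (Lit 0)))
         (Assign 17 (divE (Reg 17) (Reg 12)))"
    have fin: "wp I UNIV ?q (\<lambda>t \<tau>'. \<exists>j'<j. Inv j' \<tau>') \<tau>2"
      if u2: "unchanged {5, 7, 8, 9, 10, 27, 29} \<tau>1 \<tau>2" and c2: "regs \<tau>2 10 = curve_code s r w P x"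
        and ok2: "0 < regs \<tau>2 29 \<longleftrightarrow> curve_ok s r w P x" for \<tau>2
    proof -
      have r2: "regs \<tau>2 16 = real p" "regs \<tau>2 0 = real n" "regs \<tau>2 17 = real (z div B ^ t)"
        "regs \<tau>2 12 = real B" "regs \<tau>2 18 = regs \<tau> 18" "mem \<tau>2 = mem \<tau>"
        using u2 r t by (auto simp: unchanged_def \<tau>1_def)
      have s2: "same_regs ?X \<sigma> \<tau>2" using u u2 by (auto simp: unchanged_def same_regs_def \<tau>1_def)
      have e3: "eval I \<upsilon> (divE (Reg 17) (Reg 12)) = real (z div B ^ Suc t)"
        if "regs \<upsilon> 17 = real (z div B ^ t)" "regs \<upsilon> 12 = real B" for \<upsilon>
        unfolding zS using that by (intro eval_divE) auto
      have ea: "addr (eval I \<upsilon> keyA) = ?c" if "regs \<upsilon> 0 = real n" "regs \<upsilon> 16 = real p" for \<upsilon>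
        using that addr_key[of n p] by (simp add: keyA_def)
      have lt: "z div B ^ Suc t < j" unfolding zS t(2) using pos B by (intro div_less_dividend) auto
      have I1: "Inv (z div B ^ Suc t) (\<tau>2\<lparr>mem := (mem \<tau>2)(?c := regs \<tau>2 10),
          regs := (regs \<tau>2)(18 := 1, 17 := real (z div B ^ Suc t))\<rparr>)" if "0 < regs \<tau>2 29"
      proof -
        have "key_of s r w B z P (regs \<tau>2 10)"
          unfolding key_of_def covered_def using pos that ok2 c2 x_def by blast
        then show ?thesis unfolding Inv_def using s2 mem r2
          by (intro conjI exI[of _ "Suc t"]) (auto simp: same_regs_def)
      qed
      have I2: "Inv (z div B ^ Suc t) (\<tau>2\<lparr>regs := (regs \<tau>2)(27 := 0, 17 := real (z div B ^ Suc t))\<rparr>)"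
        if "\<not> 0 < regs \<tau>2 29"
      proof -
        have "\<not> ?cov t" using that ok2 unfolding covered_def x_def by blast
        then have "(\<exists>t'<Suc t. ?cov t') \<longrightarrow> 0 < regs \<tau> 18" using cov less_Suc_eq by auto
        then show ?thesis unfolding Inv_def using s2 mem r2 key
          by (intro conjI exI[of _ "Suc t"]) (auto simp: same_regs_def)
      qed
      show ?thesis
        by (intro wp_Seq wp_Assign wp_Cond wp_Store) (use I1 I2 lt in \<open>auto intro!: exI[of _ "z div B ^ Suc t"] simp: r2 e3 ea fun_upd_def\<close>)
    qed
    have "wp I UNIV (curve_prog CARD('d)) (\<lambda>t \<tau>2. unchanged {5, 7, 8, 9, 10, 27, 29} \<tau>1 \<tau>2 \<and>
      regs \<tau>2 10 = curve_code s r w P x \<and> (0 < regs \<tau>2 29 \<longleftrightarrow> curve_ok s r w P x)) \<tau>1"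
      by (rule wp_curve_prog[OF P _ _ _ _ _ w]) (use r in \<open>auto simp: \<tau>1_def\<close>)
    then have "wp I UNIV (Seq (curve_prog CARD('d)) ?q) (\<lambda>t \<tau>'. \<exists>j'<j. Inv j' \<tau>') \<tau>1"
      by (intro wp_Seq[of _ _ "curve_prog _"]) (erule wp_mono, elim conjE, rule fin)
    then show ?thesis
      by (intro wp_Seq[of _ _ "Assign _ _"] wp_Assign) (simp add: e1 \<tau>1_def)
  qed
  define \<sigma>1 where "\<sigma>1 = \<sigma>\<lparr>regs := (regs \<sigma>)(17 := real z, 18 := 0)\<rparr>"
  have init: "Inv z \<sigma>1"
    unfolding Inv_def by (intro conjI exI[of _ 0]) (auto simp: \<sigma>1_def same_regs_def)
  have "wp I UNIV (While ?b ?body) (\<lambda>t. ?Post) \<sigma>1"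
  proof (rule wp_While_measure[of Inv, OF init step])
    fix j \<tau>
    assume inv: "Inv j \<tau>" and h: "\<not> holds I \<tau> ?b"
    obtain t where u: "same_regs ?X \<sigma> \<tau>" and mem: "\<forall>c. c \<noteq> ?c \<longrightarrow> mem \<tau> c = mem \<sigma> c"
      and key: "0 < regs \<tau> 18 \<longrightarrow> key_of s r w B z P (mem \<tau> ?c)"
      and t: "regs \<tau> 17 = real (z div B ^ t)" and cov: "(\<exists>t'<t. ?cov t') \<longrightarrow> 0 < regs \<tau> 18"
      using inv unfolding Inv_def by blast
    have z0: "z div B ^ t = 0" using h t by simp
    have "t' < t" if "?cov t'" for t'
    proof (rule ccontr)
      assume "\<not> t' < t"
      then have "B ^ t \<le> B ^ t'" using B by (intro power_increasing) auto
      then have "z div B ^ t' \<le> z div B ^ t" using B by (intro div_le_mono2) auto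
      then show False using that z0 by (simp add: covered_def)
    qed
    then show "?Post \<tau>"
      using u mem key cov by blast
  qed
  then show ?thesis
    unfolding key_prog_def
    by (intro wp_Seq[of _ _ "Assign _ _"] wp_Assign) (simp add: \<sigma>1_def regs)
qed

section \<open>Positions of the curves in the input\<close>

definition offset :: "'d::finite curve list \<Rightarrow> nat \<Rightarrow> nat" where
  "offset Ps p = length (enc_curves (take p Ps))"

lemma length_concat_const: "\<forall>x\<in>set xs. length x = d \<Longrightarrow> length (concat xs) = length xs * d"
  by (induction xs) auto

lemma nth_concat_const:
  "\<forall>x\<in>set xs. length x = d \<Longrightarrow> i < length xs \<Longrightarrow> c < d \<Longrightarrow> concat xs ! (i * d + c) = xs ! i ! c"
proof (induction xs arbitrary: i)
  case (Cons x xs)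
  then show ?case by (cases i) (auto simp: nth_append)
qed simp

lemma length_enc_curve: "length (enc_curve (P :: 'd::finite curve)) = 1 + length P * CARD('d)"
  unfolding enc_curve_def by (simp add: length_concat_const[where d = "CARD('d)"] coords_props)

lemma has_curve_append:
  fixes P :: "'d::finite curve"
  shows "has_curve (us @ enc_curve P @ vs) (length us) P"
proof -
  have bound: "i * CARD('d) + c < length P * CARD('d)" if "i < length P" "c < CARD('d)" for i c
  proof -
    have "i * CARD('d) + c < Suc i * CARD('d)" using that by simp
    also have "\<dots> \<le> length P * CARD('d)" using that by (intro mult_le_mono1) simp
    finally show ?thesis .
  qed
  have "enc_curve P ! (1 + (i * CARD('d) + c)) = P ! i $ (coords ! c)" if "i < length P" "c < CARD('d)" for i c
    unfolding enc_curve_def using that by (simp add: nth_concat_const coords_props)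
  then show ?thesis
    unfolding has_curve_def using bound
    by (auto intro: trans_less_add1 simp: nth_append length_enc_curve enc_curve_def[of P, THEN arg_cong[of _ _ "\<lambda>l. l ! 0"]])
qed

lemma has_curve_enc_curve: "has_curve (enc_curve P) 0 P"
  using has_curve_append[of "[]" P "[]"] by simp

lemma has_curve_enc_curves:
  assumes "p < length Ps"
  shows "has_curve (enc_curves Ps) (offset Ps p) (Ps ! p)"
proof -
  have "enc_curves Ps = enc_curves (take p Ps @ Ps ! p # drop (Suc p) Ps)"
    using assms by (simp add: id_take_nth_drop[symmetric])
  then have "enc_curves Ps = enc_curves (take p Ps) @ enc_curve (Ps ! p) @ enc_curves (drop (Suc p) Ps)"
    by (simp add: enc_curves_def)
  then show ?thesis unfolding offset_def using has_curve_append by metis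
qed

lemma offset_Suc:
  fixes Ps :: "'d::finite curve list"
  shows "p < length Ps \<Longrightarrow> offset Ps (Suc p) = offset Ps p + 1 + CARD('d) * length (Ps ! p)"
  by (simp add: offset_def enc_curves_def take_Suc_conv_app_nth length_enc_curve)

lemma same_regs_trans: "same_regs X \<sigma> \<tau> \<Longrightarrow> same_regs Y \<tau> \<upsilon> \<Longrightarrow> X \<subseteq> Z \<Longrightarrow> Y \<subseteq> Z \<Longrightarrow> same_regs Z \<sigma> \<upsilon>"
  unfolding same_regs_def by (metis subsetD)

definition keys_prog :: "nat \<Rightarrow> prog" where
  "keys_prog d = Seq (Assign 15 (Lit 0)) (Seq (Assign 6 (Lit 0)) (Seq (Assign 16 (Lit 0))
     (While (Less (Reg 16) (Reg 0)) (Seq (key_prog d)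
       (Seq (Cond (Less (Lit 0) (Reg 18)) (Assign 27 (Lit 0)) (Assign 15 (Lit 1)))
       (Seq (Assign 6 (Add (Add (Reg 6) (Lit 1)) (Mul (Lit (int d)) (Inp (Reg 6)))))
         (Assign 16 (Add (Reg 16) (Lit 1)))))))))"

text \<open>Two one-sided facts about the flag in register 15 are what the search requires: if it is
  down, all keys are in place, and a number covering all curves does not raise it.\<close>

lemma wp_keys_prog:
  fixes Ps :: "'d::finite curve list"
  assumes regs: "regs \<sigma> 0 = real (length Ps)" "regs \<sigma> 3 = r" "regs \<sigma> 4 = real s"
    "regs \<sigma> 11 = real w" "regs \<sigma> 12 = real B" "regs \<sigma> 14 = real z"
    and w: "w > 0" and B: "B > 1"
  shows "wp (enc_curves Ps) UNIV (keys_prog CARD('d)) (\<lambda>t \<tau>.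
    same_regs {5, 6, 7, 8, 9, 10, 15, 16, 17, 18, 27, 29} \<sigma> \<tau> \<and>
    (\<not> 0 < regs \<tau> 15 \<longrightarrow> (\<forall>p<length Ps. key_of s r w B z (Ps ! p) (mem \<tau> (8 + 2 * length Ps + p)))) \<and>
    ((\<forall>p<length Ps. \<exists>t. covered s r w B z (Ps ! p) t) \<longrightarrow> \<not> 0 < regs \<tau> 15)) \<sigma>"
    (is "wp _ _ _ (\<lambda>t. ?Post) _")
proof -
  let ?I = "enc_curves Ps"
  let ?X = "{5, 6, 7, 8, 9, 10, 15, 16, 17, 18, 27, 29} :: nat set"
  let ?n = "length Ps"
  let ?cell = "\<lambda>p. 8 + 2 * ?n + p"
  let ?b = "Less (Reg 16) (Reg 0)"
  let ?q = "Seq (Cond (Less (Lit 0) (Reg 18)) (Assign 27 (Lit 0)) (Assign 15 (Lit 1)))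
       (Seq (Assign 6 (Add (Add (Reg 6) (Lit 1)) (Mul (Lit (int CARD('d))) (Inp (Reg 6)))))
         (Assign 16 (Add (Reg 16) (Lit 1))))"
  define Inv where "Inv j \<tau> \<longleftrightarrow> same_regs ?X \<sigma> \<tau> \<and> (\<exists>p. j = ?n - p \<and> p \<le> ?n \<and> regs \<tau> 16 = real p \<and>
    regs \<tau> 6 = real (offset Ps p) \<and>
    (\<not> 0 < regs \<tau> 15 \<longrightarrow> (\<forall>p'<p. key_of s r w B z (Ps ! p') (mem \<tau> (?cell p')))) \<and>
    ((\<forall>p'<p. \<exists>t. covered s r w B z (Ps ! p') t) \<longrightarrow> \<not> 0 < regs \<tau> 15))" for j \<tau>
  have step: "wp ?I UNIV (Seq (key_prog CARD('d)) ?q) (\<lambda>t \<tau>'. \<exists>j'<j. Inv j' \<tau>') \<tau>"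
    if inv: "Inv j \<tau>" and h: "holds ?I \<tau> ?b" for j \<tau>
  proof -
    obtain p where u: "same_regs ?X \<sigma> \<tau>" and j: "j = ?n - p" and p: "regs \<tau> 16 = real p" "regs \<tau> 6 = real (offset Ps p)"
      and keys: "\<not> 0 < regs \<tau> 15 \<longrightarrow> (\<forall>p'<p. key_of s r w B z (Ps ! p') (mem \<tau> (?cell p')))"
      and cov: "(\<forall>p'<p. \<exists>t. covered s r w B z (Ps ! p') t) \<longrightarrow> \<not> 0 < regs \<tau> 15"
      using inv unfolding Inv_def by blast
    have r: "regs \<tau> 0 = real ?n" "regs \<tau> 3 = r" "regs \<tau> 4 = real s"
      "regs \<tau> 11 = real w" "regs \<tau> 12 = real B" "regs \<tau> 14 = real z"
      using u regs by (auto simp: same_regs_def)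
    have lt: "p < ?n" using h p r by simp
    note P = has_curve_enc_curves[OF lt]
    have "wp ?I UNIV ?q (\<lambda>t \<tau>'. \<exists>j'<j. Inv j' \<tau>') \<tau>1"
      if u1: "same_regs {5, 7, 8, 9, 10, 17, 18, 27, 29} \<tau> \<tau>1"
        and m1: "\<forall>c. c \<noteq> ?cell p \<longrightarrow> mem \<tau>1 c = mem \<tau> c"
        and k1: "0 < regs \<tau>1 18 \<longrightarrow> key_of s r w B z (Ps ! p) (mem \<tau>1 (?cell p))"
        and c1: "(\<exists>t. covered s r w B z (Ps ! p) t) \<longrightarrow> 0 < regs \<tau>1 18" for \<tau>1
    proof -
      have s1: "same_regs ?X \<sigma> \<tau>1" by (rule same_regs_trans[OF u u1]) auto
      have r1: "regs \<tau>1 16 = real p" "regs \<tau>1 6 = real (offset Ps p)" "regs \<tau>1 15 = regs \<tau> 15"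
        using u1 p by (auto simp: same_regs_def)
      have e: "eval ?I \<upsilon> (Add (Add (Reg 6) (Lit 1)) (Mul (Lit (int CARD('d))) (Inp (Reg 6)))) = real (offset Ps (Suc p))"
        if "regs \<upsilon> 6 = real (offset Ps p)" for \<upsilon>
        using that P by (simp add: offset_Suc[OF lt] has_curve_def Let_def)
      have I1: "Inv (?n - Suc p) (\<tau>1\<lparr>regs := (regs \<tau>1)(27 := 0, 6 := real (offset Ps (Suc p)), 16 := real p + 1)\<rparr>)"
        if "0 < regs \<tau>1 18"
        unfolding Inv_def using s1 m1 k1 that keys cov lt r1
        by (intro conjI exI[of _ "Suc p"]) (auto simp: same_regs_def less_Suc_eq)
      have I2: "Inv (?n - Suc p) (\<tau>1\<lparr>regs := (regs \<tau>1)(15 := 1, 6 := real (offset Ps (Suc p)), 16 := real p + 1)\<rparr>)"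
        if "\<not> 0 < regs \<tau>1 18"
        unfolding Inv_def using s1 that c1 lt r1
        by (intro conjI exI[of _ "Suc p"]) (auto simp: same_regs_def)
      have less: "?n - Suc p < j" using j lt by simp
      show ?thesis
        apply (intro wp_Seq wp_Cond wp_Assign)
        subgoal using I1 less by (subst e) (auto simp: r1)
        subgoal using I2 less by (subst e) (auto simp: r1)
        done
    qed
    then show ?thesis
      by (intro wp_Seq[of _ _ "key_prog _"] wp_mono[OF wp_key_prog[OF P p(2) r(2-6) p(1) r(1) w B]]) blast
  qed
  define \<sigma>1 where "\<sigma>1 = \<sigma>\<lparr>regs := (regs \<sigma>)(15 := 0, 6 := 0, 16 := 0)\<rparr>"
  have init: "Inv ?n \<sigma>1"
    unfolding Inv_def
    by (intro conjI exI[of _ 0]) (auto simp: \<sigma>1_def same_regs_def offset_def enc_curves_def)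
  have "wp ?I UNIV (While ?b (Seq (key_prog CARD('d)) ?q)) (\<lambda>t. ?Post) \<sigma>1"
  proof (rule wp_While_measure[of Inv, OF init step])
    fix j \<tau>
    assume inv: "Inv j \<tau>" and h: "\<not> holds ?I \<tau> ?b"
    obtain p where u: "same_regs ?X \<sigma> \<tau>" and p: "p \<le> ?n" "regs \<tau> 16 = real p"
      and keys: "\<not> 0 < regs \<tau> 15 \<longrightarrow> (\<forall>p'<p. key_of s r w B z (Ps ! p') (mem \<tau> (?cell p')))"
      and cov: "(\<forall>p'<p. \<exists>t. covered s r w B z (Ps ! p') t) \<longrightarrow> \<not> 0 < regs \<tau> 15"
      using inv unfolding Inv_def by blast
    have "regs \<tau> 0 = real ?n" using u regs by (auto simp: same_regs_def)
    then have "p = ?n" using h p by simp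
    then show "?Post \<tau>"
      using u keys cov by blast
  qed
  then show ?thesis
    unfolding keys_prog_def
    by (intro wp_Seq[of _ _ "Assign _ _"] wp_Assign) (simp add: \<sigma>1_def)
qed

text \<open>Register 15 tells whether the candidate \<open>z\<close> in register 14 leaves a curve without a suitable shift
  vector. The first suitable candidate has no more digits than the one whose existence is known.\<close>

definition search_prog :: "nat \<Rightarrow> prog" where
  "search_prog d = Seq (Assign 14 (Lit 0)) (Seq (Assign 15 (Lit 1))
     (While (Less (Lit 0) (Reg 15)) (Seq (Assign 14 (Add (Reg 14) (Lit 1))) (keys_prog d))))"

lemma wp_search_prog:
  fixes Ps :: "'d::finite curve list"
  assumes regs: "regs \<sigma> 0 = real (length Ps)" "regs \<sigma> 3 = r" "regs \<sigma> 4 = real s"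
    "regs \<sigma> 11 = real w" "regs \<sigma> 12 = real B"
    and w: "w > 0" and B: "B > 1"
    and z0: "0 < z0" "\<forall>p<length Ps. \<exists>t. covered s r w B z0 (Ps ! p) t"
  shows "wp (enc_curves Ps) UNIV (search_prog CARD('d)) (\<lambda>t \<tau>.
    same_regs {5, 6, 7, 8, 9, 10, 14, 15, 16, 17, 18, 27, 29} \<sigma> \<tau> \<and>
    (\<exists>z. regs \<tau> 14 = real z \<and> z \<le> z0 \<and>
      (\<forall>p<length Ps. key_of s r w B z (Ps ! p) (mem \<tau> (8 + 2 * length Ps + p))))) \<sigma>"
    (is "wp _ _ _ (\<lambda>t. ?Post) _")
proof -
  let ?I = "enc_curves Ps"
  let ?X = "{5, 6, 7, 8, 9, 10, 14, 15, 16, 17, 18, 27, 29} :: nat set"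
  let ?n = "length Ps"
  let ?b = "Less (Lit 0) (Reg 15)"
  let ?keys = "\<lambda>z \<tau>. \<forall>p<?n. key_of s r w B z (Ps ! p) (mem \<tau> (8 + 2 * ?n + p))"
  define Inv where "Inv j \<tau> \<longleftrightarrow> same_regs ?X \<sigma> \<tau> \<and> (\<exists>z. j = z0 - z \<and> z \<le> z0 \<and> regs \<tau> 14 = real z \<and>
    (0 < regs \<tau> 15 \<longrightarrow> z < z0) \<and> (\<not> 0 < regs \<tau> 15 \<longrightarrow> ?keys z \<tau>))" for j \<tau>
  have step: "wp ?I UNIV (Seq (Assign 14 (Add (Reg 14) (Lit 1))) (keys_prog CARD('d))) (\<lambda>t \<tau>'. \<exists>j'<j. Inv j' \<tau>') \<tau>"
    if inv: "Inv j \<tau>" and h: "holds ?I \<tau> ?b" for j \<tau>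
  proof -
    obtain z where u: "same_regs ?X \<sigma> \<tau>" and z: "j = z0 - z" "regs \<tau> 14 = real z" "z < z0"
      using inv h unfolding Inv_def by auto
    define \<tau>1 where "\<tau>1 = \<tau>\<lparr>regs := (regs \<tau>)(14 := real (Suc z))\<rparr>"
    have u1: "same_regs ?X \<sigma> \<tau>1" using u by (simp add: same_regs_def \<tau>1_def)
    have r1: "regs \<tau>1 0 = real ?n" "regs \<tau>1 3 = r" "regs \<tau>1 4 = real s"
      "regs \<tau>1 11 = real w" "regs \<tau>1 12 = real B" "regs \<tau>1 14 = real (Suc z)"
      using u regs by (auto simp: same_regs_def \<tau>1_def)
    have "wp ?I UNIV (keys_prog CARD('d)) (\<lambda>t \<tau>'. \<exists>j'<j. Inv j' \<tau>') \<tau>1"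
    proof (rule wp_mono[OF wp_keys_prog[OF r1 w B]], elim conjE)
      fix \<tau>'
      assume u': "same_regs {5, 6, 7, 8, 9, 10, 15, 16, 17, 18, 27, 29} \<tau>1 \<tau>'"
        and keys: "\<not> 0 < regs \<tau>' 15 \<longrightarrow> ?keys (Suc z) \<tau>'"
        and cov: "(\<forall>p<?n. \<exists>t. covered s r w B (Suc z) (Ps ! p) t) \<longrightarrow> \<not> 0 < regs \<tau>' 15"
      have "same_regs ?X \<sigma> \<tau>'" by (rule same_regs_trans[OF u1 u']) auto
      moreover have "regs \<tau>' 14 = real (Suc z)" using u' r1 by (simp add: same_regs_def)
      moreover have "Suc z < z0" if "0 < regs \<tau>' 15"
        using that cov z0(2) z(3) by (cases "Suc z = z0") auto
      ultimately have "Inv (z0 - Suc z) \<tau>'"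
        unfolding Inv_def using keys z(3) by (intro conjI exI[of _ "Suc z"]) auto
      then show "\<exists>j'<j. Inv j' \<tau>'" using z by (intro exI[of _ "z0 - Suc z"]) auto
    qed
    then show ?thesis
      by (intro wp_Seq wp_Assign) (simp add: z \<tau>1_def add.commute)
  qed
  define \<sigma>1 where "\<sigma>1 = \<sigma>\<lparr>regs := (regs \<sigma>)(14 := 0, 15 := 1)\<rparr>"
  have init: "Inv z0 \<sigma>1"
    unfolding Inv_def using z0 by (intro conjI exI[of _ 0]) (auto simp: \<sigma>1_def same_regs_def)
  have "wp ?I UNIV (While ?b (Seq (Assign 14 (Add (Reg 14) (Lit 1))) (keys_prog CARD('d)))) (\<lambda>t. ?Post) \<sigma>1"
  proof (rule wp_While_measure[of Inv, OF init step])
    fix j \<tau>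
    assume "Inv j \<tau>" and h: "\<not> holds ?I \<tau> ?b"
    then show "?Post \<tau>"
      unfolding Inv_def by auto
  qed
  then show ?thesis
    unfolding search_prog_def
    by (intro wp_Seq[of _ _ "Assign _ _"] wp_Assign) (simp add: \<sigma>1_def)
qed

section \<open>Sorting by key_rank\<close>

text \<open>Ties are broken by position. This makes the order strict and total, so curves sharing a
  key still get different ranks.\<close>

definition lt_key :: "(nat \<Rightarrow> real) \<Rightarrow> nat \<Rightarrow> nat \<Rightarrow> bool" where
  "lt_key K i p \<longleftrightarrow> K i < K p \<or> \<not> K p < K i \<and> i < p"

definition key_rank :: "nat \<Rightarrow> (nat \<Rightarrow> real) \<Rightarrow> nat \<Rightarrow> nat" where
  "key_rank n K p = card {i \<in> {..<n}. lt_key K i p}"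

lemma lt_key_trans: "lt_key K a b \<Longrightarrow> lt_key K b c \<Longrightarrow> lt_key K a c"
  unfolding lt_key_def by linarith

lemma lt_key_linear: "a \<noteq> b \<Longrightarrow> lt_key K a b \<or> lt_key K b a"
  unfolding lt_key_def by linarith

lemma lt_key_irrefl: "\<not> lt_key K a a"
  unfolding lt_key_def by simp

lemma key_rank_less: "a < n \<Longrightarrow> lt_key K a b \<Longrightarrow> key_rank n K a < key_rank n K b"
  unfolding key_rank_def
  by (rule psubset_card_mono) (use lt_key_trans lt_key_irrefl in \<open>auto, blast+\<close>)

lemma key_rank_bij: "bij_betw (key_rank n K) {..<n} {..<n}"
proof -
  have "key_rank n K p < n" if "p < n" for p
  proof -
    have "{i \<in> {..<n}. lt_key K i p} \<subset> {..<n}" using that lt_key_irrefl by blast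
    then have "card {i \<in> {..<n}. lt_key K i p} < card {..<n}" by (rule psubset_card_mono[rotated]) simp
    then show ?thesis by (simp add: key_rank_def)
  qed
  moreover have "inj_on (key_rank n K) {..<n}"
    by (rule inj_onI) (metis key_rank_less lt_key_linear lessThan_iff less_irrefl)
  ultimately show ?thesis
    by (intro bij_betw_imageI endo_inj_surj) auto
qed

lemma key_rank_mono:
  assumes "p < n" "q < n" "key_rank n K p \<le> key_rank n K q"
  shows "K p \<le> K q"
proof (rule ccontr)
  assume "\<not> K p \<le> K q"
  then have "lt_key K q p" by (simp add: lt_key_def)
  then show False using key_rank_less[of q n K p] assms by simp
qed

definition stores_keys :: "(nat \<Rightarrow> real) \<Rightarrow> 'd::finite curve list \<Rightarrow> nat \<Rightarrow> real \<Rightarrow> nat \<Rightarrow> nat \<Rightarrow> nat \<Rightarrow> (nat \<Rightarrow> real) \<Rightarrow> bool" where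
  "stores_keys D Ps s r w B z K \<longleftrightarrow> (\<forall>p<length Ps. key_of s r w B z (Ps ! p) (K p) \<and>
    D (8 + key_rank (length Ps) K p) = K p \<and> D (8 + length Ps + key_rank (length Ps) K p) = real p)"

text \<open>The negation of \<open>lt_key\<close>: tests offer conjunction and negation only, so a
  conjunction of negations replaces the disjunction, and the branches of the conditional are
  swapped.\<close>

definition geT :: test where
  "geT = AndT (NotT (Less (Mem (Add (Add (Lit 8) (Mul (Lit 2) (Reg 0))) (Reg 7))) (Mem keyA)))
     (NotT (AndT (NotT (Less (Mem keyA) (Mem (Add (Add (Lit 8) (Mul (Lit 2) (Reg 0))) (Reg 7)))))
       (Less (Reg 7) (Reg 16))))"

definition rank1_prog :: prog where
  "rank1_prog = Seq (Assign 24 (Lit 0)) (Seq (Assign 7 (Lit 0)) (While (Less (Reg 7) (Reg 0))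
     (Seq (Cond geT (Assign 27 (Lit 0)) (Assign 24 (Add (Reg 24) (Lit 1))))
      (Assign 7 (Add (Reg 7) (Lit 1))))))"

lemma wp_rank1_prog:
  assumes K: "\<forall>i<n. mem \<sigma> (8 + 2 * n + i) = K i" and regs: "regs \<sigma> 0 = real n" "regs \<sigma> 16 = real p" and p: "p < n"
  shows "wp I W rank1_prog (\<lambda>t \<tau>. unchanged {7, 24, 27} \<sigma> \<tau> \<and> regs \<tau> 24 = real (key_rank n K p)) \<sigma>"
    (is "wp _ _ _ (\<lambda>t. ?Post) _")
proof -
  let ?X = "{7, 24, 27} :: nat set"
  let ?b = "Less (Reg 7) (Reg 0)"
  let ?c = "\<lambda>i. card {i' \<in> {..<i}. lt_key K i' p}"
  let ?body = "Seq (Cond geT (Assign 27 (Lit 0)) (Assign 24 (Add (Reg 24) (Lit 1)))) (Assign 7 (Add (Reg 7) (Lit 1)))"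
  define Inv where "Inv j \<tau> \<longleftrightarrow> unchanged ?X \<sigma> \<tau> \<and> (\<exists>i. j = n - i \<and> i \<le> n \<and> regs \<tau> 7 = real i \<and> regs \<tau> 24 = real (?c i))"
    for j \<tau>
  have c_Suc: "?c (Suc i) = (if lt_key K i p then Suc (?c i) else ?c i)" for i
  proof -
    have "{i' \<in> {..<Suc i}. lt_key K i' p} =
      (if lt_key K i p then insert i {i' \<in> {..<i}. lt_key K i' p} else {i' \<in> {..<i}. lt_key K i' p})"
      by (auto simp: less_Suc_eq)
    then show ?thesis by simp
  qed
  have step: "wp I W ?body (\<lambda>t \<tau>'. \<exists>j'<j. Inv j' \<tau>') \<tau>"
    if inv: "Inv j \<tau>" and h: "holds I \<tau> ?b" for j \<tau>
  proof -
    obtain i where u: "unchanged ?X \<sigma> \<tau>" and i: "j = n - i" "regs \<tau> 7 = real i" "regs \<tau> 24 = real (?c i)"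
      using inv unfolding Inv_def by blast
    have r: "regs \<tau> 0 = real n" "regs \<tau> 16 = real p" using u regs by (auto simp: unchanged_def)
    have lt: "i < n" using h i r by simp
    have t: "holds I \<tau> geT \<longleftrightarrow> \<not> lt_key K i p"
      using u K lt p i r unfolding geT_def lt_key_def keyA_def by (auto simp: addr_key unchanged_def)
    have I1: "Inv (n - Suc i) (\<tau>\<lparr>regs := (regs \<tau>)(27 := 0, 7 := real i + 1)\<rparr>)" if "\<not> lt_key K i p"
      unfolding Inv_def using u lt i c_Suc[of i] that
      by (intro conjI exI[of _ "Suc i"]) (auto simp: unchanged_def)
    have I2: "Inv (n - Suc i) (\<tau>\<lparr>regs := (regs \<tau>)(24 := real (?c i) + 1, 7 := real i + 1)\<rparr>)" if "lt_key K i p"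
      unfolding Inv_def using u lt i c_Suc[of i] that
      by (intro conjI exI[of _ "Suc i"]) (auto simp: unchanged_def)
    have less: "n - Suc i < j" using i lt by simp
    show ?thesis
      apply (intro wp_Seq wp_Cond wp_Assign)
      subgoal using I1 less unfolding t by (auto simp: i)
      subgoal using I2 less unfolding t by (auto simp: i)
      done
  qed
  define \<sigma>1 where "\<sigma>1 = \<sigma>\<lparr>regs := (regs \<sigma>)(24 := 0, 7 := 0)\<rparr>"
  have init: "Inv n \<sigma>1"
    unfolding Inv_def by (intro conjI exI[of _ 0]) (auto simp: \<sigma>1_def unchanged_def)
  have "wp I W (While ?b ?body) (\<lambda>t. ?Post) \<sigma>1"
  proof (rule wp_While_measure[of Inv, OF init step])
    fix j \<tau>
    assume inv: "Inv j \<tau>" and h: "\<not> holds I \<tau> ?b"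
    obtain i where u: "unchanged ?X \<sigma> \<tau>" and i: "i \<le> n" "regs \<tau> 7 = real i" "regs \<tau> 24 = real (?c i)"
      using inv unfolding Inv_def by blast
    have "regs \<tau> 0 = real n" using u regs by (auto simp: unchanged_def)
    then have "i = n" using h i by simp
    then show "?Post \<tau>" using u i by (simp add: key_rank_def)
  qed
  then show ?thesis
    unfolding rank1_prog_def
    by (intro wp_Seq[of _ _ "Assign _ _"] wp_Assign) (simp add: \<sigma>1_def)
qed

definition sort_prog :: prog where
  "sort_prog = Seq (Assign 16 (Lit 0)) (While (Less (Reg 16) (Reg 0)) (Seq rank1_prog
     (Seq (Store (Add (Lit 8) (Reg 24)) (Mem keyA)) (Seq (Store (Add (Add (Lit 8) (Reg 0)) (Reg 24)) (Reg 16))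
       (Assign 16 (Add (Reg 16) (Lit 1)))))))"

text \<open>The sorted table and the scratch keys occupy disjoint cells, so every rank is computed
  from the original keys; distinct ranks keep the writes from colliding.\<close>

lemma wp_sort_prog:
  assumes K: "\<forall>i<n. mem \<sigma> (8 + 2 * n + i) = K i" and regs: "regs \<sigma> 0 = real n"
  shows "wp I UNIV sort_prog (\<lambda>t \<tau>. same_regs {7, 16, 24, 27} \<sigma> \<tau> \<and>
    (\<forall>p<n. mem \<tau> (8 + key_rank n K p) = K p \<and> mem \<tau> (8 + n + key_rank n K p) = real p)) \<sigma>"
    (is "wp _ _ _ (\<lambda>t. ?Post) _")
proof -
  let ?X = "{7, 16, 24, 27} :: nat set"
  let ?b = "Less (Reg 16) (Reg 0)"
  let ?q = "Seq (Store (Add (Lit 8) (Reg 24)) (Mem keyA)) (Seq (Store (Add (Add (Lit 8) (Reg 0)) (Reg 24)) (Reg 16))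
       (Assign 16 (Add (Reg 16) (Lit 1))))"
  define Inv where "Inv j \<tau> \<longleftrightarrow> same_regs ?X \<sigma> \<tau> \<and> (\<forall>i<n. mem \<tau> (8 + 2 * n + i) = K i) \<and>
    (\<exists>p. j = n - p \<and> p \<le> n \<and> regs \<tau> 16 = real p \<and>
      (\<forall>p'<p. mem \<tau> (8 + key_rank n K p') = K p' \<and> mem \<tau> (8 + n + key_rank n K p') = real p'))" for j \<tau>
  have key_rank: "key_rank n K p < n" if "p < n" for p
    using bij_betwE[OF key_rank_bij[of n K]] that by auto
  have key_rank_eq: "key_rank n K p = key_rank n K q \<longleftrightarrow> p = q" if "p < n" "q < n" for p q
    using bij_betw_imp_inj_on[OF key_rank_bij[of n K]] that by (auto simp: inj_on_def)
  have step: "wp I UNIV (Seq rank1_prog ?q) (\<lambda>t \<tau>'. \<exists>j'<j. Inv j' \<tau>') \<tau>"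
    if inv: "Inv j \<tau>" and h: "holds I \<tau> ?b" for j \<tau>
  proof -
    obtain p where u: "same_regs ?X \<sigma> \<tau>" and keys: "\<forall>i<n. mem \<tau> (8 + 2 * n + i) = K i"
      and p: "j = n - p" "regs \<tau> 16 = real p"
      and done': "\<forall>p'<p. mem \<tau> (8 + key_rank n K p') = K p' \<and> mem \<tau> (8 + n + key_rank n K p') = real p'"
      using inv unfolding Inv_def by blast
    have r0: "regs \<tau> 0 = real n" using u regs by (auto simp: same_regs_def)
    have lt: "p < n" using h p r0 by simp
    let ?R = "key_rank n K p"
    have "wp I UNIV ?q (\<lambda>t \<tau>'. \<exists>j'<j. Inv j' \<tau>') \<tau>1"
      if u1: "unchanged {7, 24, 27} \<tau> \<tau>1" and r24: "regs \<tau>1 24 = real ?R" for \<tau>1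
    proof -
      have r1: "regs \<tau>1 0 = real n" "regs \<tau>1 16 = real p" "mem \<tau>1 = mem \<tau>"
        using u1 r0 p by (auto simp: unchanged_def)
      have a1: "addr (8 + real ?R) = 8 + ?R"
        using addr_of_nat[of "8 + ?R"] by (simp only: of_nat_add of_nat_numeral)
      have a2: "addr (8 + real n + real ?R) = 8 + n + ?R"
        using addr_of_nat[of "8 + n + ?R"] by (simp only: of_nat_add of_nat_numeral)
      let ?M = "(mem \<tau>)(8 + ?R := K p, 8 + n + ?R := real p)"
      have "\<forall>i<n. ?M (8 + 2 * n + i) = K i" using keys key_rank[OF lt] by auto
      moreover have "\<forall>p'<Suc p. ?M (8 + key_rank n K p') = K p' \<and> ?M (8 + n + key_rank n K p') = real p'"
      proof (intro allI impI)
        fix p' assume p': "p' < Suc p"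
        then have "p' < n" using lt by simp
        then show "?M (8 + key_rank n K p') = K p' \<and> ?M (8 + n + key_rank n K p') = real p'"
          using key_rank[of p'] key_rank[OF lt] key_rank_eq[of p' p] lt done' p' by (auto simp: less_Suc_eq)
      qed
      ultimately have "Inv (n - Suc p) (\<tau>1\<lparr>mem := ?M, regs := (regs \<tau>1)(16 := real p + 1)\<rparr>)"
        unfolding Inv_def using u u1 lt
        by (intro conjI exI[of _ "Suc p"]) (auto simp: same_regs_def unchanged_def simp del: fun_upd_apply, auto)
      then have "\<exists>j'<j. Inv j' (\<tau>1\<lparr>mem := ?M, regs := (regs \<tau>1)(16 := real p + 1)\<rparr>)"
        using p lt by (intro exI[of _ "n - Suc p"]) auto
      then show ?thesis
        using keys lt
        by (intro wp_Seq wp_Store wp_Assign) (auto simp: r1 r24 a1 a2 addr_key keyA_def)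
    qed
    then show ?thesis
      by (intro wp_Seq[of _ _ rank1_prog] wp_mono[OF wp_rank1_prog[OF keys r0 p(2) lt]]) blast
  qed
  define \<sigma>1 where "\<sigma>1 = \<sigma>\<lparr>regs := (regs \<sigma>)(16 := 0)\<rparr>"
  have init: "Inv n \<sigma>1"
    unfolding Inv_def using K by (intro conjI exI[of _ 0]) (auto simp: \<sigma>1_def same_regs_def)
  have "wp I UNIV (While ?b (Seq rank1_prog ?q)) (\<lambda>t. ?Post) \<sigma>1"
  proof (rule wp_While_measure[of Inv, OF init step])
    fix j \<tau>
    assume inv: "Inv j \<tau>" and h: "\<not> holds I \<tau> ?b"
    obtain p where u: "same_regs ?X \<sigma> \<tau>" and p: "p \<le> n" "regs \<tau> 16 = real p"
      and d: "\<forall>p'<p. mem \<tau> (8 + key_rank n K p') = K p' \<and> mem \<tau> (8 + n + key_rank n K p') = real p'"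
      using inv unfolding Inv_def by blast
    have "regs \<tau> 0 = real n" using u regs by (auto simp: same_regs_def)
    then have "p = n" using h p by simp
    then show "?Post \<tau>"
      using u d by blast
  qed
  then show ?thesis
    unfolding sort_prog_def
    by (intro wp_Seq[of _ _ "Assign _ _"] wp_Assign) (simp add: \<sigma>1_def)
qed

text \<open>Register 22 lags one iteration behind register 13 and so ends with
  \<open>(2 * m) ^ (k - 1)\<close>.\<close>

definition powers_prog :: prog where
  "powers_prog = Seq (Assign 12 (Lit 1)) (Seq (Assign 13 (Lit 1)) (Seq (Assign 7 (Lit 0))
     (While (Less (Reg 7) (Reg 2)) (Seq (Assign 22 (Reg 13)) (Seq (Assign 12 (Mul (Reg 12) (Reg 4)))
       (Seq (Assign 13 (Mul (Reg 13) (Mul (Lit 2) (Reg 1)))) (Assign 7 (Add (Reg 7) (Lit 1)))))))))"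

lemma wp_powers_prog:
  assumes regs: "regs \<sigma> 1 = real m" "regs \<sigma> 2 = real k" "regs \<sigma> 4 = real s" and k: "k \<ge> 1"
  shows "wp I W powers_prog (\<lambda>t \<tau>. unchanged {7, 12, 13, 22} \<sigma> \<tau> \<and> regs \<tau> 12 = real (s ^ k) \<and>
    regs \<tau> 13 = real ((2 * m) ^ k) \<and> regs \<tau> 22 = real ((2 * m) ^ (k - 1))) \<sigma>"
    (is "wp _ _ _ (\<lambda>t. ?Post) _")
proof -
  let ?X = "{7, 12, 13, 22} :: nat set"
  let ?b = "Less (Reg 7) (Reg 2)"
  define Inv where "Inv j \<tau> \<longleftrightarrow> unchanged ?X \<sigma> \<tau> \<and> (\<exists>i. j = k - i \<and> i \<le> k \<and> regs \<tau> 7 = real i \<and>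
    regs \<tau> 12 = real (s ^ i) \<and> regs \<tau> 13 = real ((2 * m) ^ i) \<and> (i > 0 \<longrightarrow> regs \<tau> 22 = real ((2 * m) ^ (i - 1))))" for j \<tau>
  let ?body = "Seq (Assign 22 (Reg 13)) (Seq (Assign 12 (Mul (Reg 12) (Reg 4)))
       (Seq (Assign 13 (Mul (Reg 13) (Mul (Lit 2) (Reg 1)))) (Assign 7 (Add (Reg 7) (Lit 1)))))"
  have step: "wp I W ?body (\<lambda>t \<tau>'. \<exists>j'<j. Inv j' \<tau>') \<tau>" if inv: "Inv j \<tau>" and h: "holds I \<tau> ?b" for j \<tau>
  proof -
    obtain i where u: "unchanged ?X \<sigma> \<tau>" and i: "j = k - i" "regs \<tau> 7 = real i"
      "regs \<tau> 12 = real (s ^ i)" "regs \<tau> 13 = real ((2 * m) ^ i)"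
      using inv unfolding Inv_def by blast
    have r: "regs \<tau> 1 = real m" "regs \<tau> 2 = real k" "regs \<tau> 4 = real s" using u regs by (auto simp: unchanged_def)
    have lt: "i < k" using h i r by simp
    have "Inv (k - Suc i) (\<tau>\<lparr>regs := (regs \<tau>)(22 := real ((2 * m) ^ i), 12 := real (s ^ i) * real s,
        13 := real ((2 * m) ^ i) * (2 * real m), 7 := real i + 1)\<rparr>)"
      unfolding Inv_def using u lt by (intro conjI exI[of _ "Suc i"]) (auto simp: unchanged_def)
    then have "\<exists>j'<j. Inv j' (\<tau>\<lparr>regs := (regs \<tau>)(22 := real ((2 * m) ^ i), 12 := real (s ^ i) * real s,
        13 := real ((2 * m) ^ i) * (2 * real m), 7 := real i + 1)\<rparr>)"
      using i lt by (intro exI[of _ "k - Suc i"]) auto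
    then show ?thesis
      by (intro wp_Seq wp_Assign) (simp add: i r r(1)[unfolded One_nat_def] del: of_nat_mult of_nat_power)
  qed
  define \<sigma>1 where "\<sigma>1 = \<sigma>\<lparr>regs := (regs \<sigma>)(12 := 1, 13 := 1, 7 := 0)\<rparr>"
  have init: "Inv k \<sigma>1"
    unfolding Inv_def by (intro conjI exI[of _ 0]) (auto simp: \<sigma>1_def unchanged_def)
  have "wp I W (While ?b ?body) (\<lambda>t. ?Post) \<sigma>1"
  proof (rule wp_While_measure[of Inv, OF init step])
    fix j \<tau>
    assume inv: "Inv j \<tau>" and h: "\<not> holds I \<tau> ?b"
    obtain i where u: "unchanged ?X \<sigma> \<tau>" and i: "i \<le> k" "regs \<tau> 7 = real i"
      "regs \<tau> 12 = real (s ^ i)" "regs \<tau> 13 = real ((2 * m) ^ i)" "i > 0 \<longrightarrow> regs \<tau> 22 = real ((2 * m) ^ (i - 1))"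
      using inv unfolding Inv_def by blast
    have "regs \<tau> 2 = real k" using u regs by (auto simp: unchanged_def)
    then have "i = k" using h i by simp
    then show "?Post \<tau>"
      using u i k by auto
  qed
  then show ?thesis
    unfolding powers_prog_def
    by (intro wp_Seq[of _ _ "Assign _ _"] wp_Assign) (simp add: \<sigma>1_def)
qed

definition params_prog :: prog where
  "params_prog = Seq (Store (Lit 0) (Reg 0)) (Seq (Store (Lit 1) (Reg 3)) (Seq (Store (Lit 2) (Reg 4))
     (Seq (Store (Lit 3) (Reg 12)) (Seq (Store (Lit 4) (Mul (Lit 2) (Reg 1)))
     (Seq (Store (Lit 5) (Mul (Sub (Mul (Lit 2) (Reg 1)) (Lit 1)) (Reg 22))) (Seq (Store (Lit 6) (Reg 13))
     (Seq (Store (Lit 7) (Reg 14)) (Assign 0 (Add (Lit 8) (Mul (Lit 2) (Reg 0)))))))))))"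

definition prep_prog :: "nat \<Rightarrow> prog" where
  "prep_prog d = Seq (Assign 11 (Add (divE (Reg 1) (Reg 2)) (Lit 1))) (Seq (Assign 4 (Mul (Lit (int (4 * d))) (Reg 11)))
     (Seq powers_prog (Seq (search_prog d) (Seq sort_prog params_prog))))"

lemma wp_prep_prog:
  fixes Ps :: "'d::finite curve list"
  assumes k: "1 \<le> k" "k \<le> m" and w: "w = m div k + 1" and s: "s = 4 * CARD('d) * w"
    and z0: "0 < z0" "\<forall>p<length Ps. \<exists>t. covered s r w (s ^ k) z0 (Ps ! p) t"
    and n: "n = length Ps"
  shows "wp (enc_curves Ps) UNIV (prep_prog CARD('d)) (\<lambda>t \<tau>. regs \<tau> 0 = real (8 + 2 * n) \<and>
    (\<exists>z K. z \<le> z0 \<and> stores_keys (mem \<tau>) Ps s r w (s ^ k) z K \<and> stores_params (mem \<tau>) n m k s z r))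
    (prep_state n m k r \<omega>)"
    (is "wp _ _ _ (\<lambda>t. ?Post) _")
proof -
  let ?I = "enc_curves Ps"
  define Post where "Post = ?Post"
  have w0: "w > 0" and s2: "2 \<le> s" using w s zero_less_card_finite[where 'a='d] by (auto simp del: zero_less_card_finite)
  have B: "s ^ k > 1" using s2 k by (metis Suc_1 Suc_le_lessD one_less_power not_one_le_zero not_gr_zero)
  define \<sigma>0 where "\<sigma>0 = prep_state n m k r \<omega>"
  define \<sigma>1 where "\<sigma>1 = \<sigma>0\<lparr>regs := (regs \<sigma>0)(11 := real w, 4 := real s)\<rparr>"
  have r1: "regs \<sigma>1 0 = real n" "regs \<sigma>1 1 = real m" "regs \<sigma>1 2 = real k" "regs \<sigma>1 3 = r" "regs \<sigma>1 4 = real s"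
    "regs \<sigma>1 11 = real w"
    by (auto simp: \<sigma>1_def \<sigma>0_def prep_state_def)
  have addr: "addr 0 = 0" "addr 1 = 1" "addr (numeral v) = numeral v" for v
    by (simp_all add: addr_def)
  have Y0: "(2 * real m - 1) * real ((2 * m) ^ (k - 1)) = real ((2 * m - 1) * (2 * m) ^ (k - 1))"
    using k by (simp add: of_nat_diff)
  have final: "wp ?I UNIV params_prog (\<lambda>t. Post) \<sigma>4"
    if u2: "unchanged {7, 12, 13, 22} \<sigma>1 \<sigma>2"
      and r2: "regs \<sigma>2 12 = real (s ^ k)" "regs \<sigma>2 13 = real ((2 * m) ^ k)" "regs \<sigma>2 22 = real ((2 * m) ^ (k - 1))"
      and u3: "same_regs {5, 6, 7, 8, 9, 10, 14, 15, 16, 17, 18, 27, 29} \<sigma>2 \<sigma>3"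
      and z: "regs \<sigma>3 14 = real z" "z \<le> z0" and keys: "\<forall>p<n. key_of s r w (s ^ k) z (Ps ! p) (K p)"
      and u4: "same_regs {7, 16, 24, 27} \<sigma>3 \<sigma>4"
      and mem: "\<forall>p<n. mem \<sigma>4 (8 + key_rank n K p) = K p \<and> mem \<sigma>4 (8 + n + key_rank n K p) = real p"
    for \<sigma>2 \<sigma>3 \<sigma>4 z K
  proof -
    have r4: "regs \<sigma>4 0 = real n" "regs \<sigma>4 1 = real m" "regs \<sigma>4 3 = r" "regs \<sigma>4 4 = real s"
      "regs \<sigma>4 12 = real (s ^ k)" "regs \<sigma>4 13 = real ((2 * m) ^ k)" "regs \<sigma>4 22 = real ((2 * m) ^ (k - 1))"
      "regs \<sigma>4 14 = real z"
      using u2 u3 u4 r1 r2 z by (auto simp: unchanged_def same_regs_def)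
    define M where "M = (mem \<sigma>4)(0 := real n, 1 := r, 2 := real s, 3 := real (s ^ k), 4 := 2 * real m,
      5 := (2 * real m - 1) * real ((2 * m) ^ (k - 1)), 6 := real ((2 * m) ^ k), 7 := real z)"
    \<comment> \<open>The parameters occupy the eight cells below the table, so storing them last
      leaves the sorted keys intact.\<close>
    have ge: "M (8 + a) = mem \<sigma>4 (8 + a)" for a by (simp add: M_def)
    have M: "M 0 = real n" "M 1 = r" "M 2 = real s" "M 3 = real (s ^ k)" "M 4 = 2 * real m"
      "M 5 = (2 * real m - 1) * real ((2 * m) ^ (k - 1))" "M 6 = real ((2 * m) ^ k)" "M 7 = real z"
      by (simp_all add: M_def)
    have cells: "stores_keys M Ps s r w (s ^ k) z K"
      unfolding stores_keys_def n[symmetric] using keys mem ge by (simp add: add.assoc)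
    define \<tau> where "\<tau> = \<sigma>4\<lparr>mem := M, regs := (regs \<sigma>4)(0 := 8 + 2 * real n)\<rparr>"
    have \<tau>: "mem \<tau> = M" "regs \<tau> 0 = real (8 + 2 * n)" by (simp_all add: \<tau>_def)
    have "M 4 = real (2 * m)" using M(5) by simp
    then have "stores_params M n m k s z r"
      unfolding stores_params_def using M(1-4,7,8) M(6)[unfolded Y0] by blast
    then have "Post \<tau>" unfolding Post_def \<tau> using z(2) cells by blast
    have "wp ?I UNIV params_prog (\<lambda>t \<upsilon>. \<upsilon> = \<tau>) \<sigma>4"
      unfolding params_prog_def
      apply (rule wp_Seq, rule wp_Store, simp, simp add: addr r4 r4(2)[unfolded One_nat_def] del: of_nat_mult of_nat_power)+
      apply (rule wp_Assign)
      apply (simp add: r4 M_def \<tau>_def del: of_nat_mult of_nat_power)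
      done
    then show ?thesis using \<open>Post \<tau>\<close> by (auto elim: wp_mono)
  qed
  have "wp ?I UNIV (Seq powers_prog (Seq (search_prog CARD('d)) (Seq sort_prog params_prog))) (\<lambda>t. Post) \<sigma>1"
  proof (intro wp_Seq[of _ _ powers_prog], rule wp_mono[OF wp_powers_prog[OF r1(2,3,5) k(1)]],
      elim conjE, intro wp_Seq[of _ _ "search_prog _"])
    fix \<sigma>2
    assume u2: "unchanged {7, 12, 13, 22} \<sigma>1 \<sigma>2"
      and r2: "regs \<sigma>2 12 = real (s ^ k)" "regs \<sigma>2 13 = real ((2 * m) ^ k)" "regs \<sigma>2 22 = real ((2 * m) ^ (k - 1))"
    have r2': "regs \<sigma>2 0 = real (length Ps)" "regs \<sigma>2 3 = r" "regs \<sigma>2 4 = real s" "regs \<sigma>2 11 = real w"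
      using u2 r1 n by (auto simp: unchanged_def)
    show "wp ?I UNIV (search_prog CARD('d)) (\<lambda>t \<tau>. wp ?I UNIV (Seq sort_prog params_prog) (\<lambda>t. Post) \<tau>) \<sigma>2"
    proof (rule wp_mono[OF wp_search_prog[OF r2' r2(1) w0 B z0]], elim conjE exE, intro wp_Seq[of _ _ sort_prog])
      fix \<sigma>3 z
      assume u3: "same_regs {5, 6, 7, 8, 9, 10, 14, 15, 16, 17, 18, 27, 29} \<sigma>2 \<sigma>3"
        and z: "regs \<sigma>3 14 = real z" "z \<le> z0"
        and keys: "\<forall>p<length Ps. key_of s r w (s ^ k) z (Ps ! p) (mem \<sigma>3 (8 + 2 * length Ps + p))"
      define K where "K p = mem \<sigma>3 (8 + 2 * n + p)" for p
      have K: "\<forall>i<n. mem \<sigma>3 (8 + 2 * n + i) = K i" by (simp add: K_def)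
      have keys': "\<forall>p<n. key_of s r w (s ^ k) z (Ps ! p) (K p)" using keys by (simp add: K_def n)
      have r3: "regs \<sigma>3 0 = real n" using u3 r2' n by (simp add: same_regs_def)
      show "wp ?I UNIV sort_prog (\<lambda>t \<tau>. wp ?I UNIV params_prog (\<lambda>t. Post) \<tau>) \<sigma>3"
        by (rule wp_mono[OF wp_sort_prog[OF K r3]]) (use final[OF u2 r2 u3 z keys'] in blast)
    qed
  qed
  moreover have "eval ?I \<sigma>0 (divE (Reg 1) (Reg 2)) = real (m div k)"
    by (rule eval_divE) (auto simp: \<sigma>0_def prep_state_def)
  ultimately have "wp ?I UNIV (prep_prog CARD('d)) (\<lambda>t. Post) \<sigma>0"
    unfolding prep_prog_def
    by (intro wp_Seq[of _ _ "Assign _ _"] wp_Assign) (simp add: \<sigma>1_def w s algebra_simps)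
  then show ?thesis by (simp only: Post_def \<sigma>0_def)
qed

section \<open>The data structure\<close>

lemma curve_code_eq_walk_code_iff:
  "curve_code s r w P x = walk_code s r Q x' es \<longleftrightarrow>
    remdups_adj (map (curve_elem s r w P x) [0..<length P]) =
    remdups_adj (map (walk_elem s r x' Q) (walk (length Q) 0 0 es))"
  for P Q :: "'d::finite curve"
  unfolding curve_code_def walk_code_def
  by (rule seq_code_eq_iff[where d = "CARD('d)"]) (auto simp: curve_elem_def walk_elem_def)

text \<open>\<open>x\<close> and \<open>x'\<close> are unrelated: the query may hit a key made with
  another shift vector.\<close>

lemma walk_code_sound:
  fixes P Q :: "'d::finite curve"
  assumes "curve_code s r w P x = walk_code s r Q x' es" "valid_walk k m es" "k \<ge> 1"
    "P \<noteq> []" "Q \<noteq> []" "length Q \<le> m" "r > 0" "s > 0"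
  shows "frechet_dist P Q \<le> real CARD('d) * (real s * r)"
proof (rule frechet_dist_le_of_corners[of P Q r s es m])
  show "remdups_adj (map (\<lambda>i. vcorner s r (x div s ^ (i div w) mod s) (P ! i)) [0..<length P]) =
    remdups_adj (map (\<lambda>(q, b). vcorner s r (x' div s ^ b mod s) (Q ! q)) (walk (length Q) 0 0 es))"
    using assms(1) unfolding curve_code_eq_walk_code_iff by (simp add: curve_elem_def[abs_def] walk_elem_def)
qed (use assms in \<open>auto simp: valid_walk_def\<close>)

text \<open>Here both codes use the same \<open>x\<close>. If it suits \<open>P\<close>, every
  matched pair has equal corners, and the matching itself supplies the walk.\<close>

lemma walk_code_complete:
  fixes P Q :: "'d::finite curve"
  assumes "curve_ok s r w P x" "frechet_dist P Q \<le> r" "r > 0" "P \<noteq> []" "Q \<noteq> []" "length Q \<le> m"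
    "\<forall>i<length P. i div w < k"
  shows "\<exists>es. valid_walk k m es \<and> curve_code s r w P x = walk_code s r Q x es"
proof -
  have "fr (\<lambda>i q. norm (P ! i - Q ! q) \<le> r) [0..<length P] [0..<length Q]"
    using assms by (simp add: frechet_dist_le_iff)
  from fr_walk[OF this, where w = w and k = k and m = m and s = s and J = "\<lambda>b. x div s ^ b mod s"]
  obtain es where "valid_walk k m es"
    "remdups_adj (map (\<lambda>i. vcorner s r (x div s ^ (i div w) mod s) (P ! i)) [0..<length P]) =
     remdups_adj (map (\<lambda>(q, b). vcorner s r (x div s ^ b mod s) (Q ! q)) (walk (length Q) 0 0 es))"
    using assms unfolding curve_ok_def valid_walk_def by auto
  then show ?thesis
    unfolding curve_code_eq_walk_code_iff by (auto simp: curve_elem_def[abs_def] walk_elem_def)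
qed

text \<open>The block length \<open>m div k + 1\<close> exceeds \<open>m\<close> / \<open>k\<close>,
  so \<open>k\<close> blocks reach beyond index \<open>m\<close>.\<close>

lemma block_less:
  fixes k m i :: nat
  assumes "1 \<le> k" "i < m"
  shows "i div (m div k + 1) < k"
proof -
  have "m < k * (m div k + 1)" using dividend_less_times_div[of k m] assms by simp
  then show ?thesis using assms by (simp add: div_less_iff_less_mult)
qed

text \<open>\<open>A P b\<close> collects the shifts that put all vertices of block \<open>b\<close>
  inside their cells, and by the choice of \<open>s\<close> it contains at least half of the shifts.
  The two options for \<open>L\<close> count the curves or their patterns.\<close>

lemma exists_covering:
  fixes S :: "'d::finite curve set"
  assumes "finite S" "\<forall>P\<in>S. length P \<le> m" "1 \<le> k" "w = m div k + 1" "s = 4 * CARD('d) * w"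
    and L: "card S < 2 ^ L \<or> L = s * k + 1"
  shows "\<exists>z. 0 < z \<and> z < (s ^ k) ^ (2 ^ k * L + 1) \<and> (\<forall>P\<in>S. \<exists>t. covered s r w (s ^ k) z P t)"
proof -
  define A where "A P b = {j \<in> {..<s}. \<forall>i\<in>{i. i < length P \<and> i div w = b}. vinside s r j (P ! i)}"
    for P :: "'d curve" and b
  have "0 < CARD('d)" by simp
  then have s: "2 \<le> s" using assms(4,5) by (cases "CARD('d)") auto
  have w: "0 < w" using assms(4) by simp
  have half: "s \<le> 2 * card (A P b)" for P b
    unfolding A_def
  proof (rule card_vinside_ge)
    \<comment> \<open>A block is part of an interval of \<open>w\<close> indices, which gives the
      cardinality bound that \<open>s\<close> was chosen for.\<close>
    have "{i. i < length P \<and> i div w = b} \<subseteq> {b * w..<b * w + w}"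
    proof
      fix i assume "i \<in> {i. i < length P \<and> i div w = b}"
      then have "i div w = b" by simp
      then show "i \<in> {b * w..<b * w + w}"
        using w div_mult_mod_eq[of i w] mod_less_divisor[OF w, of i] by auto
    qed
    then have "card {i. i < length P \<and> i div w = b} \<le> card {b * w..<b * w + w}"
      by (intro card_mono) auto
    then show "4 * CARD('d) * card {i. i < length P \<and> i div w = b} \<le> s"
      unfolding assms(5) by (intro mult_le_mono2) simp
  qed (use s in auto)
  have sub: "A P b \<subseteq> {..<s}" for P b by (auto simp: A_def)
  have block: "i div w < k" if "P \<in> S" "i < length P" for P i
    using block_less[OF assms(3), of i m] assms(2) that unfolding assms(4) by force
  have "\<exists>z. 0 < z \<and> z < (s ^ k) ^ (2 ^ k * L + 1) \<and>
    (\<forall>P\<in>S. \<exists>t. 0 < z div (s ^ k) ^ t \<and> (\<forall>b<k. (z div (s ^ k) ^ t mod s ^ k) div s ^ b mod s \<in> A P b))"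
    by (rule exists_shift_numeral[OF assms(1) s assms(3) L]) (rule sub, rule half)
  then obtain z where z: "0 < z" "z < (s ^ k) ^ (2 ^ k * L + 1)"
    "\<forall>P\<in>S. \<exists>t. 0 < z div (s ^ k) ^ t \<and> (\<forall>b<k. (z div (s ^ k) ^ t mod s ^ k) div s ^ b mod s \<in> A P b)"
    by (elim exE conjE) (rule that)
  have "\<exists>t. covered s r w (s ^ k) z P t" if P: "P \<in> S" for P
  proof -
    obtain t where t: "0 < z div (s ^ k) ^ t"
      "\<forall>b<k. (z div (s ^ k) ^ t mod s ^ k) div s ^ b mod s \<in> A P b"
      using bspec[OF z(3) P] by (elim exE conjE) (rule that)
    have "curve_ok s r w P (z div (s ^ k) ^ t mod s ^ k)"
      unfolding curve_ok_def
    proof (intro allI impI)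
      fix i assume i: "i < length P"
      then have "(z div (s ^ k) ^ t mod s ^ k) div s ^ (i div w) mod s \<in> A P (i div w)"
        using t(2) block[OF P i] by blast
      then show "vinside s r ((z div (s ^ k) ^ t mod s ^ k) div s ^ (i div w) mod s) (P ! i)"
        using i unfolding A_def by blast
    qed
    then show ?thesis using t(1) unfolding covered_def by blast
  qed
  then show ?thesis using z(1,2) by (intro exI[of _ z]) simp
qed

lemma query_correct:
  fixes Ps :: "'d::finite curve list" and Q :: "'d curve"
  assumes k: "1 \<le> k" "k \<le> m" and w: "w = m div k + 1" and s: "s = 4 * CARD('d) * w" and r: "r > 0"
    and n: "n = length Ps" "1 \<le> n" "n \<le> 2 ^ l" and Ps: "\<forall>P\<in>set Ps. 1 \<le> length P \<and> length P \<le> m"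
    and Q: "1 \<le> length Q" "length Q \<le> m" and z: "z < (s ^ k) ^ T"
    and keys: "stores_keys D Ps s r w (s ^ k) z K" and params: "stores_params D n m k s z r"
  shows "\<exists>t \<tau>. exec (enc_curve Q) W (query_prog CARD('d)) \<lparr>regs = \<lambda>_. 0, mem = D, tape = \<eta>\<rparr> t \<tau> \<and>
    t \<le> T * ((2 * m) ^ (k - 1) * ((k + m) * (vcost CARD('d) + 65) + l * 30 + 80) + 30) + 40 \<and>
    correct_answer Ps (real CARD('d) * real s) r Q (regs \<tau> 0)"
proof -
  define Good where "Good v \<longleftrightarrow> (\<exists>i<length Ps. v = real i \<and> frechet_dist (Ps ! i) Q \<le> real CARD('d) * real s * r)" for v
  have "0 < CARD('d)" by simp
  then have s2: "2 \<le> s" using w s by (cases "CARD('d)") auto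
  note cells = keys[unfolded stores_keys_def n(1)[symmetric]]
  have key_rank: "\<exists>p<n. i = key_rank n K p" if "i < n" for i
  proof -
    have "i \<in> key_rank n K ` {..<n}" using bij_betw_imp_surj_on[OF key_rank_bij[of n K]] that by simp
    then show ?thesis by auto
  qed
  have block: "i div w < k" if "P \<in> set Ps" "i < length P" for P i
    using block_less[OF k(1), of i m] Ps that unfolding w by force
  \<comment> \<open>\<open>Good\<close> positions are those of curves within the promised distance.
    Sortedness comes from the ranks, and \<open>sound\<close> from the fact that each stored key is
    the code of its curve for some shift vector.\<close>
  interpret run: query_run Q "enc_curve Q" W D "\<lambda>i. D (8 + i)" "\<lambda>i. D (8 + n + i)" n m k s z l r Good
  proof
    show "\<forall>i j. i \<le> j \<longrightarrow> j < n \<longrightarrow> D (8 + i) \<le> D (8 + j)"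
    proof (intro allI impI)
      fix i j assume ij: "i \<le> j" "j < n"
      obtain p q where "p < n" "i = key_rank n K p" "q < n" "j = key_rank n K q"
        using key_rank[of i] key_rank[of j] ij by auto
      then show "D (8 + i) \<le> D (8 + j)" using cells key_rank_mono[of p n q K] ij by simp
    qed
    show "Good (D (8 + n + i))" if es: "valid_walk k m es" and i: "i < n" and eq: "D (8 + i) = walk_code s r Q x es" for x es i
    proof -
      obtain p where p: "p < n" "i = key_rank n K p" using key_rank[OF i] by blast
      have "key_of s r w (s ^ k) z (Ps ! p) (K p)" using cells p by blast
      then obtain x' where "K p = curve_code s r w (Ps ! p) x'" unfolding key_of_def by blast
      then have "curve_code s r w (Ps ! p) x' = walk_code s r Q x es" using cells p eq by simp
      moreover have "Ps ! p \<in> set Ps" using p n by simp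
      ultimately have "frechet_dist (Ps ! p) Q \<le> real CARD('d) * (real s * r)"
        using Ps Q k r s2 es by (intro walk_code_sound[of s r w _ x' Q x es k m]) fastforce+
      then show ?thesis unfolding Good_def using p cells n by (intro exI[of _ p]) (simp add: mult.assoc)
    qed
  qed (use k s2 n Q params in \<open>auto simp: has_curve_enc_curve\<close>)
  obtain t \<tau> where ex: "exec (enc_curve Q) W (query_prog CARD('d)) \<lparr>regs = \<lambda>_. 0, mem = D, tape = \<eta>\<rparr> t \<tau>"
    and t: "t \<le> T * run.round_cost + 40"
    and hits: "\<forall>t es. 0 < z div (s ^ k) ^ t \<longrightarrow> valid_walk k m es \<longrightarrow> run.hit (z div (s ^ k) ^ t mod s ^ k) es \<longrightarrow> Good (regs \<tau> 0)"
    using run.wp_query_prog[OF z] unfolding wp_def by blast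
  have "Good (regs \<tau> 0)" if P: "P \<in> set Ps" "frechet_dist P Q \<le> r" for P
  proof -
    from P(1) obtain p where "p < length Ps" "Ps ! p = P" by (auto simp: in_set_conv_nth)
    then have p: "p < n" "P = Ps ! p" using n(1) by auto
    obtain t where t: "covered s r w (s ^ k) z P t" "K p = curve_code s r w P (z div (s ^ k) ^ t mod s ^ k)"
      using cells p unfolding key_of_def by blast
    obtain es where es: "valid_walk k m es" "K p = walk_code s r Q (z div (s ^ k) ^ t mod s ^ k) es"
      using walk_code_complete[of s r w P "z div (s ^ k) ^ t mod s ^ k" Q m k] t P r Q Ps block[OF P(1)]
      unfolding covered_def by fastforce
    have "key_rank n K p < n" using bij_betwE[OF key_rank_bij[of n K]] p by auto
    then have "run.hit (z div (s ^ k) ^ t mod s ^ k) es"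
      unfolding run.hit_def using es cells p by (intro exI[of _ "key_rank n K p"]) simp
    then show ?thesis using hits t es unfolding covered_def by blast
  qed
  then have "correct_answer Ps (real CARD('d) * real s) r Q (regs \<tau> 0)"
    unfolding correct_answer_def Good_def by blast
  moreover have "run.round_cost = (2 * m) ^ (k - 1) * ((k + m) * (vcost CARD('d) + 65) + l * 30 + 80) + 30"
    by (simp add: run.round_cost_def run.probe_cost_def)
  ultimately show ?thesis using ex t by auto
qed

text \<open>If the answer is correct for all random choices, the whole product space serves as the
  event, with probability 1. Determinism of \<open>exec\<close> carries the claim from one exhibited
  run to all runs in the definition.\<close>

lemma near_neighbor_structureI:
  fixes Ps :: "'d::finite curve list"
  assumes "\<And>\<omega>. \<exists>D s. builds pre Ps m k r \<omega> D s \<and> real s \<le> space_bd \<and>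
      (\<forall>Q :: 'd curve. 1 \<le> length Q \<and> length Q \<le> m \<longrightarrow> (\<forall>\<eta> junk. \<exists>t \<tau>.
         exec (enc_curve Q) {a. s \<le> a \<and> real (Suc a) \<le> space_bd} qry (query_state D s junk \<eta>) t \<tau> \<and>
         real t \<le> time_bd \<and> correct_answer Ps c r Q (regs \<tau> 0)))"
    and "p \<le> 1"
  shows "near_neighbor_structure pre qry Ps m k r c space_bd time_bd p"
  unfolding near_neighbor_structure_def
proof (intro conjI ballI allI impI)
  fix \<omega>
  show "\<exists>D s. builds pre Ps m k r \<omega> D s \<and> real s \<le> space_bd \<and>
        (\<forall>Q. 1 \<le> length Q \<and> length Q \<le> m \<longrightarrow>
          (\<forall>\<eta>\<in>space tapes. \<forall>junk. \<exists>t \<tau>.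
             exec (enc_curve (Q :: 'd curve)) {a. s \<le> a \<and> real (Suc a) \<le> space_bd} qry
               (query_state D s junk \<eta>) t \<tau> \<and> real t \<le> time_bd))"
    using assms(1)[of \<omega>] by meson
next
  fix Q :: "'d curve"
  assume Q: "1 \<le> length Q \<and> length Q \<le> m"
  interpret prob_space tapes by (rule prob_space_tapes)
  interpret pair_prob_space tapes tapes ..
  let ?E = "space (tapes \<Otimes>\<^sub>M tapes)"
  have "measure (tapes \<Otimes>\<^sub>M tapes) ?E = 1" by (rule P.prob_space)
  moreover have "correct_answer Ps c r Q (regs \<tau> 0)"
    if b: "builds pre Ps m k r \<omega> D s"
      and e: "exec (enc_curve Q) {a. s \<le> a \<and> real (Suc a) \<le> space_bd} qry (query_state D s junk \<eta>) t \<tau>"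
    for \<omega> \<eta> D s junk t \<tau>
  proof -
    obtain D' s' where b': "builds pre Ps m k r \<omega> D' s'"
      and q: "\<forall>\<eta> junk. \<exists>t \<tau>. exec (enc_curve Q) {a. s' \<le> a \<and> real (Suc a) \<le> space_bd} qry (query_state D' s' junk \<eta>) t \<tau> \<and>
         real t \<le> time_bd \<and> correct_answer Ps c r Q (regs \<tau> 0)"
      using assms(1)[of \<omega>] Q by meson
    have "D' = D \<and> s' = s"
      using b b' unfolding builds_def by (metis exec_deterministic of_nat_eq_iff)
    then show ?thesis using q e exec_deterministic by metis
  qed
  ultimately show "\<exists>E\<in>sets (tapes \<Otimes>\<^sub>M tapes). p \<le> measure (tapes \<Otimes>\<^sub>M tapes) E \<and>
          (\<forall>(\<omega>, \<eta>)\<in>E. \<forall>D s junk t \<tau>. builds pre Ps m k r \<omega> D s \<longrightarrow>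
             exec (enc_curve Q) {a. s \<le> a \<and> real (Suc a) \<le> space_bd} qry (query_state D s junk \<eta>) t \<tau> \<longrightarrow>
             correct_answer Ps c r Q (regs \<tau> 0))"
    using assms(2) by (intro bexI[of _ ?E]) auto
qed

section \<open>Bounds on time, space and approximation factor\<close>

lemma ex_log_bound:
  assumes "2 \<le> n"
  shows "\<exists>L. n < 2 ^ L \<and> real L \<le> 2 * log 2 (real n) \<and> 1 \<le> L"
proof -
  define L where "L = Suc (nat \<lfloor>log 2 (real n)\<rfloor>)"
  have ge1: "1 \<le> log 2 (real n)" using assms by (simp add: le_log_iff)
  have L: "real L = of_int \<lfloor>log 2 (real n)\<rfloor> + 1" using ge1 by (simp add: L_def)
  have "log 2 (real n) < real L" unfolding L by linarith
  then have "real n < 2 powr real L" using assms by (simp add: log_less_iff)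
  then have "real n < real (2 ^ L)" by (simp add: powr_realpow)
  then have "n < 2 ^ L" by (simp only: of_nat_less_iff)
  moreover have "real L \<le> 2 * log 2 (real n)" unfolding L using ge1 by linarith
  moreover have "1 \<le> L" by (simp add: L_def)
  ultimately show ?thesis by blast
qed

text \<open>With \<open>L = min L1 L2\<close>, the product of \<open>L\<close> and a sum of order
  \<open>m + L1\<close> is bounded termwise: \<open>L \<le> L1\<close> is used next to
  \<open>m\<close>, and \<open>L \<le> L2\<close>, of order \<open>m\<close>, next to
  \<open>L1\<close>. Both terms become multiples of \<open>m * L1\<close>.\<close>

lemma query_time_bound:
  assumes k: "1 \<le> k" "k \<le> m" and L: "1 \<le> L1" "L = min L1 L2" "L2 \<le> 9 * d * m" "1 \<le> L2"
  shows "(2 ^ k * L + 1) * ((2 * m) ^ (k - 1) * ((k + m) * V + L1 * 30 + 80) + 30) + 40 \<le>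
    (2 * V + 270 * d + 150) * (2 ^ (2 * k) * m ^ k * L1)"
proof -
  define X where "X = (2 * m) ^ (k - 1)"
  have X1: "1 \<le> X" using k by (simp add: X_def Suc_le_eq)
  have m1: "1 \<le> m" using k by simp
  have "(k + m) * V + L1 * 30 + 80 + 30 \<le> m * (2 * V + 110) + L1 * 30"
  proof -
    have "(k + m) * V \<le> (2 * m) * V" using k by (intro mult_le_mono1) simp
    moreover have "110 \<le> m * 110" using m1 by simp
    moreover have "m * (2 * V + 110) = (2 * m) * V + m * 110" by (simp add: algebra_simps)
    ultimately show ?thesis by linarith
  qed
  then have "X * ((k + m) * V + L1 * 30 + 80) + 30 \<le> X * (m * (2 * V + 110) + L1 * 30)"
  proof -
    assume a: "(k + m) * V + L1 * 30 + 80 + 30 \<le> m * (2 * V + 110) + L1 * 30"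
    have "X * ((k + m) * V + L1 * 30 + 80) + 30 \<le> X * ((k + m) * V + L1 * 30 + 80) + X * 30"
      using X1 by simp
    also have "\<dots> = X * ((k + m) * V + L1 * 30 + 80 + 30)" by (simp add: algebra_simps)
    also have "\<dots> \<le> X * (m * (2 * V + 110) + L1 * 30)" using a by (rule mult_le_mono2)
    finally show ?thesis .
  qed
  \<comment> \<open>The additional digit of \<open>z\<close>, its marker, is absorbed by a factor
    2.\<close>
  moreover have "2 ^ k * L + 1 \<le> 2 ^ k * (2 * L)"
  proof -
    have "1 \<le> L" using L by simp
    then have "1 \<le> 2 ^ k * L" by simp
    then show ?thesis by simp
  qed
  ultimately have "(2 ^ k * L + 1) * (X * ((k + m) * V + L1 * 30 + 80) + 30) \<le>
      (2 ^ k * (2 * L)) * (X * (m * (2 * V + 110) + L1 * 30))"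
    by (intro mult_le_mono)
  also have "\<dots> = 2 ^ k * 2 * X * (L * (m * (2 * V + 110) + L1 * 30))" by (simp add: algebra_simps)
  also have "\<dots> \<le> 2 ^ k * 2 * X * (m * L1 * (2 * V + 110 + 270 * d))"
  proof (rule mult_le_mono2)
    have "L * (m * (2 * V + 110)) \<le> L1 * (m * (2 * V + 110))" using L by (intro mult_le_mono1) simp
    moreover have "L * (L1 * 30) \<le> (9 * d * m) * (L1 * 30)" using L by (intro mult_le_mono1) simp
    moreover have "L * (m * (2 * V + 110) + L1 * 30) = L * (m * (2 * V + 110)) + L * (L1 * 30)"
      by (rule distrib_left)
    moreover have "m * L1 * (2 * V + 110 + 270 * d) = L1 * (m * (2 * V + 110)) + (9 * d * m) * (L1 * 30)"
      by (simp add: algebra_simps)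
    ultimately show "L * (m * (2 * V + 110) + L1 * 30) \<le> m * L1 * (2 * V + 110 + 270 * d)"
      by linarith
  qed
  \<comment> \<open>Powers of two: \<open>k\<close> from the number of shift vectors,
    \<open>k - 1\<close> from the walks and one from the marker add up to
    \<open>2 * k\<close>.\<close>
  also have "2 ^ k * 2 * X * (m * L1 * (2 * V + 110 + 270 * d)) = 2 ^ (2 * k) * m ^ k * L1 * (2 * V + 110 + 270 * d)"
  proof -
    obtain k' where k': "k = Suc k'" using k by (cases k) auto
    have "X = 2 ^ k' * m ^ k'" unfolding X_def k' by (simp add: power_mult_distrib)
    moreover have "(2 :: nat) ^ (2 * k) = 2 ^ k * 2 * 2 ^ k'" unfolding k' by (simp add: mult_2 power_add)
    moreover have "m ^ k = m ^ k' * m" unfolding k' by simp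
    ultimately show ?thesis by (simp only: mult_ac)
  qed
  finally have "(2 ^ k * L + 1) * (X * ((k + m) * V + L1 * 30 + 80) + 30) \<le>
    2 ^ (2 * k) * m ^ k * L1 * (2 * V + 110 + 270 * d)" .
  moreover have "40 \<le> 2 ^ (2 * k) * m ^ k * L1 * 40"
  proof -
    have "1 \<le> 2 ^ (2 * k) * m ^ k * L1" using m1 L by (simp add: Suc_le_eq)
    then show ?thesis by simp
  qed
  moreover have "(2 * V + 270 * d + 150) * (2 ^ (2 * k) * m ^ k * L1) =
    2 ^ (2 * k) * m ^ k * L1 * (2 * V + 110 + 270 * d) + 2 ^ (2 * k) * m ^ k * L1 * 40"
    by (simp add: algebra_simps)
  ultimately show ?thesis unfolding X_def by linarith
qed

theorem near_neighbor_structure_frechet: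
  fixes Ps :: "'d::finite curve list"
  assumes n: "n = length Ps" "2 \<le> n" "distinct Ps" and Ps: "\<forall>P\<in>set Ps. 1 \<le> length P \<and> length P \<le> m"
    and r: "r > 0" and k: "1 \<le> k" "k \<le> m"
  shows "near_neighbor_structure (prep_prog CARD('d)) (query_prog CARD('d)) Ps m k r
    (real CARD('d) * real (4 * CARD('d) * (m div k + 1)))
    (6 * (2 ^ (2 * k) * real m ^ (k - 1) * real n * log 2 (real n) + real n * real m))
    (2 * real (2 * (vcost CARD('d) + 65) + 270 * CARD('d) + 150) * (2 ^ (2 * k) * real m ^ k * log 2 (real n)))
    (1 - 1 / real n)"
proof (rule near_neighbor_structureI)
  fix \<omega>
  define w where "w = m div k + 1"
  define s where "s = 4 * CARD('d) * w"
  obtain L1 where L1: "n < 2 ^ L1" "real L1 \<le> 2 * log 2 (real n)" "1 \<le> L1"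
    using ex_log_bound[OF n(2)] by blast
  define L2 where "L2 = s * k + 1"
  define L where "L = min L1 L2"
  have cardS: "card (set Ps) = n" using n distinct_card by blast
  have "card (set Ps) < 2 ^ L \<or> L = s * k + 1" using L1(1) cardS by (auto simp: L_def L2_def min_def)
  from exists_covering[OF _ _ k(1) w_def s_def this, of r] Ps
  obtain z0 where z0: "0 < z0" "z0 < (s ^ k) ^ (2 ^ k * L + 1)" "\<forall>P\<in>set Ps. \<exists>t. covered s r w (s ^ k) z0 P t"
    by auto
  \<comment> \<open>The constant 9 is 8 + 1: \<open>(m div k + 1) * k\<close> is at most
    \<open>2 * m\<close>, which is multiplied by \<open>4 * CARD('d)\<close>, and the additive 1 is
    at most \<open>CARD('d) * m\<close>.\<close>
  have L2: "L2 \<le> 9 * CARD('d) * m" "1 \<le> L2"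
  proof -
    have "m div k * k \<le> m" by simp
    moreover have "(m div k + 1) * k = m div k * k + k" by simp
    ultimately have "(m div k + 1) * k \<le> 2 * m" using k by linarith
    then have "4 * CARD('d) * ((m div k + 1) * k) \<le> 4 * CARD('d) * (2 * m)" by (rule mult_le_mono2)
    moreover have "1 \<le> CARD('d) * m" using k by (simp add: Suc_le_eq)
    moreover have "L2 = 4 * CARD('d) * ((m div k + 1) * k) + 1"
      unfolding L2_def s_def w_def by (simp only: mult.assoc)
    moreover have "9 * CARD('d) * m = 4 * CARD('d) * (2 * m) + CARD('d) * m" by simp
    ultimately show "L2 \<le> 9 * CARD('d) * m" by linarith
  qed (simp add: L2_def)
  obtain t0 \<tau>0 where ex: "exec (enc_curves Ps) UNIV (prep_prog CARD('d)) (prep_state n m k r \<omega>) t0 \<tau>0"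
    and r0: "regs \<tau>0 0 = real (8 + 2 * n)" and "\<exists>z K. z \<le> z0 \<and>
      stores_keys (mem \<tau>0) Ps s r w (s ^ k) z K \<and> stores_params (mem \<tau>0) n m k s z r"
    using wp_prep_prog[OF k w_def s_def z0(1) _ n(1), of r \<omega>] z0(3) unfolding wp_def by auto
  then obtain z K where z: "z \<le> z0" and keys: "stores_keys (mem \<tau>0) Ps s r w (s ^ k) z K"
    and params: "stores_params (mem \<tau>0) n m k s z r"
    by blast
  let ?space = "6 * (2 ^ (2 * k) * real m ^ (k - 1) * real n * log 2 (real n) + real n * real m)"
  let ?time = "2 * real (2 * (vcost CARD('d) + 65) + 270 * CARD('d) + 150) * (2 ^ (2 * k) * real m ^ k * log 2 (real n))"
  have b: "builds (prep_prog CARD('d)) Ps m k r \<omega> (mem \<tau>0) (8 + 2 * n)"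
    unfolding builds_def using ex r0 n(1) by blast
  \<comment> \<open>For \<open>n \<ge> 2\<close>, \<open>8 + 2 * n\<close> is at most
    \<open>6 * n\<close>, hence already within the summand \<open>6 * n * m\<close>.\<close>
  have space: "real (8 + 2 * n) \<le> ?space"
  proof -
    have key: "real (8 + 2 * n) \<le> 6 * (X + Y)" if "0 \<le> X" "real n \<le> Y" for X Y :: real
      using that n(2) by simp
    have "0 \<le> log 2 (real n)" using n(2) by simp
    moreover have "real n * 1 \<le> real n * real m" using k by (intro mult_left_mono) auto
    ultimately show ?thesis by (intro key) simp_all
  qed
  have query: "\<exists>t \<tau>. exec (enc_curve Q) {a. 8 + 2 * n \<le> a \<and> real (Suc a) \<le> ?space} (query_prog CARD('d))
      (query_state (mem \<tau>0) (8 + 2 * n) junk \<eta>) t \<tau> \<and> real t \<le> ?time \<and>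
      correct_answer Ps (real CARD('d) * real (4 * CARD('d) * (m div k + 1))) r Q (regs \<tau> 0)"
    if Q: "1 \<le> length Q \<and> length Q \<le> m" for Q :: "'d curve" and \<eta> junk
  proof -
    \<comment> \<open>The memory seen by the query. The parameters and the sorted table lie below
      \<open>8 + 2 * n\<close>, where \<open>D\<close> agrees with the result of preprocessing, so
      both storage conditions carry over whatever \<open>junk\<close> is.\<close>
    define D where "D = (\<lambda>a. if a < 8 + 2 * n then mem \<tau>0 a else junk a)"
    have rk: "key_rank n K p < n" if "p < n" for p using bij_betwE[OF key_rank_bij[of n K]] that by auto
    have keysD: "stores_keys D Ps s r w (s ^ k) z K"
      unfolding stores_keys_def n(1)[symmetric]
    proof (intro allI impI)
      fix p assume p: "p < n"
      then have "D (8 + key_rank n K p) = mem \<tau>0 (8 + key_rank n K p)"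
        "D (8 + n + key_rank n K p) = mem \<tau>0 (8 + n + key_rank n K p)"
        using rk[OF p] by (simp_all add: D_def)
      then show "key_of s r w (s ^ k) z (Ps ! p) (K p) \<and>
        D (8 + key_rank n K p) = K p \<and> D (8 + n + key_rank n K p) = real p"
        using keys p unfolding stores_keys_def n(1)[symmetric] by simp
    qed
    have "D a = mem \<tau>0 a" if "a < 8" for a using that by (simp add: D_def)
    then have paramsD: "stores_params D n m k s z r" using params unfolding stores_params_def by simp
    have zT: "z < (s ^ k) ^ (2 ^ k * L + 1)" using z z0(2) by simp
    have n1: "1 \<le> n" "n \<le> 2 ^ L1" using n(2) L1(1) by simp_all
    obtain t \<tau> where e: "exec (enc_curve Q) {a. 8 + 2 * n \<le> a \<and> real (Suc a) \<le> ?space} (query_prog CARD('d))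
        \<lparr>regs = \<lambda>_. 0, mem = D, tape = \<eta>\<rparr> t \<tau>"
      and t: "t \<le> (2 ^ k * L + 1) * ((2 * m) ^ (k - 1) * ((k + m) * (vcost CARD('d) + 65) + L1 * 30 + 80) + 30) + 40"
      and c: "correct_answer Ps (real CARD('d) * real s) r Q (regs \<tau> 0)"
      using query_correct[OF k w_def s_def r n(1) n1 Ps conjunct1[OF Q] conjunct2[OF Q] zT keysD paramsD,
        where W = "{a. 8 + 2 * n \<le> a \<and> real (Suc a) \<le> ?space}" and \<eta> = \<eta>]
      by (elim exE conjE) (rule that)
    let ?C = "2 * (vcost CARD('d) + 65) + 270 * CARD('d) + 150"
    have "t \<le> ?C * (2 ^ (2 * k) * m ^ k * L1)"
      using t query_time_bound[OF k L1(3) L_def L2, of "vcost CARD('d) + 65"] by (rule le_trans)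
    then have "real t \<le> real (?C * (2 ^ (2 * k) * m ^ k * L1))" by (simp only: of_nat_le_iff)
    also have "\<dots> = real ?C * (2 ^ (2 * k) * real m ^ k * real L1)"
      by (simp only: of_nat_mult of_nat_power of_nat_numeral)
    also have "\<dots> \<le> real ?C * (2 ^ (2 * k) * real m ^ k * (2 * log 2 (real n)))"
      using L1(2) by (intro mult_left_mono) auto
    also have "\<dots> = ?time" by (simp only: mult_ac)
    finally have "real t \<le> ?time" .
    then show ?thesis using e c unfolding query_state_def D_def s_def w_def by blast
  qed
  show "\<exists>D s. builds (prep_prog CARD('d)) Ps m k r \<omega> D s \<and> real s \<le> ?space \<and>
      (\<forall>Q :: 'd curve. 1 \<le> length Q \<and> length Q \<le> m \<longrightarrow> (\<forall>\<eta> junk. \<exists>t \<tau>.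
         exec (enc_curve Q) {a. s \<le> a \<and> real (Suc a) \<le> ?space} (query_prog CARD('d)) (query_state D s junk \<eta>) t \<tau> \<and>
         real t \<le> ?time \<and>
         correct_answer Ps (real CARD('d) * real (4 * CARD('d) * (m div k + 1))) r Q (regs \<tau> 0)))"
    by (rule exI[of _ "mem \<tau>0"], rule exI[of _ "8 + 2 * n"]) (intro conjI b space allI impI query; elim conjE; assumption)
qed (use n in simp)

text \<open>Since \<open>k \<le> m\<close>, the additive 1 is itself at most \<open>m\<close> /
  \<open>k\<close>.\<close>

lemma approx_factor_bound:
  assumes "1 \<le> k" "k \<le> m"
  shows "real (m div k + 1) \<le> 2 * (real m / real k)"
proof -
  have "real (m div k) \<le> real m / real k" by (rule of_nat_div_le_of_nat)
  moreover have "1 \<le> real m / real k" using assms by simp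
  ultimately show ?thesis by simp
qed

theorem mainTheorem2:
  shows "\<exists>(pre :: prog) (qry :: prog) (c :: nat \<Rightarrow> nat \<Rightarrow> real) (C\<^sub>c :: real) (C\<^sub>s :: real) (C\<^sub>t :: real).
    (\<forall>m k. 1 \<le> k \<and> k \<le> m \<longrightarrow> \<bar>c m k\<bar> \<le> C\<^sub>c * (real m / real k)) \<and>
    (\<forall>(S :: (real ^ 'd::finite) list set) (n :: nat) (m :: nat) (k :: nat) (r :: real) Ps.
       finite S \<and> card S = n \<and> n \<ge> 2 \<and>
       (\<forall>P\<in>S. 1 \<le> length P \<and> length P \<le> m) \<and>
       r > 0 \<and> 1 \<le> k \<and> k \<le> m \<and>
       set Ps = S \<and> distinct Ps \<longrightarrow>
       near_neighbor_structure pre qry Ps m k r (c m k)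
         (C\<^sub>s * (2 ^ (2 * k) * real m ^ (k - 1) * real n * log 2 (real n) + real n * real m))
         (C\<^sub>t * (2 ^ (2 * k) * real m ^ k * log 2 (real n)))
         (1 - 1 / real n))"
proof -
  let ?d = "CARD('d)"
  let ?c = "\<lambda>m k. real ?d * real (4 * ?d * (m div k + 1))"
  let ?Ct = "2 * real (2 * (vcost ?d + 65) + 270 * ?d + 150)"
  have approx: "\<bar>?c m k\<bar> \<le> (8 * real ?d * real ?d) * (real m / real k)" if "1 \<le> k \<and> k \<le> m" for m k
  proof -
    have "\<bar>?c m k\<bar> = (4 * real ?d * real ?d) * real (m div k + 1)" by (simp add: abs_mult algebra_simps)
    also have "\<dots> \<le> (4 * real ?d * real ?d) * (2 * (real m / real k))"
      using approx_factor_bound[of k m] that by (intro mult_left_mono) auto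
    finally show ?thesis by simp
  qed
  have ds: "near_neighbor_structure (prep_prog ?d) (query_prog ?d) Ps m k r (?c m k)
         (6 * (2 ^ (2 * k) * real m ^ (k - 1) * real n * log 2 (real n) + real n * real m))
         (?Ct * (2 ^ (2 * k) * real m ^ k * log 2 (real n)))
         (1 - 1 / real n)"
    if "finite S \<and> card S = n \<and> n \<ge> 2 \<and> (\<forall>P\<in>S. 1 \<le> length P \<and> length P \<le> m) \<and>
       r > 0 \<and> 1 \<le> k \<and> k \<le> m \<and> set Ps = S \<and> distinct Ps"
    for S :: "(real ^ 'd) list set" and n m k r Ps
  proof (rule near_neighbor_structure_frechet)
    show "n = length Ps" using that distinct_card by metis
  qed (use that in auto)
  show ?thesis
    by (rule exI[of _ "prep_prog ?d"], rule exI[of _ "query_prog ?d"], rule exI[of _ ?c],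
        rule exI[of _ "8 * real ?d * real ?d"], rule exI[of _ 6], rule exI[of _ ?Ct])
      (intro conjI allI impI; (erule approx | erule ds))
qed

end
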